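(* Given an $\alpha$-approximation algorithm for knapsack orienteering with knapsack deadlines (Knap-OrientKD), one can obtain an $O(\alpha)$-approximation algorithm for 2CorrKO.
   Context: CorrKO: a finite metric $(V,d)$ with integer distances, root $\rho$, travel budget $B$, processing budget $W$; each vertex $v$ has random integer size $S_v\ge0$ and correlated random reward $R_v\ge0$, independent across vertices; a policy starts at $\rho$ and visits distinct vertices, processing jobs non-preemptively with $(S_v,R_v)$ revealed on completion; if it visits $\rho=v_0,\dots,v_\ell$ then $\sum_{i}d(v_{i-1},v_i)\le B$ and $\sum_{i=1}^{\ell-1}S_{v_i}\le W$, and the reward of $v_i$ is collected iff $\sum_{h\le i}S_{v_h}\le W$; approximation is relative to the optimal adaptive policy. 2CorrKO is CorrKO where each $S_v$ is supported on at most two values. OrientKD (rooted): metric $(V,d)$, root $\rho$, budget $B$, rewards $\pi_v\ge0$, knapsack weights $\mathrm{wt}_v\ge0$ and knapsack deadlines $\mathrm{KD}_v$; a path $P$ starting at $\rho$ is feasible if $d(P)\le B$ and $\sum_{u\in P_{\rho,v}}\mathrm{wt}_u\le \mathrm{KD}_v$ for every $v\in P$ ($P_{\rho,v}$ is the $\rho$-$v$ portion of $P$); maximize $\sum_{v\in P}\pi_v$. Knap-OrientKD additionally has nonnegative weights $b_v$ and a budget $T$, requiring $\sum_{v\in P}b_v\le T$. *)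

theory Defs
  imports
    "HOL-Probability.Probability"
    "HOL-Library.Log_Nat"
    "HOL-Computational_Algebra.Polynomial"
begin

section \<open>Algorithms with an oracle\<close>

text \<open>
  Algorithms are programs of a small first-order functional language over binary trees whose
  leaves are rational numbers in binary. Evaluating an expression is charged one unit plus the
  bit size of its value, on top of the charges for its subexpressions; in particular large
  intermediate numbers, copied data and oracle answers are all paid for, so "polynomial cost"
  agrees with polynomial time on an oracle Turing machine that pays for writing its queries and
  reading the answers.
\<close>

datatype val = Num rat | Pair val val

definition rat_size :: "rat \<Rightarrow> nat" where
  "rat_size x = (case quotient_of x of (a, b) \<Rightarrow> nat (bitlen \<bar>a\<bar>) + nat (bitlen b))"

primrec val_size :: "val \<Rightarrow> nat" where
  "val_size (Num x) = 1 + rat_size x"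
| "val_size (Pair u v) = 1 + val_size u + val_size v"

text \<open>All basic operations are total; on arguments of the wrong shape they default to 0.\<close>

primrec val_num :: "val \<Rightarrow> rat" where
  "val_num (Num x) = x"
| "val_num (Pair u v) = 0"

primrec val_fst :: "val \<Rightarrow> val" where
  "val_fst (Num x) = Num 0"
| "val_fst (Pair u v) = u"

primrec val_snd :: "val \<Rightarrow> val" where
  "val_snd (Num x) = Num 0"
| "val_snd (Pair u v) = v"

primrec val_is_num :: "val \<Rightarrow> rat" where
  "val_is_num (Num x) = 1"
| "val_is_num (Pair u v) = 0"

datatype arith = Add | Sub | Mul | Div | Less

primrec arith_sem :: "arith \<Rightarrow> rat \<Rightarrow> rat \<Rightarrow> rat" where
  "arith_sem Add x y = x + y"
| "arith_sem Sub x y = x - y"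
| "arith_sem Mul x y = x * y"
| "arith_sem Div x y = x / y"
| "arith_sem Less x y = (if x < y then 1 else 0)"

text \<open>Variables are de Bruijn indices. A program is a list of bodies of unary, mutually
  recursive functions; the body of a function is evaluated in the environment consisting of its
  argument, and the program is started by calling function 0.\<close>

datatype expr =
    EVar nat
  | ENum rat
  | ECons expr expr
  | EFst expr
  | ESnd expr
  | EIsNum expr
  | EArith arith expr expr
  | EIf expr expr expr
  | ELet expr expr
  | ECall nat expr
  | EOracle expr

type_synonym program = "expr list"

text \<open>\<open>evaluates p orc env e v t\<close>: with oracle \<open>orc\<close>, expression \<open>e\<close> evaluates to \<open>v\<close> at cost \<open>t\<close>.\<close>

inductive evaluates :: "program \<Rightarrow> (val \<Rightarrow> val) \<Rightarrow> val list \<Rightarrow> expr \<Rightarrow> val \<Rightarrow> nat \<Rightarrow> bool"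
  for p :: program and orc :: "val \<Rightarrow> val" where
  Var: "i < length env \<Longrightarrow> evaluates p orc env (EVar i) (env ! i) (1 + val_size (env ! i))"
| Lit: "evaluates p orc env (ENum x) (Num x) (1 + val_size (Num x))"
| Cons: "evaluates p orc env e1 v1 t1 \<Longrightarrow> evaluates p orc env e2 v2 t2 \<Longrightarrow>
    evaluates p orc env (ECons e1 e2) (Pair v1 v2) (1 + t1 + t2 + val_size (Pair v1 v2))"
| Fst: "evaluates p orc env e v t \<Longrightarrow>
    evaluates p orc env (EFst e) (val_fst v) (1 + t + val_size (val_fst v))"
| Snd: "evaluates p orc env e v t \<Longrightarrow>
    evaluates p orc env (ESnd e) (val_snd v) (1 + t + val_size (val_snd v))"
| IsNum: "evaluates p orc env e v t \<Longrightarrow>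
    evaluates p orc env (EIsNum e) (Num (val_is_num v)) (1 + t + val_size (Num (val_is_num v)))"
| Arith: "evaluates p orc env e1 v1 t1 \<Longrightarrow> evaluates p orc env e2 v2 t2 \<Longrightarrow>
    w = Num (arith_sem f (val_num v1) (val_num v2)) \<Longrightarrow>
    evaluates p orc env (EArith f e1 e2) w (1 + t1 + t2 + val_size w)"
| IfTrue: "evaluates p orc env c u t0 \<Longrightarrow> val_num u \<noteq> 0 \<Longrightarrow> evaluates p orc env e1 v t \<Longrightarrow>
    evaluates p orc env (EIf c e1 e2) v (1 + t0 + t + val_size v)"
| IfFalse: "evaluates p orc env c u t0 \<Longrightarrow> val_num u = 0 \<Longrightarrow> evaluates p orc env e2 v t \<Longrightarrow>
    evaluates p orc env (EIf c e1 e2) v (1 + t0 + t + val_size v)"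
| Let: "evaluates p orc env e1 u t1 \<Longrightarrow> evaluates p orc (u # env) e2 v t2 \<Longrightarrow>
    evaluates p orc env (ELet e1 e2) v (1 + t1 + t2 + val_size v)"
| Call: "evaluates p orc env e u t1 \<Longrightarrow> f < length p \<Longrightarrow> evaluates p orc [u] (p ! f) v t2 \<Longrightarrow>
    evaluates p orc env (ECall f e) v (1 + t1 + t2 + val_size v)"
| Oracle: "evaluates p orc env e u t \<Longrightarrow>
    evaluates p orc env (EOracle e) (orc u) (1 + t + val_size (orc u))"

inductive_cases evaluates_elims:
  "evaluates p orc env (EVar i) v t" "evaluates p orc env (ENum x) v t" "evaluates p orc env (ECons e1 e2) v t"
  "evaluates p orc env (EFst e) v t" "evaluates p orc env (ESnd e) v t" "evaluates p orc env (EIsNum e) v t"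
  "evaluates p orc env (EArith f e1 e2) v t" "evaluates p orc env (EIf c e1 e2) v t"
  "evaluates p orc env (ELet e1 e2) v t" "evaluates p orc env (ECall f e) v t"
  "evaluates p orc env (EOracle e) v t"

lemma evaluates_deterministic:
  "evaluates p orc env e v t \<Longrightarrow> evaluates p orc env e v' t' \<Longrightarrow> v' = v \<and> t' = t"
proof (induction arbitrary: v' t' rule: evaluates.induct)
  case Var
  from Var.prems show ?case by (rule evaluates_elims) simp_all
next
  case Lit
  from Lit.prems show ?case by (rule evaluates_elims) simp_all
next
  case Cons
  from Cons.prems show ?case by (rule evaluates_elims) (use Cons.hyps in \<open>auto dest!: Cons.IH\<close>)
next
  case Fst
  from Fst.prems show ?case by (rule evaluates_elims) (use Fst.hyps in \<open>auto dest!: Fst.IH\<close>)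
next
  case Snd
  from Snd.prems show ?case by (rule evaluates_elims) (use Snd.hyps in \<open>auto dest!: Snd.IH\<close>)
next
  case IsNum
  from IsNum.prems show ?case by (rule evaluates_elims) (use IsNum.hyps in \<open>auto dest!: IsNum.IH\<close>)
next
  case Arith
  from Arith.prems show ?case by (rule evaluates_elims) (use Arith.hyps in \<open>auto dest!: Arith.IH\<close>)
next
  case IfTrue
  from IfTrue.prems show ?case by (rule evaluates_elims) (use IfTrue.hyps in \<open>auto dest!: IfTrue.IH\<close>)
next
  case IfFalse
  from IfFalse.prems show ?case by (rule evaluates_elims) (use IfFalse.hyps in \<open>auto dest!: IfFalse.IH\<close>)
next
  case Let
  from Let.prems show ?case by (rule evaluates_elims) (use Let.hyps in \<open>auto dest!: Let.IH\<close>)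
next
  case Call
  from Call.prems show ?case by (rule evaluates_elims) (use Call.hyps in \<open>auto dest!: Call.IH\<close>)
next
  case Oracle
  from Oracle.prems show ?case by (rule evaluates_elims) (use Oracle.hyps in \<open>auto dest!: Oracle.IH\<close>)
qed

definition run :: "program \<Rightarrow> (val \<Rightarrow> val) \<Rightarrow> val \<Rightarrow> val \<Rightarrow> nat \<Rightarrow> bool" where
  "run p orc x y t \<longleftrightarrow> p \<noteq> [] \<and> evaluates p orc [x] (p ! 0) y t"

subsection \<open>Encodings\<close>

definition enc_nat :: "nat \<Rightarrow> val" where
  "enc_nat n = Num (of_nat n)"

primrec enc_list :: "('a \<Rightarrow> val) \<Rightarrow> 'a list \<Rightarrow> val" where
  "enc_list f [] = Num 0"
| "enc_list f (x # xs) = Pair (f x) (enc_list f xs)"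

primrec enc_option :: "('a \<Rightarrow> val) \<Rightarrow> 'a option \<Rightarrow> val" where
  "enc_option f None = Num 0"
| "enc_option f (Some x) = Pair (f x) (Num 0)"

definition enc_pair :: "('a \<Rightarrow> val) \<Rightarrow> ('b \<Rightarrow> val) \<Rightarrow> 'a \<times> 'b \<Rightarrow> val" where
  "enc_pair f g z = Pair (f (fst z)) (g (snd z))"

definition enc_vector :: "('a \<Rightarrow> val) \<Rightarrow> nat \<Rightarrow> (nat \<Rightarrow> 'a) \<Rightarrow> val" where
  "enc_vector f n a = enc_list f (map a [0..<n])"

definition enc_matrix :: "('a \<Rightarrow> val) \<Rightarrow> nat \<Rightarrow> (nat \<Rightarrow> nat \<Rightarrow> 'a) \<Rightarrow> val" where
  "enc_matrix f n a = enc_vector (enc_vector f n) n a"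

section \<open>Orienteering with knapsack deadlines\<close>

text \<open>In all problems the vertex set is \<open>{..<n}\<close>.\<close>

fun path_length :: "(nat \<Rightarrow> nat \<Rightarrow> 'a::comm_monoid_add) \<Rightarrow> nat list \<Rightarrow> 'a" where
  "path_length d (u # v # xs) = d u v + path_length d (v # xs)"
| "path_length d _ = 0"

record orientkd =
  ok_n :: nat
  ok_dist :: "nat \<Rightarrow> nat \<Rightarrow> rat"
  ok_root :: nat
  ok_budget :: rat
  ok_reward :: "nat \<Rightarrow> rat"
  ok_wt :: "nat \<Rightarrow> rat"
  ok_kd :: "nat \<Rightarrow> rat"

record knap_orientkd = orientkd +
  ok_b :: "nat \<Rightarrow> rat"
  ok_T :: rat

definition orientkd_wf :: "'a orientkd_scheme \<Rightarrow> bool" where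
  "orientkd_wf J \<longleftrightarrow>
     ok_root J < ok_n J \<and>
     Metric_space {..<ok_n J} (\<lambda>u v. of_rat (ok_dist J u v)) \<and>
     ok_budget J \<ge> 0 \<and>
     (\<forall>v<ok_n J. ok_reward J v \<ge> 0 \<and> ok_wt J v \<ge> 0 \<and> ok_kd J v \<ge> 0)"

definition knap_orientkd_wf :: "knap_orientkd \<Rightarrow> bool" where
  "knap_orientkd_wf J \<longleftrightarrow> orientkd_wf J \<and> (\<forall>v<ok_n J. ok_b J v \<ge> 0) \<and> ok_T J \<ge> 0"

text \<open>A path is the list of its vertices, root included; \<open>take (Suc i) P\<close> is its portion from the
  root to \<open>P ! i\<close>.\<close>

definition orientkd_feasible :: "'a orientkd_scheme \<Rightarrow> nat list \<Rightarrow> bool" where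
  "orientkd_feasible J P \<longleftrightarrow>
     P \<noteq> [] \<and> hd P = ok_root J \<and> distinct P \<and> set P \<subseteq> {..<ok_n J} \<and>
     path_length (ok_dist J) P \<le> ok_budget J \<and>
     (\<forall>i<length P. (\<Sum>u\<leftarrow>take (Suc i) P. ok_wt J u) \<le> ok_kd J (P ! i))"

definition knap_orientkd_feasible :: "knap_orientkd \<Rightarrow> nat list \<Rightarrow> bool" where
  "knap_orientkd_feasible J P \<longleftrightarrow> orientkd_feasible J P \<and> (\<Sum>v\<leftarrow>P. ok_b J v) \<le> ok_T J"

definition orientkd_value :: "'a orientkd_scheme \<Rightarrow> nat list \<Rightarrow> rat" where
  "orientkd_value J P = (\<Sum>v\<leftarrow>P. ok_reward J v)"

definition enc_knap_orientkd :: "knap_orientkd \<Rightarrow> val" where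
  "enc_knap_orientkd J = enc_list id
     [enc_nat (ok_n J), enc_matrix Num (ok_n J) (ok_dist J), enc_nat (ok_root J),
      Num (ok_budget J), enc_vector Num (ok_n J) (ok_reward J), enc_vector Num (ok_n J) (ok_wt J),
      enc_vector Num (ok_n J) (ok_kd J), enc_vector Num (ok_n J) (ok_b J), Num (ok_T J)]"

text \<open>The input/output behaviour of an \<open>\<alpha>\<close>-approximation algorithm. Nothing is promised on inputs
  that do not encode a feasible instance (an instance is infeasible iff the trivial path
  violates the deadline of the root or the knapsack constraint).\<close>

definition knap_orientkd_approx :: "real \<Rightarrow> (val \<Rightarrow> val) \<Rightarrow> bool" where
  "knap_orientkd_approx \<alpha> orc \<longleftrightarrow>
     (\<forall>J. knap_orientkd_wf J \<and> (\<exists>Q. knap_orientkd_feasible J Q) \<longrightarrow>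
       (\<exists>P. orc (enc_knap_orientkd J) = enc_list enc_nat P \<and> knap_orientkd_feasible J P \<and>
         (\<forall>Q. knap_orientkd_feasible J Q \<longrightarrow>
            of_rat (orientkd_value J Q) \<le> \<alpha> * of_rat (orientkd_value J P))))"

section \<open>Correlated knapsack orienteering\<close>

text \<open>An outcome is a pair (size, reward). The joint law of \<open>(S\<^sub>v, R\<^sub>v)\<close> is given explicitly as a
  list of outcomes with their probabilities.\<close>

type_synonym outcome = "nat \<times> rat"

record corrko =
  ck_n :: nat
  ck_dist :: "nat \<Rightarrow> nat \<Rightarrow> nat"
  ck_root :: nat
  ck_B :: nat
  ck_W :: nat
  ck_job :: "nat \<Rightarrow> (outcome \<times> rat) list"

definition ck_joblist :: "corrko \<Rightarrow> nat \<Rightarrow> (outcome \<times> real) list" where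
  "ck_joblist I v = map (map_prod id of_rat) (ck_job I v)"

definition ck_law :: "corrko \<Rightarrow> nat \<Rightarrow> outcome pmf" where
  "ck_law I v = pmf_of_list (ck_joblist I v)"

definition corrko_wf :: "corrko \<Rightarrow> bool" where
  "corrko_wf I \<longleftrightarrow>
     ck_root I < ck_n I \<and>
     Metric_space {..<ck_n I} (\<lambda>u v. of_nat (ck_dist I u v)) \<and>
     (\<forall>v<ck_n I. pmf_of_list_wf (ck_joblist I v) \<and> (\<forall>(s, r)\<in>set_pmf (ck_law I v). r \<ge> 0))"

definition two_corrko :: "corrko \<Rightarrow> bool" where
  "two_corrko I \<longleftrightarrow> corrko_wf I \<and> (\<forall>v<ck_n I. card (fst ` set_pmf (ck_law I v)) \<le> 2)"

text \<open>The joint distribution of all \<open>(S\<^sub>v, R\<^sub>v)\<close>, independent across vertices.\<close>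

definition ck_outcomes :: "corrko \<Rightarrow> (nat \<Rightarrow> outcome) pmf" where
  "ck_outcomes I = Pi_pmf {..<ck_n I} (0, 0) (ck_law I)"

text \<open>A (deterministic, adaptive) policy is a decision tree: having processed the job at a vertex,
  it branches on the revealed size and reward. The initial visit of the root is implicit, and no
  job is processed there.\<close>

datatype policy = Stop | Visit nat "outcome \<Rightarrow> policy"

primrec visits :: "policy \<Rightarrow> (nat \<Rightarrow> outcome) \<Rightarrow> nat list" where
  "visits Stop \<omega> = []"
| "visits (Visit v k) \<omega> = v # visits (k (\<omega> v)) \<omega>"

text \<open>With visited vertices \<open>v\<^sub>1, \<dots>, v\<^sub>l\<close> after the root, the last job may overrun the processing
  budget: only the sizes of \<open>v\<^sub>1, \<dots>, v\<^sub>l\<^sub>-\<^sub>1\<close> are constrained.\<close>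

definition corrko_feasible :: "corrko \<Rightarrow> policy \<Rightarrow> bool" where
  "corrko_feasible I \<pi> \<longleftrightarrow>
     (\<forall>\<omega>\<in>set_pmf (ck_outcomes I). let vs = visits \<pi> \<omega> in
        distinct (ck_root I # vs) \<and> set vs \<subseteq> {..<ck_n I} \<and>
        path_length (ck_dist I) (ck_root I # vs) \<le> ck_B I \<and>
        (\<Sum>v\<leftarrow>butlast vs. fst (\<omega> v)) \<le> ck_W I)"

definition collected :: "corrko \<Rightarrow> (nat \<Rightarrow> outcome) \<Rightarrow> nat list \<Rightarrow> rat" where
  "collected I \<omega> vs =
     (\<Sum>i<length vs. if (\<Sum>v\<leftarrow>take (Suc i) vs. fst (\<omega> v)) \<le> ck_W I then snd (\<omega> (vs ! i)) else 0)"

definition corrko_value :: "corrko \<Rightarrow> policy \<Rightarrow> real" where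
  "corrko_value I \<pi> =
     measure_pmf.expectation (ck_outcomes I) (\<lambda>\<omega>. of_rat (collected I \<omega> (visits \<pi> \<omega>)))"

subsection \<open>Approximation algorithms\<close>

text \<open>A program for CorrKO makes the decisions of a policy one by one: its input is the instance
  together with the history of vertices visited and outcomes seen so far, its output the next
  vertex to visit, or \<open>None\<close> to stop. (A program that computes a non-adaptive policy is the special
  case of one that ignores the outcomes, except for stopping when the budget is exhausted.)\<close>

type_synonym history = "(nat \<times> outcome) list"

definition enc_outcome :: "outcome \<Rightarrow> val" where
  "enc_outcome = enc_pair enc_nat Num"

definition enc_corrko :: "corrko \<Rightarrow> val" where
  "enc_corrko I = enc_list id
     [enc_nat (ck_n I), enc_matrix enc_nat (ck_n I) (ck_dist I), enc_nat (ck_root I),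
      enc_nat (ck_B I), enc_nat (ck_W I),
      enc_vector (enc_list (enc_pair enc_outcome Num)) (ck_n I) (ck_job I)]"

definition enc_query :: "corrko \<Rightarrow> history \<Rightarrow> val" where
  "enc_query I h = Pair (enc_corrko I) (enc_list (enc_pair enc_nat enc_outcome) h)"

text \<open>\<open>follows I dec \<pi> h\<close>: from history \<open>h\<close> on, the decisions \<open>dec\<close> are those of \<open>\<pi>\<close>, on every
  history that occurs with positive probability.\<close>

primrec follows ::
  "corrko \<Rightarrow> (history \<Rightarrow> nat option \<Rightarrow> bool) \<Rightarrow> policy \<Rightarrow> history \<Rightarrow> bool" where
  "follows I dec Stop h \<longleftrightarrow> dec h None"
| "follows I dec (Visit v k) h \<longleftrightarrow>
     dec h (Some v) \<and> (\<forall>x\<in>set_pmf (ck_law I v). follows I dec (k x) (h @ [(v, x)]))"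

definition decides ::
  "program \<Rightarrow> (val \<Rightarrow> val) \<Rightarrow> nat poly \<Rightarrow> corrko \<Rightarrow> history \<Rightarrow> nat option \<Rightarrow> bool" where
  "decides p orc q I h a \<longleftrightarrow>
     (\<exists>t. run p orc (enc_query I h) (enc_option enc_nat a) t \<and>
          t \<le> poly q (val_size (enc_query I h)))"

text \<open>With oracle \<open>orc\<close>, the program \<open>p\<close> is a \<open>\<beta>\<close>-approximation algorithm for 2CorrKO, of
  running time bounded by the polynomial \<open>q\<close>.\<close>

definition two_corrko_approx ::
  "real \<Rightarrow> program \<Rightarrow> nat poly \<Rightarrow> (val \<Rightarrow> val) \<Rightarrow> bool" where
  "two_corrko_approx \<beta> p q orc \<longleftrightarrow>
     (\<forall>I. two_corrko I \<longrightarrow>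
       (\<exists>\<pi>. follows I (decides p orc q I) \<pi> [] \<and> corrko_feasible I \<pi> \<and>
         (\<forall>\<sigma>. corrko_feasible I \<sigma> \<longrightarrow> corrko_value I \<sigma> \<le> \<beta> * corrko_value I \<pi>)))"

end

theory Submission
  imports Defs
begin

text \<open>
  Split the reward of a job according to whether its size is at most \<open>W / 2\<close>. The tour of an adaptive
  policy is a random path. By optional stopping, the means of the truncated sizes along it sum to
  \<open>O(W)\<close> in expectation; and a reward of a large outcome is only collected while all previous
  outcomes were small, so that the probabilities of large outcomes at the vertices where one could
  still be collected sum to at most 1 in expectation. Cutting the realized path greedily into blocks
  that are feasible for a Knap-OrientKD instance (one for each part of the reward) therefore bounds
  the optimum by a constant times the optima of the two instances. Conversely, visiting the vertices
  of a feasible path of either instance in order collects at least half of its value in expectation,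
  by Markov's inequality for the small part and by a union bound for the large part. Hence the better
  of the two oracle answers will do. The program stays polynomial because
  \<open>numerator + denominator\<close> is submultiplicative under sums and products of rational numbers.
\<close>

section \<open>Laws of policy traces\<close>

text \<open>The threshold \<open>W / 2\<close> is the point above which no two sizes fit into the
  budget together. For large outcomes it cannot: whether a large reward is collected depends on the
  random sizes of all earlier jobs, whereas a knapsack deadline compares fixed weights. Two sizes
  per job close this gap. A job that can be both small and large takes at least its small size on
  every outcome, and its large size is one number, so every such vertex at which a large reward was
  still within reach meets a fixed deadline. Jobs that are large with certainty escape this
  argument; capping probabilities at the knapsack budget 1/2 lets each of them be a block of its
  own. In the cost analysis, sizes composed along a recursion would grow with its depth. Each
  recursive function therefore comes with a closed form of its result, and the size bound is proved
  for that value at every suffix of the input.\<close>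

lemma expectation_bind_finite:
  fixes h :: "'b \<Rightarrow> real"
  assumes "finite (set_pmf p)" "\<And>x. x \<in> set_pmf p \<Longrightarrow> finite (set_pmf (f x))"
  shows "measure_pmf.expectation (bind_pmf p f) h =
    measure_pmf.expectation p (\<lambda>x. measure_pmf.expectation (f x) h)"
  using assms pmf_expectation_bind[of "set_pmf p" f p h] integral_measure_pmf[of "set_pmf p" p "\<lambda>x. measure_pmf.expectation (f x) h"]
  by auto

lemma expectation_mono_finite:
  fixes f g :: "'a \<Rightarrow> real"
  assumes "finite (set_pmf p)" "\<And>x. x \<in> set_pmf p \<Longrightarrow> f x \<le> g x"
  shows "measure_pmf.expectation p f \<le> measure_pmf.expectation p g"
  using assms by (intro integral_mono_AE) (auto intro: integrable_measure_pmf_finite simp: AE_measure_pmf_iff)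

lemma expectation_cong_set_pmf:
  fixes f g :: "'a \<Rightarrow> real"
  assumes "\<And>x. x \<in> set_pmf p \<Longrightarrow> f x = g x"
  shows "measure_pmf.expectation p f = measure_pmf.expectation p g"
  using assms by (intro integral_cong_AE) (auto simp: AE_measure_pmf_iff)

lemma expectation_add_finite:
  fixes f g :: "'a \<Rightarrow> real"
  assumes "finite (set_pmf p)"
  shows "measure_pmf.expectation p (\<lambda>x. f x + g x) =
    measure_pmf.expectation p f + measure_pmf.expectation p g"
  using assms by (intro Bochner_Integration.integral_add integrable_measure_pmf_finite)

text \<open>The list of a job may name an outcome several times, and the mass function adds up these
  entries. Exchanging the two sums undoes the grouping.\<close>

lemma sum_list_filter_key:
  fixes g :: "'a \<Rightarrow> real"
  assumes "finite A"
  shows "(\<Sum>x\<in>A. sum_list (map snd (filter (\<lambda>z. fst z = x) xs)) * g x) =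
    (\<Sum>z\<leftarrow>filter (\<lambda>z. fst z \<in> A) xs. snd z * g (fst z))"
proof (induction xs)
  case (Cons z xs)
  have "(\<Sum>x\<in>A. sum_list (map snd (filter (\<lambda>z. fst z = x) (z # xs))) * g x) =
     (\<Sum>x\<in>A. (if fst z = x then snd z * g x else 0) +
        sum_list (map snd (filter (\<lambda>z. fst z = x) xs)) * g x)"
    by (intro sum.cong) (auto simp: algebra_simps)
  then show ?case
    using Cons assms by (auto simp: sum.distrib)
qed simp

lemma expectation_pmf_of_list:
  fixes g :: "'a \<Rightarrow> real"
  assumes "pmf_of_list_wf xs"
  shows "measure_pmf.expectation (pmf_of_list xs) g = (\<Sum>z\<leftarrow>xs. snd z * g (fst z))"
proof -
  have "measure_pmf.expectation (pmf_of_list xs) g =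
      (\<Sum>x\<in>set (map fst xs). pmf (pmf_of_list xs) x * g x)"
    using set_pmf_of_list[OF assms] by (subst integral_measure_pmf[of "set (map fst xs)"]) auto
  also have "\<dots> = (\<Sum>z\<leftarrow>filter (\<lambda>z. fst z \<in> set (map fst xs)) xs. snd z * g (fst z))"
    using assms by (subst sum_list_filter_key[symmetric]) (auto simp: pmf_pmf_of_list)
  also have "filter (\<lambda>z. fst z \<in> set (map fst xs)) xs = xs"
    by (rule filter_True) auto
  finally show ?thesis .
qed

text \<open>Entries of probability 0 may occur in a job list without belonging to the support. This
  is why \<open>job_max\<close> tests the probability of an entry.\<close>

lemma set_pmf_of_list_positive:
  assumes "pmf_of_list_wf xs"
  shows "set_pmf (pmf_of_list xs) = {x. \<exists>p>0. (x, p) \<in> set xs}"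
proof (intro set_eqI iffI)
  fix x assume "x \<in> set_pmf (pmf_of_list xs)"
  then have "sum_list (map snd (filter (\<lambda>z. fst z = x) xs)) \<noteq> 0"
    by (simp add: set_pmf_iff pmf_pmf_of_list[OF assms])
  then have "\<exists>z\<in>set (filter (\<lambda>z. fst z = x) xs). snd z \<noteq> 0"
    by (metis (mono_tags, lifting) map_cong sum_list_0)
  then obtain z where "z \<in> set xs" "fst z = x" "snd z \<noteq> 0" by auto
  moreover have "snd z \<ge> 0"
    using assms \<open>z \<in> set xs\<close> by (auto simp: pmf_of_list_wf_def)
  ultimately show "x \<in> {x. \<exists>p>0. (x, p) \<in> set xs}"
    by (cases z) (auto simp: less_le)
next
  fix x assume "x \<in> {x. \<exists>p>0. (x, p) \<in> set xs}"
  then obtain p where p: "p > 0" "(x, p) \<in> set xs" by auto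
  have nn: "\<And>y. y \<in> set (map snd (filter (\<lambda>z. fst z = x) xs)) \<Longrightarrow> 0 \<le> y"
    using assms by (auto simp: pmf_of_list_wf_def)
  have "p \<in> set (map snd (filter (\<lambda>z. fst z = x) xs))"
    using p(2) by force
  then have "p \<le> sum_list (map snd (filter (\<lambda>z. fst z = x) xs))"
    using nn by (rule member_le_sum_list)
  then show "x \<in> set_pmf (pmf_of_list xs)"
    using p by (simp add: set_pmf_iff pmf_pmf_of_list[OF assms])
qed

section \<open>Lists with deadlines and their greedy decomposition\<close>

primrec on_time :: "('a \<Rightarrow> 'b::linordered_field) \<Rightarrow> ('a \<Rightarrow> 'b) \<Rightarrow> 'b \<Rightarrow> 'a list \<Rightarrow> bool" where
  "on_time w k g [] \<longleftrightarrow> True"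
| "on_time w k g (v # vs) \<longleftrightarrow> g \<le> k v \<and> on_time w k (g + w v) vs"

lemma on_time_antimono: "on_time w k g vs \<Longrightarrow> g' \<le> g \<Longrightarrow> on_time w k g' vs"
proof (induction vs arbitrary: g g')
  case (Cons v vs)
  then show ?case using add_right_mono[of g' g "w v"] by (auto intro: order_trans)
qed simp

lemma on_time_subseq:
  assumes "subseq us vs" "on_time w k g vs" "\<And>v. v \<in> set vs \<Longrightarrow> 0 \<le> w v"
  shows "on_time w k g us"
  using assms
proof (induction arbitrary: g rule: list_emb.induct)
  case (list_emb_Cons us vs v)
  then have "on_time w k (g + w v) us" "0 \<le> w v" by auto
  then show ?case by (auto intro: on_time_antimono)
qed auto

text \<open>Two conventions meet here: \<open>on_time\<close> tests the weight strictly before a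
  vertex, while a deadline in OrientKD also counts the weight of the vertex itself. Hence the
  deadlines \<open>k + w\<close> in \<open>deadline_instance\<close>.\<close>

lemma on_time_conv_take:
  "on_time w k g vs \<longleftrightarrow>
    (\<forall>i<length vs. g + (\<Sum>u\<leftarrow>take (Suc i) vs. w u) \<le> k (vs ! i) + w (vs ! i))"
proof (induction vs arbitrary: g)
  case (Cons v vs)
  show ?case unfolding length_Cons All_less_Suc2 by (simp add: Cons add.assoc)
qed simp

lemma on_time_of_rat:
  "on_time (\<lambda>v. of_rat (w v) :: 'b::linordered_field) (\<lambda>v. of_rat (k v)) (of_rat g) vs \<longleftrightarrow> on_time w k g vs"
  by (induction vs arbitrary: g) (auto simp: of_rat_less_eq of_rat_add[symmetric])

lemma greedy_prefix:
  "\<exists>us us'. vs = us @ us' \<and> on_time w (\<lambda>_. \<tau>) g us \<and> (us' = [] \<or> g + (\<Sum>v\<leftarrow>us. w v) > \<tau>)"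
proof (induction vs arbitrary: g)
  case (Cons v vs)
  show ?case
  proof (cases "g > \<tau>")
    case True
    then show ?thesis by (intro exI[of _ "[]"] exI[of _ "v # vs"]) auto
  next
    case False
    obtain us us' where "vs = us @ us'" "on_time w (\<lambda>_. \<tau>) (g + w v) us"
      "us' = [] \<or> g + w v + (\<Sum>v\<leftarrow>us. w v) > \<tau>"
      using Cons[of "g + w v"] by auto
    with False show ?thesis
      by (intro exI[of _ "v # us"] exI[of _ us']) (auto simp: add.assoc)
  qed
qed simp

text \<open>Cut the list greedily into blocks whose weight exceeds \<open>\<tau>\<close> only with their last element.\<close>

lemma reward_le_of_blocks:
  fixes w r :: "'a \<Rightarrow> real"
  assumes "0 < \<tau>" "\<And>v. v \<in> set vs \<Longrightarrow> 0 \<le> w v"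
    and "\<And>us. sublist us vs \<Longrightarrow> on_time w (\<lambda>_. \<tau>) 0 us \<Longrightarrow> (\<Sum>v\<leftarrow>us. r v) \<le> M"
    and "0 \<le> M"
  shows "(\<Sum>v\<leftarrow>vs. r v) \<le> M * (1 + (\<Sum>v\<leftarrow>vs. w v) / \<tau>)"
  using assms(2,3)
proof (induction "length vs" arbitrary: vs rule: less_induct)
  case less
  obtain us us' where us: "vs = us @ us'" "on_time w (\<lambda>_. \<tau>) 0 us"
    "us' = [] \<or> (\<Sum>v\<leftarrow>us. w v) > \<tau>"
    using greedy_prefix[of vs w \<tau> 0] by auto
  have r_us: "(\<Sum>v\<leftarrow>us. r v) \<le> M" using us by (intro less.prems) auto
  have w_us: "0 \<le> (\<Sum>v\<leftarrow>us. w v)" using less.prems(1) us(1) by (intro sum_list_nonneg) auto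
  show ?case
  \<comment> \<open>A block that is not the last one has weight above \<tau> and is charged to that
    weight. The last block may be lighter and is charged to the summand 1.\<close>
  proof (cases "us' = []")
    case True
    with r_us w_us us(1) assms(1,4) show ?thesis
      by (simp add: distrib_left add_increasing2)
  next
    case False
    with us(3) have gt: "(\<Sum>v\<leftarrow>us. w v) > \<tau>" by simp
    with assms(1) have "us \<noteq> []" by auto
    have "(\<Sum>v\<leftarrow>us'. r v) \<le> M * (1 + (\<Sum>v\<leftarrow>us'. w v) / \<tau>)"
      using \<open>us \<noteq> []\<close> us(1) less.prems by (intro less.hyps) (auto simp: sublist_append)
    moreover have "M \<le> M * ((\<Sum>v\<leftarrow>us. w v) / \<tau>)"
      using gt assms(1,4) by (intro mult_left_mono[of 1 _ M, simplified]) auto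
    ultimately show ?thesis using r_us us(1) by (simp add: algebra_simps add_divide_distrib)
  qed
qed

section \<open>Drawing outcomes along the visits of a policy\<close>

primrec trace :: "policy \<Rightarrow> (nat \<Rightarrow> outcome) \<Rightarrow> history" where
  "trace Stop \<omega> = []"
| "trace (Visit v k) \<omega> = (v, \<omega> v) # trace (k (\<omega> v)) \<omega>"

text \<open>Deferred decisions: the outcome of a vertex is drawn only when the vertex is visited, so
  that expectations can be computed by recursion on the decision tree.\<close>

primrec trace_law :: "(nat \<Rightarrow> outcome pmf) \<Rightarrow> policy \<Rightarrow> history pmf" where
  "trace_law L Stop = return_pmf []"
| "trace_law L (Visit v k) = bind_pmf (L v) (\<lambda>x. map_pmf ((#) (v, x)) (trace_law L (k x)))"

lemma visits_conv_trace: "visits \<pi> \<omega> = map fst (trace \<pi> \<omega>)"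
  by (induction \<pi>) auto

lemma trace_conv_visits: "trace \<pi> \<omega> = map (\<lambda>v. (v, \<omega> v)) (visits \<pi> \<omega>)"
  by (induction \<pi>) auto

lemma trace_upd: "v \<notin> set (visits \<pi> (f(v := x))) \<Longrightarrow> trace \<pi> (f(v := x)) = trace \<pi> f"
  by (induction \<pi>) auto

text \<open>By independence the outcome of the first vertex can be drawn before all others. As no
  vertex is visited twice, the rest of the policy never reads that coordinate again
  (\<open>trace_upd\<close>), and the induction continues on the vertex set without it.\<close>

lemma map_trace_Pi_pmf:
  assumes "finite A"
    and "\<And>f. f \<in> set_pmf (Pi_pmf A d L) \<Longrightarrow> distinct (visits \<pi> f) \<and> set (visits \<pi> f) \<subseteq> A"
  shows "map_pmf (trace \<pi>) (Pi_pmf A d L) = trace_law L \<pi>"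
  using assms
proof (induction \<pi> arbitrary: A)
  case Stop
  then show ?case by (simp add: map_pmf_const[symmetric])
next
  case (Visit v k)
  obtain f0 where "f0 \<in> set_pmf (Pi_pmf A d L)" using set_pmf_not_empty by fast
  then have "v \<in> A" using Visit.prems(2) by fastforce
  define A' where "A' = A - {v}"
  have A: "A = insert v A'" "finite A'" "v \<notin> A'" using \<open>v \<in> A\<close> Visit.prems(1) by (auto simp: A'_def)
  have sup: "v \<notin> set (visits (k x) (f(v := x)))"
      "distinct (visits (k x) f)" "set (visits (k x) f) \<subseteq> A'"
      "trace (k x) (f(v := x)) = trace (k x) f"
    if "x \<in> set_pmf (L v)" "f \<in> set_pmf (Pi_pmf A' d L)" for x f
  proof -
    have "f(v := x) \<in> set_pmf (Pi_pmf A d L)"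
      using that A by (auto simp: Pi_pmf_insert)
    moreover have "(f(v := x)) v = x" by simp
    ultimately have *: "v \<notin> set (visits (k x) (f(v := x)))" "distinct (visits (k x) (f(v := x)))"
      "set (visits (k x) (f(v := x))) \<subseteq> A" using Visit.prems(2)[of "f(v := x)"] by (simp_all del: fun_upd_apply)
    then show "v \<notin> set (visits (k x) (f(v := x)))" by simp
    then show t: "trace (k x) (f(v := x)) = trace (k x) f" by (rule trace_upd)
    then show "distinct (visits (k x) f)" "set (visits (k x) f) \<subseteq> A'"
      using * by (auto simp: visits_conv_trace A'_def)
  qed
  have "map_pmf (trace (Visit v k)) (Pi_pmf A d L) =
      bind_pmf (L v) (\<lambda>x. bind_pmf (Pi_pmf A' d L) (\<lambda>f. return_pmf (trace (Visit v k) (f(v := x)))))"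
    using A by (simp add: Pi_pmf_insert' map_bind_pmf)
  also have "\<dots> = bind_pmf (L v) (\<lambda>x. map_pmf ((#) (v, x)) (map_pmf (trace (k x)) (Pi_pmf A' d L)))"
  proof (intro bind_pmf_cong refl)
    fix x assume x: "x \<in> set_pmf (L v)"
    show "bind_pmf (Pi_pmf A' d L) (\<lambda>f. return_pmf (trace (Visit v k) (f(v := x)))) =
        map_pmf ((#) (v, x)) (map_pmf (trace (k x)) (Pi_pmf A' d L))"
      unfolding map_pmf_def bind_assoc_pmf bind_return_pmf
      by (intro bind_pmf_cong refl) (simp add: sup(4)[OF x])
  qed
  also have "\<dots> = bind_pmf (L v) (\<lambda>x. map_pmf ((#) (v, x)) (trace_law L (k x)))"
    using A(2) sup(2,3) by (intro bind_pmf_cong refl) (subst Visit.IH, auto)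
  finally show ?case by (simp only: trace_law.simps)
qed

lemma finite_trace_law: "(\<And>v. finite (set_pmf (L v))) \<Longrightarrow> finite (set_pmf (trace_law L \<pi>))"
  by (induction \<pi>) auto

text \<open>An increment may depend on the size \<open>h\<close> processed on arrival at a vertex
  and on the outcome there. The former is known before the latter is drawn, which is what allows
  conditional means.\<close>

primrec accumulate :: "(nat \<Rightarrow> nat \<Rightarrow> outcome \<Rightarrow> real) \<Rightarrow> nat \<Rightarrow> history \<Rightarrow> real" where
  "accumulate c h [] = 0"
| "accumulate c h (z # tr) = c h (fst z) (snd z) + accumulate c (h + fst (snd z)) tr"

text \<open>Optional stopping: each increment may be replaced by its conditional mean.\<close>

lemma expectation_accumulate:
  assumes fin: "\<And>v. finite (set_pmf (L v))"
  shows "measure_pmf.expectation (trace_law L \<pi>) (accumulate c h) =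
    measure_pmf.expectation (trace_law L \<pi>)
      (accumulate (\<lambda>h v _. measure_pmf.expectation (L v) (c h v)) h)"
proof (induction \<pi> arbitrary: h)
  case (Visit v k)
  have exp: "measure_pmf.expectation (trace_law L (Visit v k)) (accumulate c h) =
    measure_pmf.expectation (L v) (\<lambda>x. c h v x +
      measure_pmf.expectation (trace_law L (k x)) (accumulate c (h + fst x)))" for c h
    by (simp add: expectation_bind_finite fin finite_trace_law expectation_add_finite)
  show ?case
    unfolding exp Visit.IH[OF rangeI]
    by (simp add: expectation_add_finite fin)
qed simp

lemma accumulate_add:
  "accumulate (\<lambda>h v x. f h v x + g h v x) h tr = accumulate f h tr + accumulate g h tr"
  by (induction tr arbitrary: h) auto

lemma accumulate_no_state: "accumulate (\<lambda>_ v x. f v x) h tr = (\<Sum>z\<leftarrow>tr. f (fst z) (snd z))"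
  by (induction tr arbitrary: h) auto

lemma accumulate_mono:
  assumes "\<And>h v x. (v, x) \<in> set tr \<Longrightarrow> c h v x \<le> c' h v x"
  shows "accumulate c h tr \<le> accumulate c' h tr"
  using assms by (induction tr arbitrary: h) (auto intro!: add_mono)

definition collects :: "nat \<Rightarrow> nat \<Rightarrow> nat \<Rightarrow> outcome \<Rightarrow> real" where
  "collects W h v x = (if h + fst x \<le> W then of_rat (snd x) else 0)"

lemma collected_conv_accumulate:
  "of_rat (collected I \<omega> (visits \<pi> \<omega>)) = accumulate (collects (ck_W I)) 0 (trace \<pi> \<omega>)"
proof -
  have "of_rat (\<Sum>i<length vs. if h + (\<Sum>v\<leftarrow>take (Suc i) vs. fst (\<omega> v)) \<le> ck_W I
      then snd (\<omega> (vs ! i)) else 0) = accumulate (collects (ck_W I)) h (map (\<lambda>v. (v, \<omega> v)) vs)" for h vs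
  proof (induction vs arbitrary: h)
    case (Cons v vs)
    have "(\<Sum>i<length vs. if h + (\<Sum>v\<leftarrow>take (Suc (Suc i)) (v # vs). fst (\<omega> v)) \<le> ck_W I
        then snd (\<omega> ((v # vs) ! Suc i)) else 0) =
      (\<Sum>i<length vs. if h + fst (\<omega> v) + (\<Sum>v\<leftarrow>take (Suc i) vs. fst (\<omega> v)) \<le> ck_W I
        then snd (\<omega> (vs ! i)) else 0)"
      by (intro sum.cong) (simp_all add: add.assoc)
    then show ?case
      unfolding length_Cons sum.lessThan_Suc_shift of_rat_add
      using Cons[of "h + fst (\<omega> v)"] by (simp add: collects_def)
  qed simp
  from this[of 0] show ?thesis by (simp add: collected_def trace_conv_visits)
qed

section \<open>The two deadline instances\<close>

text \<open>The statistics of a job are rational expressions in its list because the program has to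
  compute exactly these numbers. \<open>small_reward_eq\<close> and its companions identify them
  with expectations under the law of the job.\<close>

definition job_reward :: "rat \<Rightarrow> (outcome \<times> rat) list \<Rightarrow> rat" where
  "job_reward t xs = (\<Sum>z\<leftarrow>xs. if t < of_nat (fst (fst z)) then 0 else snd z * snd (fst z))"

definition job_tail :: "rat \<Rightarrow> (outcome \<times> rat) list \<Rightarrow> rat" where
  "job_tail t xs = (\<Sum>z\<leftarrow>xs. if t < of_nat (fst (fst z)) then snd z else 0)"

definition job_mean :: "rat \<Rightarrow> (outcome \<times> rat) list \<Rightarrow> rat" where
  "job_mean t xs = (\<Sum>z\<leftarrow>xs. snd z * (if t < of_nat (fst (fst z)) then t else of_nat (fst (fst z))))"

text \<open>Used with \<open>t = W / 2\<close> for the size that a job takes if it stays small, and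
  with \<open>t = W\<close> for the largest size that can be collected at all. The value 0 also
  stands for the absence of such an outcome.\<close>

definition job_max :: "rat \<Rightarrow> (outcome \<times> rat) list \<Rightarrow> rat" where
  "job_max t xs = foldr (\<lambda>z y. if 0 < snd z \<and> \<not> t < of_nat (fst (fst z)) \<and> y < of_nat (fst (fst z))
     then of_nat (fst (fst z)) else y) xs 0"

lemma job_max_nonneg: "0 \<le> job_max t xs"
  by (induction xs) (auto simp: job_max_def)

lemma job_max_upper: "z \<in> set xs \<Longrightarrow> 0 < snd z \<Longrightarrow> of_nat (fst (fst z)) \<le> t \<Longrightarrow> of_nat (fst (fst z)) \<le> job_max t xs"
  by (induction xs) (auto simp: job_max_def)

lemma job_max_attained:
  "job_max t xs = 0 \<or> (\<exists>z\<in>set xs. 0 < snd z \<and> of_nat (fst (fst z)) \<le> t \<and> job_max t xs = of_nat (fst (fst z)))"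
  by (induction xs) (auto simp: job_max_def)

lemma job_max_le: "0 \<le> t \<Longrightarrow> job_max t xs \<le> t"
  using job_max_attained[of t xs] by auto

text \<open>No job is processed at the root, although the instance may list one there. With all data
  of the root set to 0, the trivial path is feasible.\<close>

definition at_vertices :: "corrko \<Rightarrow> ((outcome \<times> rat) list \<Rightarrow> rat) \<Rightarrow> nat \<Rightarrow> rat" where
  "at_vertices I f v = (if v = ck_root I then 0 else f (ck_job I v))"

text \<open>The knapsack budget 1/2 serves the large instance: on a feasible path, every vertex with
  a positive large reward is reached with only small outcomes before it with probability at least
  1/2.\<close>

definition deadline_instance where
  "deadline_instance I r w k b = \<lparr>ok_n = ck_n I, ok_dist = (\<lambda>u v. of_nat (ck_dist I u v)),
     ok_root = ck_root I, ok_budget = of_nat (ck_B I), ok_reward = at_vertices I r,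
     ok_wt = at_vertices I w, ok_kd = at_vertices I (\<lambda>xs. k xs + w xs), ok_b = at_vertices I b,
     ok_T = (1 / 2 :: rat)\<rparr>"

text \<open>For the rewards of outcomes of size at most \<open>W / 2\<close>: the deadlines bound the mean truncated
  size of the jobs \<^emph>\<open>before\<close> each vertex by \<open>(W + 1) / 4\<close>.\<close>

definition small_instance :: "corrko \<Rightarrow> knap_orientkd" where
  "small_instance I = (let W = of_nat (ck_W I) in
     deadline_instance I (job_reward (W / 2)) (job_mean (W + 1)) (\<lambda>_. (W + 1) / 4) (\<lambda>_. 0))"

text \<open>For the rewards of outcomes of larger size: these are only collected as long as all previous
  sizes are at most \<open>W / 2\<close>, so the deadlines refer to the smaller size of each job, and the
  knapsack constraint bounds the probability that some previous size is large.\<close>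

definition large_instance :: "corrko \<Rightarrow> knap_orientkd" where
  "large_instance I = (let W = of_nat (ck_W I) in
     deadline_instance I (\<lambda>xs. job_reward W xs - job_reward (W / 2) xs) (job_max (W / 2))
       (\<lambda>xs. W - job_max W xs) (\<lambda>xs. if 1 / 2 < job_tail (W / 2) xs then 1 / 2 else job_tail (W / 2) xs))"

text \<open>Shortcutting by the triangle inequality. It lets a block from the middle of a run start
  at the root, and lets the eligible vertices be picked out of a run.\<close>

lemma path_length_subseq:
  fixes d :: "nat \<Rightarrow> nat \<Rightarrow> nat"
  assumes tri: "\<And>x y z. x < n \<Longrightarrow> y < n \<Longrightarrow> z < n \<Longrightarrow> d x z \<le> d x y + d y z"
  shows "subseq us vs \<Longrightarrow> u < n \<Longrightarrow> set vs \<subseteq> {..<n} \<Longrightarrow> path_length d (u # us) \<le> path_length d (u # vs)"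
proof (induction vs arbitrary: u us)
  case (Cons v vs)
  show ?case
  proof (cases "\<exists>us'. us = v # us' \<and> subseq us' vs")
    case True
    with Cons show ?thesis by auto
  next
    case False
    with Cons.prems(1) have sub: "subseq us vs"
      by (cases us) (auto split: if_splits)
    have "path_length d (v # us) \<le> path_length d (v # vs)"
      using Cons sub by auto
    moreover have "path_length d (u # us) \<le> d u v + path_length d (v # us)"
    proof (cases us)
      case (Cons x us')
      have "x \<in> set vs" using sub Cons using list_emb_set[of "(=)" us vs x] by auto
      then show ?thesis using tri[of u v x] Cons.prems Cons by auto
    qed simp
    ultimately show ?thesis by simp
  qed
qed (auto dest: list_emb_Nil2)

lemma path_length_of_nat:
  "path_length (\<lambda>u v. of_nat (d u v) :: rat) vs = of_nat (path_length d vs)"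
  by (induction d vs rule: path_length.induct) auto

section \<open>Jobs of an instance as distributions, and the two deadline instances over the
  reals\<close>

locale two_corrko_inst =
  fixes I :: corrko
  assumes two: "two_corrko I"
begin

abbreviation "n \<equiv> ck_n I"
abbreviation "\<rho> \<equiv> ck_root I"
abbreviation "W \<equiv> ck_W I"
abbreviation "law \<equiv> ck_law I"

definition "small_reward v = real_of_rat (job_reward (of_nat W / 2) (ck_job I v))"
definition "large_reward v = real_of_rat (job_reward (of_nat W) (ck_job I v) - job_reward (of_nat W / 2) (ck_job I v))"
definition "mean_size v = real_of_rat (job_mean (of_nat W + 1) (ck_job I v))"
definition "large_prob v = real_of_rat (job_tail (of_nat W / 2) (ck_job I v))"
definition "small_size v = real_of_rat (job_max (of_nat W / 2) (ck_job I v))"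
definition "large_size v = real_of_rat (job_max (of_nat W) (ck_job I v))"

lemma wf: "corrko_wf I"
  using two by (simp add: two_corrko_def)

lemma root_less: "\<rho> < n"
  using wf by (simp add: corrko_wf_def)

lemma wf_job: "v < n \<Longrightarrow> pmf_of_list_wf (ck_joblist I v)"
  using wf by (simp add: corrko_wf_def)

lemma reward_nonneg: "v < n \<Longrightarrow> x \<in> set_pmf (law v) \<Longrightarrow> 0 \<le> snd x"
  using wf by (cases x) (fastforce simp: corrko_wf_def)

lemma dist_triangle: "x < n \<Longrightarrow> y < n \<Longrightarrow> z < n \<Longrightarrow> ck_dist I x z \<le> ck_dist I x y + ck_dist I y z"
  using wf Metric_space.triangle[of "{..<n}" "\<lambda>u v. real (ck_dist I u v)" x y z]
  by (simp add: corrko_wf_def flip: of_nat_add)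

lemma finite_law: "v < n \<Longrightarrow> finite (set_pmf (law v))"
  using finite_subset[OF set_pmf_of_list[OF wf_job]] by (simp add: ck_law_def)

lemma set_law: "v < n \<Longrightarrow> set_pmf (law v) = {x. \<exists>p>0. (x, p) \<in> set (ck_job I v)}"
proof -
  assume "v < n"
  have "(\<exists>p>0. (x, p) \<in> set (ck_joblist I v)) \<longleftrightarrow> (\<exists>p>0. (x, p) \<in> set (ck_job I v))" for x
  proof
    assume "\<exists>p>0. (x, p) \<in> set (ck_joblist I v)"
    then show "\<exists>p>0. (x, p) \<in> set (ck_job I v)" by (auto simp: ck_joblist_def)
  next
    assume "\<exists>p>0. (x, p) \<in> set (ck_job I v)"
    then obtain p where "p > 0" "(x, p) \<in> set (ck_job I v)" by auto
    then have "(x, real_of_rat p) \<in> set (ck_joblist I v)" "real_of_rat p > 0"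
      unfolding ck_joblist_def by (auto intro!: image_eqI[of _ _ "(x, p)"])
    then show "\<exists>p>0. (x, p) \<in> set (ck_joblist I v)" by blast
  qed
  then show ?thesis
    using set_pmf_of_list_positive[OF wf_job[OF \<open>v < n\<close>]] by (simp add: ck_law_def)
qed

lemma expectation_law:
  "v < n \<Longrightarrow> measure_pmf.expectation (law v) g = (\<Sum>z\<leftarrow>ck_job I v. real_of_rat (snd z) * g (fst z))"
  using expectation_pmf_of_list[OF wf_job] by (simp add: ck_law_def ck_joblist_def o_def)

lemma of_rat_sum_list: "of_rat (\<Sum>z\<leftarrow>zs. f z) = (\<Sum>z\<leftarrow>zs. of_rat (f z) :: real)"
  by (induction zs) (auto simp: of_rat_add)

lemma half_less_iff: "(of_nat W / 2 :: rat) < of_nat s \<longleftrightarrow> W < 2 * s"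
  using of_nat_less_iff[where 'a = rat, of W "2 * s"] by (simp add: field_simps)

lemma Suc_less_iff: "(of_nat W + 1 :: rat) < of_nat s \<longleftrightarrow> W + 1 < s"
  using of_nat_less_iff[where 'a = rat, of "W + 1" s] by (simp add: algebra_simps)

lemma small_reward_eq:
  "v < n \<Longrightarrow> small_reward v =
    measure_pmf.expectation (law v) (\<lambda>x. if W < 2 * fst x then 0 else of_rat (snd x))"
  unfolding small_reward_def job_reward_def expectation_law of_rat_sum_list half_less_iff
  by (intro arg_cong[where f = sum_list] map_cong) (auto simp: of_rat_mult)

lemma large_reward_eq:
  "v < n \<Longrightarrow> large_reward v =
    measure_pmf.expectation (law v) (\<lambda>x. if W < 2 * fst x \<and> fst x \<le> W then of_rat (snd x) else 0)"
  unfolding large_reward_def job_reward_def expectation_law of_rat_sum_list half_less_iff of_rat_diff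
    sum_list_subtractf[symmetric]
  by (intro arg_cong[where f = sum_list] map_cong) (auto simp: of_rat_mult)

lemma mean_size_eq:
  "v < n \<Longrightarrow> mean_size v = measure_pmf.expectation (law v) (\<lambda>x. min (real (fst x)) (real W + 1))"
  unfolding mean_size_def job_mean_def expectation_law of_rat_sum_list Suc_less_iff
  by (intro arg_cong[where f = sum_list] map_cong) (auto simp: of_rat_mult of_rat_add min_def)

lemma large_prob_eq:
  "v < n \<Longrightarrow> large_prob v = measure_pmf.expectation (law v) (\<lambda>x. if W < 2 * fst x then 1 else 0)"
  unfolding large_prob_def job_tail_def expectation_law of_rat_sum_list half_less_iff
  by (intro arg_cong[where f = sum_list] map_cong) auto

lemma small_size_upper:
  assumes "v < n" "x \<in> set_pmf (law v)" "2 * fst x \<le> W"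
  shows "real (fst x) \<le> small_size v"
proof -
  obtain p where "p > 0" "(x, p) \<in> set (ck_job I v)" using assms by (auto simp: set_law)
  with job_max_upper[of "(x, p)" _ "of_nat W / 2"] assms(3) half_less_iff[of "fst x"]
  have "of_nat (fst x) \<le> job_max (of_nat W / 2) (ck_job I v)" by auto
  then show ?thesis unfolding small_size_def by (metis of_rat_less_eq of_rat_of_nat_eq)
qed

lemma small_size_attained:
  assumes "v < n"
  shows "small_size v = 0 \<or> (\<exists>x\<in>set_pmf (law v). 2 * fst x \<le> W \<and> small_size v = real (fst x))"
proof (cases "small_size v = 0")
  case False
  then obtain z where z: "z \<in> set (ck_job I v)" "0 < snd z" "of_nat (fst (fst z)) \<le> (of_nat W / 2 :: rat)"
      "job_max (of_nat W / 2) (ck_job I v) = of_nat (fst (fst z))"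
    using job_max_attained[of "of_nat W / 2" "ck_job I v"] by (auto simp: small_size_def)
  then have "fst z \<in> set_pmf (law v)" using assms by (cases z) (auto simp: set_law)
  moreover have "2 * fst (fst z) \<le> W" using z(3) half_less_iff[of "fst (fst z)"] by simp
  ultimately show ?thesis using z(4) by (auto simp: small_size_def)
qed simp

lemma large_size_upper:
  assumes "v < n" "x \<in> set_pmf (law v)" "fst x \<le> W"
  shows "real (fst x) \<le> large_size v"
proof -
  obtain p where "p > 0" "(x, p) \<in> set (ck_job I v)" using assms by (auto simp: set_law)
  with job_max_upper[of "(x, p)" _ "of_nat W"] assms(3)
  have "of_nat (fst x) \<le> job_max (of_nat W) (ck_job I v)" by auto
  then show ?thesis unfolding large_size_def by (metis of_rat_less_eq of_rat_of_nat_eq)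
qed

lemma large_size_attained:
  assumes "v < n"
  shows "large_size v = 0 \<or> (\<exists>x\<in>set_pmf (law v). fst x \<le> W \<and> large_size v = real (fst x))"
proof (cases "large_size v = 0")
  case False
  then obtain z where z: "z \<in> set (ck_job I v)" "0 < snd z" "of_nat (fst (fst z)) \<le> (of_nat W :: rat)"
      "job_max (of_nat W) (ck_job I v) = of_nat (fst (fst z))"
    using job_max_attained[of "of_nat W" "ck_job I v"] by (auto simp: large_size_def)
  then have "fst z \<in> set_pmf (law v)" using assms by (cases z) (auto simp: set_law)
  with z show ?thesis by (auto simp: large_size_def)
qed simp

lemma large_size_le: "large_size v \<le> real W"
  using job_max_le[of "of_nat W" "ck_job I v"] unfolding large_size_def
  by (metis of_nat_0_le_iff of_rat_less_eq of_rat_of_nat_eq)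

lemma small_size_nonneg: "0 \<le> small_size v"
  by (simp add: small_size_def job_max_nonneg)

lemma small_reward_nonneg: "v < n \<Longrightarrow> 0 \<le> small_reward v"
  unfolding small_reward_eq using reward_nonneg
  by (intro integral_nonneg_AE) (auto simp: AE_measure_pmf_iff)

lemma large_reward_nonneg: "v < n \<Longrightarrow> 0 \<le> large_reward v"
  unfolding large_reward_eq using reward_nonneg
  by (intro integral_nonneg_AE) (auto simp: AE_measure_pmf_iff)

lemma mean_size_nonneg: "v < n \<Longrightarrow> 0 \<le> mean_size v"
  unfolding mean_size_eq by (intro integral_nonneg_AE) (auto simp: AE_measure_pmf_iff)

lemma large_prob_nonneg: "v < n \<Longrightarrow> 0 \<le> large_prob v"
  unfolding large_prob_eq by (intro integral_nonneg_AE) (auto simp: AE_measure_pmf_iff)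

lemma feasible_deadline_instance_iff:
  "knap_orientkd_feasible (deadline_instance I r w k b) (\<rho> # vs) \<longleftrightarrow>
    distinct (\<rho> # vs) \<and> set vs \<subseteq> {..<n} \<and> path_length (ck_dist I) (\<rho> # vs) \<le> ck_B I \<and>
    on_time (\<lambda>v. w (ck_job I v)) (\<lambda>v. k (ck_job I v)) 0 vs \<and>
    (\<Sum>v\<leftarrow>vs. b (ck_job I v)) \<le> 1 / 2"
proof (cases "\<rho> \<in> set vs")
  case False
  then have at: "at_vertices I f v = f (ck_job I v)" if "v \<in> set vs" for f v
    using that by (auto simp: at_vertices_def)
  have root: "at_vertices I f \<rho> = 0" for f
    by (simp add: at_vertices_def)
  have sums: "(\<Sum>u\<leftarrow>us. at_vertices I f u) = (\<Sum>u\<leftarrow>us. f (ck_job I u))" if "set us \<subseteq> set vs" for us f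
    using at that by (intro arg_cong[where f = sum_list] map_cong) auto
  have "on_time (\<lambda>v. w (ck_job I v)) (\<lambda>v. k (ck_job I v)) 0 vs \<longleftrightarrow>
     (\<forall>i<length vs. (\<Sum>u\<leftarrow>take (Suc i) vs. at_vertices I w u) \<le> at_vertices I (\<lambda>xs. k xs + w xs) (vs ! i))"
    unfolding on_time_conv_take by (simp add: sums[OF set_take_subset] at)
  then have "(\<forall>i<length (\<rho> # vs). (\<Sum>u\<leftarrow>take (Suc i) (\<rho> # vs). at_vertices I w u)
        \<le> at_vertices I (\<lambda>xs. k xs + w xs) ((\<rho> # vs) ! i)) \<longleftrightarrow>
      on_time (\<lambda>v. w (ck_job I v)) (\<lambda>v. k (ck_job I v)) 0 vs"
    unfolding length_Cons All_less_Suc2 by (simp add: root)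
  moreover have "(\<Sum>v\<leftarrow>\<rho> # vs. at_vertices I b v) = (\<Sum>v\<leftarrow>vs. b (ck_job I v))"
    by (simp add: sums root)
  ultimately show ?thesis
    using root_less False
    unfolding knap_orientkd_feasible_def orientkd_feasible_def deadline_instance_def
    by (simp add: path_length_of_nat del: length_Cons take_Suc_Cons sum_list.Cons list.simps(9))
qed (simp add: knap_orientkd_feasible_def orientkd_feasible_def deadline_instance_def)

lemma feasible_deadline_instance_root:
  "knap_orientkd_feasible (deadline_instance I r w k b) Q \<Longrightarrow> \<exists>vs. Q = \<rho> # vs"
  by (cases Q) (auto simp: knap_orientkd_feasible_def orientkd_feasible_def deadline_instance_def)

lemma value_deadline_instance:
  assumes "\<rho> \<notin> set vs"
  shows "orientkd_value (deadline_instance I r w k b) (\<rho> # vs) = (\<Sum>v\<leftarrow>vs. r (ck_job I v))"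
  using assms
  by (auto simp: orientkd_value_def deadline_instance_def at_vertices_def
      intro!: arg_cong[where f = sum_list] map_cong)

lemma deadline_instance_wf:
  assumes "\<And>v. v < n \<Longrightarrow> 0 \<le> r (ck_job I v)" "\<And>v. v < n \<Longrightarrow> 0 \<le> w (ck_job I v)"
    "\<And>v. v < n \<Longrightarrow> 0 \<le> k (ck_job I v)" "\<And>v. v < n \<Longrightarrow> 0 \<le> b (ck_job I v)"
  shows "knap_orientkd_wf (deadline_instance I r w k b)"
  using assms root_less wf
  by (auto simp: knap_orientkd_wf_def orientkd_wf_def deadline_instance_def at_vertices_def corrko_wf_def)

lemma small_instance_wf: "knap_orientkd_wf (small_instance I)"
  unfolding small_instance_def Let_def
  using small_reward_nonneg mean_size_nonneg
  by (intro deadline_instance_wf) (auto simp: small_reward_def mean_size_def)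

lemma large_instance_wf: "knap_orientkd_wf (large_instance I)"
  unfolding large_instance_def Let_def
  using large_reward_nonneg large_prob_nonneg job_max_nonneg job_max_le[of "of_nat W"]
  by (intro deadline_instance_wf) (auto simp: large_reward_def large_prob_def)

definition "paths = {vs. distinct (\<rho> # vs) \<and> set vs \<subseteq> {..<n} \<and> path_length (ck_dist I) (\<rho> # vs) \<le> ck_B I}"

lemma subseq_distinct: "subseq us vs \<Longrightarrow> distinct vs \<Longrightarrow> distinct us"
  by (induction rule: list_emb.induct) (auto dest: list_emb_set)

lemma paths_subseq:
  assumes "vs \<in> paths" "subseq us vs"
  shows "us \<in> paths"
proof -
  have "set us \<subseteq> set vs" using assms(2) by (auto dest: list_emb_set)
  then show ?thesis
    using path_length_subseq[of n "ck_dist I" us vs \<rho>] dist_triangle root_less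
      subseq_distinct[of us vs] assms
    unfolding paths_def by auto
qed

lemma small_instance_iff:
  "knap_orientkd_feasible (small_instance I) (\<rho> # vs) \<longleftrightarrow>
    vs \<in> paths \<and> on_time mean_size (\<lambda>_. (real W + 1) / 4) 0 vs"
proof -
  have "on_time mean_size (\<lambda>_. (real W + 1) / 4) 0 vs \<longleftrightarrow>
      on_time (\<lambda>v. job_mean (of_nat W + 1) (ck_job I v)) (\<lambda>v. (of_nat W + 1) / 4) 0 vs"
    by (subst on_time_of_rat[symmetric, where 'b = real])
      (simp add: mean_size_def[abs_def] of_rat_divide of_rat_add)
  then show ?thesis
    by (auto simp: small_instance_def Let_def feasible_deadline_instance_iff paths_def)
qed

text \<open>The cap makes every single vertex affordable within the knapsack budget, even one that
  is almost certainly large.\<close>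

definition "capped_prob v = min (large_prob v) (1 / 2)"

lemma large_instance_iff:
  "knap_orientkd_feasible (large_instance I) (\<rho> # vs) \<longleftrightarrow>
    vs \<in> paths \<and> on_time small_size (\<lambda>v. real W - large_size v) 0 vs \<and>
    (\<Sum>v\<leftarrow>vs. capped_prob v) \<le> 1 / 2"
proof -
  have 1: "on_time small_size (\<lambda>v. real W - large_size v) 0 vs \<longleftrightarrow>
      on_time (\<lambda>v. job_max (of_nat W / 2) (ck_job I v)) (\<lambda>v. of_nat W - job_max (of_nat W) (ck_job I v)) 0 vs"
    by (subst on_time_of_rat[symmetric, where 'b = real])
      (simp add: small_size_def[abs_def] large_size_def of_rat_diff)
  have "capped_prob v = of_rat (if 1 / 2 < job_tail (of_nat W / 2) (ck_job I v) then 1 / 2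
      else job_tail (of_nat W / 2) (ck_job I v))" for v
    using of_rat_less[of "1/2" "job_tail (of_nat W / 2) (ck_job I v)", where 'a = real]
    by (auto simp: capped_prob_def large_prob_def of_rat_divide)
  then have "(\<Sum>v\<leftarrow>vs. capped_prob v) \<le> 1 / 2 \<longleftrightarrow> real_of_rat (\<Sum>v\<leftarrow>vs. if 1 / 2 < job_tail (of_nat W / 2) (ck_job I v)
      then 1 / 2 else job_tail (of_nat W / 2) (ck_job I v)) \<le> real_of_rat (1 / 2)"
    by (simp add: of_rat_sum_list of_rat_divide)
  with 1 show ?thesis
    by (auto simp: large_instance_def Let_def feasible_deadline_instance_iff paths_def of_rat_less_eq)
qed

lemma small_instance_value:
  "vs \<in> paths \<Longrightarrow> of_rat (orientkd_value (small_instance I) (\<rho> # vs)) = (\<Sum>v\<leftarrow>vs. small_reward v)"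
  by (simp add: small_instance_def Let_def value_deadline_instance paths_def of_rat_sum_list small_reward_def)

lemma large_instance_value:
  "vs \<in> paths \<Longrightarrow> of_rat (orientkd_value (large_instance I) (\<rho> # vs)) = (\<Sum>v\<leftarrow>vs. large_reward v)"
  by (simp add: large_instance_def Let_def value_deadline_instance paths_def of_rat_sum_list large_reward_def)

lemma empty_path: "[] \<in> paths"
  by (simp add: paths_def)

text \<open>Nothing is known about the jobs listed outside the vertex set. A point mass there gives
  finite support at every argument, as \<open>expectation_accumulate\<close> demands.\<close>

definition "law' v = (if v < n then law v else return_pmf (0, 0))"

lemma finite_law': "finite (set_pmf (law' v))"
  by (simp add: law'_def finite_law)

definition "runs = {tr. map fst tr \<in> paths \<and> (\<forall>z\<in>set tr. snd z \<in> set_pmf (law (fst z))) \<and>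
  (\<Sum>z\<leftarrow>butlast tr. fst (snd z)) \<le> W}"

lemma ck_outcomes_eq: "ck_outcomes I = Pi_pmf {..<n} (0, 0) law'"
  unfolding ck_outcomes_def by (intro Pi_pmf_cong) (auto simp: law'_def)

lemma trace_law_policy:
  assumes "corrko_feasible I \<pi>"
  shows "map_pmf (trace \<pi>) (ck_outcomes I) = trace_law law' \<pi>"
  unfolding ck_outcomes_eq
  using assms by (intro map_trace_Pi_pmf) (auto simp: corrko_feasible_def Let_def simp flip: ck_outcomes_eq)

lemma policy_value:
  assumes "corrko_feasible I \<pi>"
  shows "corrko_value I \<pi> = measure_pmf.expectation (trace_law law' \<pi>) (accumulate (collects W) 0)"
  unfolding corrko_value_def collected_conv_accumulate trace_law_policy[OF assms, symmetric]
  by simp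

lemma policy_runs:
  assumes "corrko_feasible I \<pi>" "tr \<in> set_pmf (trace_law law' \<pi>)"
  shows "tr \<in> runs"
proof -
  obtain f where f: "f \<in> set_pmf (ck_outcomes I)" "tr = trace \<pi> f"
    using assms unfolding trace_law_policy[OF assms(1), symmetric] by auto
  have supp: "f v \<in> set_pmf (law v)" if "v < n" for v
    using f(1) that by (auto simp: ck_outcomes_def set_Pi_pmf PiE_dflt_def)
  show ?thesis
    using assms(1)[unfolded corrko_feasible_def, rule_format, OF f(1)] supp
    by (auto simp: Let_def runs_def paths_def f(2) trace_conv_visits o_def map_butlast[symmetric] subset_iff)
qed

end

section \<open>Upper bound for adaptive policies\<close>

lemma sum_list_pos:
  fixes f :: "'a \<Rightarrow> real"
  shows "xs \<noteq> [] \<Longrightarrow> (\<And>x. x \<in> set xs \<Longrightarrow> 0 < f x) \<Longrightarrow> 0 < (\<Sum>x\<leftarrow>xs. f x)"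
  by (induction xs rule: list_nonempty_induct) (auto intro: add_pos_pos)

context two_corrko_inst
begin

text \<open>Giving up the collection test for small outcomes makes the conditional means independent
  of the history. The argument \<open>h\<close> remains to fit \<open>accumulate\<close>.\<close>

definition "small_part h v x = (if W < 2 * fst x then 0 else real_of_rat (snd x))"
definition "large_part h v x = (if W < 2 * fst x \<and> h + fst x \<le> W then real_of_rat (snd x) else 0)"

text \<open>Whether a large reward could still be collected at \<open>v\<close> is settled before
  the outcome of \<open>v\<close> is drawn, so the condition survives when increments are replaced
  by their means.\<close>

definition "eligible h v \<longleftrightarrow> (\<exists>x\<in>set_pmf (law v). W < 2 * fst x \<and> h + fst x \<le> W)"

primrec eligibles :: "nat \<Rightarrow> history \<Rightarrow> nat list" where
  "eligibles h [] = []"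
| "eligibles h (z # tr) = (if eligible h (fst z) then [fst z] else []) @ eligibles (h + fst (snd z)) tr"

lemma accumulate_eligible:
  "accumulate (\<lambda>h v _. if eligible h v then f v else 0) h tr = (\<Sum>v\<leftarrow>eligibles h tr. f v)"
  by (induction tr arbitrary: h) auto

lemma eligibles_subseq: "subseq (eligibles h tr) (map fst tr)"
  by (induction tr arbitrary: h) (auto simp: list_emb_append2 intro: list_emb_Cons)

lemma runs_vertex: "tr \<in> runs \<Longrightarrow> z \<in> set tr \<Longrightarrow> fst z < n"
  by (auto simp: runs_def paths_def)

lemma collects_le:
  assumes "tr \<in> runs"
  shows "accumulate (collects W) 0 tr \<le> accumulate small_part 0 tr + accumulate large_part 0 tr"
  unfolding accumulate_add[symmetric]
proof (rule accumulate_mono)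
  fix h v x assume "(v, x) \<in> set tr"
  then have "0 \<le> snd x"
    using runs_vertex[OF assms] reward_nonneg assms by (fastforce simp: runs_def)
  then show "collects W h v x \<le> small_part h v x + large_part h v x"
    by (auto simp: collects_def small_part_def large_part_def)
qed

text \<open>\<open>expectation_accumulate\<close> is used in both directions: it turns small rewards
  into their means, to which the block decomposition applies, and mean sizes back into realized
  truncated sizes, which feasibility bounds on every run.\<close>

lemma expectation_small_part:
  assumes "corrko_feasible I \<pi>"
    and bound: "\<And>vs. knap_orientkd_feasible (small_instance I) (\<rho> # vs) \<Longrightarrow> (\<Sum>v\<leftarrow>vs. small_reward v) \<le> M"
  shows "measure_pmf.expectation (trace_law law' \<pi>) (accumulate small_part 0) \<le> 9 * M"
proof -
  let ?E = "measure_pmf.expectation (trace_law law' \<pi>)"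
  note fin = finite_trace_law[OF finite_law', where \<pi> = \<pi>]
  have "M \<ge> 0" using bound[of "[]"] empty_path by (auto simp: small_instance_iff)
  define \<tau> where "\<tau> = (real W + 1) / 4"
  have "\<tau> > 0" by (simp add: \<tau>_def)
  \<comment> \<open>All jobs but the last take at most \<open>W\<close> together, and the last one
    at most \<open>W + 1\<close> after truncation. The sum is at most \<open>2 * (W + 1)\<close>,
    which is 8 times \<tau>.\<close>
  have mean: "?E (accumulate (\<lambda>_ v _. mean_size v) 0) \<le> 8 * \<tau>"
  proof -
    have "?E (accumulate (\<lambda>_ v x. min (real (fst x)) (real W + 1)) 0) =
        ?E (accumulate (\<lambda>_ v _. measure_pmf.expectation (law' v) (\<lambda>x. min (real (fst x)) (real W + 1))) 0)"
      by (rule expectation_accumulate[OF finite_law'])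
    also have "\<dots> = ?E (accumulate (\<lambda>_ v _. mean_size v) 0)"
    proof (rule expectation_cong_set_pmf)
      fix tr assume "tr \<in> set_pmf (trace_law law' \<pi>)"
      then have "tr \<in> runs" by (rule policy_runs[OF assms(1)])
      then show "accumulate (\<lambda>_ v _. measure_pmf.expectation (law' v) (\<lambda>x. min (real (fst x)) (real W + 1))) 0 tr =
          accumulate (\<lambda>_ v _. mean_size v) 0 tr"
        unfolding accumulate_no_state using runs_vertex
        by (intro arg_cong[where f = sum_list] map_cong) (auto simp: mean_size_eq law'_def)
    qed
    finally have "?E (accumulate (\<lambda>_ v _. mean_size v) 0) =
      ?E (accumulate (\<lambda>_ v x. min (real (fst x)) (real W + 1)) 0)" by simp
    also have "\<dots> \<le> ?E (\<lambda>_. 8 * \<tau>)"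
    proof (rule expectation_mono_finite[OF fin])
      fix tr assume "tr \<in> set_pmf (trace_law law' \<pi>)"
      then have tr: "(\<Sum>z\<leftarrow>butlast tr. fst (snd z)) \<le> W" using policy_runs[OF assms(1)] by (auto simp: runs_def)
      have "accumulate (\<lambda>_ v x. min (real (fst x)) (real W + 1)) 0 tr =
          (\<Sum>z\<leftarrow>tr. min (real (fst (snd z))) (real W + 1))"
        by (rule accumulate_no_state)
      also have "\<dots> \<le> (\<Sum>z\<leftarrow>butlast tr. real (fst (snd z))) + (real W + 1)"
      proof (cases tr rule: rev_cases)
        case (snoc us z)
        then show ?thesis by (auto intro!: add_mono sum_list_mono)
      qed auto
      also have "(\<Sum>z\<leftarrow>butlast tr. real (fst (snd z))) = real (\<Sum>z\<leftarrow>butlast tr. fst (snd z))"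
        by (induction tr) auto
      also have "\<dots> \<le> real W" using tr by (rule of_nat_mono)
      finally show "accumulate (\<lambda>_ v x. min (real (fst x)) (real W + 1)) 0 tr \<le> 8 * \<tau>"
        by (simp add: \<tau>_def)
    qed
    finally show ?thesis by simp
  qed
  have "?E (accumulate small_part 0) =
      ?E (accumulate (\<lambda>h v _. measure_pmf.expectation (law' v) (small_part h v)) 0)"
    by (rule expectation_accumulate[OF finite_law'])
  also have "\<dots> \<le> ?E (\<lambda>tr. M + M / \<tau> * accumulate (\<lambda>_ v _. mean_size v) 0 tr)"
  proof (rule expectation_mono_finite[OF fin])
    fix tr assume "tr \<in> set_pmf (trace_law law' \<pi>)"
    then have tr: "tr \<in> runs" by (rule policy_runs[OF assms(1)])
    have "accumulate (\<lambda>h v _. measure_pmf.expectation (law' v) (small_part h v)) 0 tr =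
        (\<Sum>v\<leftarrow>map fst tr. small_reward v)"
      unfolding small_part_def accumulate_no_state map_map o_def using runs_vertex[OF tr]
      by (intro arg_cong[where f = sum_list] map_cong) (auto simp: small_reward_eq law'_def)
    also have "\<dots> \<le> M * (1 + (\<Sum>v\<leftarrow>map fst tr. mean_size v) / \<tau>)"
    proof (rule reward_le_of_blocks)
      show "0 \<le> mean_size v" if "v \<in> set (map fst tr)" for v
        using that runs_vertex[OF tr] by (auto intro: mean_size_nonneg)
      show "(\<Sum>v\<leftarrow>us. small_reward v) \<le> M"
        if "sublist us (map fst tr)" "on_time mean_size (\<lambda>_. \<tau>) 0 us" for us
        using that tr paths_subseq[OF _ sublist_imp_subseq]
        by (intro bound) (auto simp: small_instance_iff \<tau>_def runs_def)
    qed (use \<open>\<tau> > 0\<close> \<open>M \<ge> 0\<close> in auto)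
    also have "\<dots> = M + M / \<tau> * accumulate (\<lambda>_ v _. mean_size v) 0 tr"
      by (simp add: accumulate_no_state o_def algebra_simps)
    finally show "accumulate (\<lambda>h v _. measure_pmf.expectation (law' v) (small_part h v)) 0 tr \<le> \<dots>" .
  qed
  also have "\<dots> = M + M / \<tau> * ?E (accumulate (\<lambda>_ v _. mean_size v) 0)"
    by (subst expectation_add_finite[OF fin]) simp
  also have "\<dots> \<le> M + M / \<tau> * (8 * \<tau>)"
    using mean \<open>\<tau> > 0\<close> \<open>M \<ge> 0\<close> by (intro add_left_mono mult_left_mono) auto
  also have "\<dots> = 9 * M" using \<open>\<tau> > 0\<close> by simp
  finally show ?thesis .
qed

lemma capped_prob_bounds: "v < n \<Longrightarrow> 0 \<le> capped_prob v \<and> capped_prob v \<le> 1 / 2 \<and> capped_prob v \<le> large_prob v"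
  using large_prob_nonneg by (auto simp: capped_prob_def)

lemma large_prob_eq_0_iff:
  assumes "v < n"
  shows "large_prob v = 0 \<longleftrightarrow> (\<forall>x\<in>set_pmf (law v). 2 * fst x \<le> W)"
  unfolding large_prob_eq[OF assms]
  by (subst integral_nonneg_eq_0_iff_AE)
    (auto simp: AE_measure_pmf_iff integrable_measure_pmf_finite finite_law assms not_less)

lemma large_prob_eq_1:
  assumes "v < n" "\<And>x. x \<in> set_pmf (law v) \<Longrightarrow> W < 2 * fst x"
  shows "large_prob v = 1"
proof -
  have "large_prob v = measure_pmf.expectation (law v) (\<lambda>_. 1)"
    unfolding large_prob_eq[OF assms(1)] using assms(2) by (intro expectation_cong_set_pmf) simp
  then show ?thesis by simp
qed

text \<open>This is where the restriction to two sizes per job is used.\<close>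

lemma sizes_unique:
  assumes "v < n" "large_prob v < 1" "x \<in> set_pmf (law v)" "W < 2 * fst x"
  shows "fst x \<le> W \<Longrightarrow> large_size v = real (fst x)"
    and "y \<in> set_pmf (law v) \<Longrightarrow> small_size v \<le> real (fst y)"
proof -
  \<comment> \<open>A job that is not large with certainty has a small outcome. Its size and the
    size of \<open>x\<close> exhaust the two sizes that are allowed.\<close>
  obtain x0 where x0: "x0 \<in> set_pmf (law v)" "2 * fst x0 \<le> W"
    using large_prob_eq_1[OF assms(1)] assms(2) by (metis not_le less_irrefl)
  have "fst x0 \<noteq> fst x" using x0(2) assms(4) by auto
  have card: "card (fst ` set_pmf (law v)) \<le> 2"
    using two assms(1) by (simp add: two_corrko_def)
  have sizes: "fst y = fst x0 \<or> fst y = fst x" if "y \<in> set_pmf (law v)" for y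
  proof (rule ccontr)
    assume "\<not> ?thesis"
    then have "card {fst y, fst x0, fst x} = 3" using \<open>fst x0 \<noteq> fst x\<close> by auto
    moreover have "card {fst y, fst x0, fst x} \<le> card (fst ` set_pmf (law v))"
      using that x0(1) assms(1,3) by (intro card_mono) (auto simp: finite_law)
    ultimately show False using card by simp
  qed
  show "large_size v = real (fst x)" if "fst x \<le> W"
  proof -
    have "real (fst x) \<le> large_size v" using large_size_upper[OF assms(1,3) that] .
    moreover from large_size_attained[OF assms(1)] sizes have "large_size v \<le> real (fst x)"
      using x0(2) assms(4) by fastforce
    ultimately show ?thesis by simp
  qed
  show "small_size v \<le> real (fst y)" if "y \<in> set_pmf (law v)"
    using small_size_attained[OF assms(1)] sizes x0(2) assms(4) sizes[OF that] by fastforce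
qed

text \<open>The deadlines measure the small sizes of earlier jobs, whereas eligibility refers to the
  size processed in the run. By \<open>sizes_unique\<close> every outcome of a kept job takes at
  least its small size, so the processed size dominates the weight; and eligibility says that the
  only collectable large size of the job still fits. Jobs left out of the list only increase the
  processed size.\<close>

lemma eligibles_on_time:
  assumes "\<And>z. z \<in> set tr \<Longrightarrow> fst z < n \<and> snd z \<in> set_pmf (law (fst z))"
  shows "on_time small_size (\<lambda>v. real W - large_size v) (real h)
    (filter (\<lambda>v. large_prob v < 1) (eligibles h tr))"
  using assms
proof (induction tr arbitrary: h)
  case (Cons z tr)
  obtain v x where z: "z = (v, x)" by (cases z)
  with Cons.prems[of z] have v: "v < n" "x \<in> set_pmf (law v)" by auto
  have IH: "on_time small_size (\<lambda>v. real W - large_size v) (real (h + fst x))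
      (filter (\<lambda>v. large_prob v < 1) (eligibles (h + fst x) tr))"
    by (rule Cons.IH) (rule Cons.prems, simp)
  show ?case
  proof (cases "eligible h v \<and> large_prob v < 1")
    case True
    then obtain y where y: "y \<in> set_pmf (law v)" "W < 2 * fst y" "h + fst y \<le> W"
      by (auto simp: eligible_def)
    have "large_size v = real (fst y)" "small_size v \<le> real (fst x)"
      using sizes_unique[OF v(1) _ y(1,2)] True y(3) v(2) by auto
    with IH True y(3) z show ?thesis
      by (auto elim!: on_time_antimono)
  next
    case False
    with IH z show ?thesis by (auto elim!: on_time_antimono)
  qed
qed simp

lemma expectation_large_part:
  assumes "corrko_feasible I \<pi>"
    and bound: "\<And>vs. knap_orientkd_feasible (large_instance I) (\<rho> # vs) \<Longrightarrow> (\<Sum>v\<leftarrow>vs. large_reward v) \<le> M"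
  shows "measure_pmf.expectation (trace_law law' \<pi>) (accumulate large_part 0) \<le> 6 * M"
proof -
  let ?E = "measure_pmf.expectation (trace_law law' \<pi>)"
  let ?prob = "\<lambda>h v _. if eligible h v then large_prob v else 0"
  note fin = finite_trace_law[OF finite_law', where \<pi> = \<pi>]
  have "M \<ge> 0" using bound[of "[]"] empty_path by (auto simp: large_instance_iff)
  have prob: "?E (accumulate ?prob 0) \<le> 1"
  proof -
    let ?hit = "\<lambda>h v x. if eligible h v then if W < 2 * fst x then 1 else 0 else 0"
    have "?E (accumulate ?hit 0) =
        ?E (accumulate (\<lambda>h v _. measure_pmf.expectation (law' v) (?hit h v)) 0)"
      by (rule expectation_accumulate[OF finite_law'])
    also have "\<dots> = ?E (accumulate ?prob 0)"
    proof (rule expectation_cong_set_pmf)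
      fix tr assume "tr \<in> set_pmf (trace_law law' \<pi>)"
      then have tr: "tr \<in> runs" by (rule policy_runs[OF assms(1)])
      have "measure_pmf.expectation (law' v) (?hit h v) = ?prob h v x" if "(v, x) \<in> set tr" for h v x
        using runs_vertex[OF tr that] by (simp add: large_prob_eq law'_def)
      then show "accumulate (\<lambda>h v _. measure_pmf.expectation (law' v) (?hit h v)) 0 tr = accumulate ?prob 0 tr"
        by (intro antisym accumulate_mono) auto
    qed
    finally have "?E (accumulate ?prob 0) = ?E (accumulate ?hit 0)" by simp
    also have "\<dots> \<le> ?E (\<lambda>_. 1)"
    proof (rule expectation_mono_finite[OF fin])
      fix tr
      \<comment> \<open>Once more than \<open>W / 2\<close> has been processed, no large outcome
        fits and no vertex is eligible. A hit leads into this state, so there is at most one hit per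
        run.\<close>
      have "accumulate ?hit h tr \<le> (if W < 2 * h then 0 else 1)" for h
      proof (induction tr arbitrary: h)
        case (Cons z tr)
        show ?case using Cons[of "h + fst (snd z)"]
          by (auto simp: eligible_def split: if_splits)
      qed simp
      from this[of 0] show "accumulate ?hit 0 tr \<le> 1" by simp
    qed
    finally show ?thesis by simp
  qed
  have "?E (accumulate large_part 0) =
      ?E (accumulate (\<lambda>h v _. measure_pmf.expectation (law' v) (large_part h v)) 0)"
    by (rule expectation_accumulate[OF finite_law'])
  also have "\<dots> \<le> ?E (\<lambda>tr. 2 * M + 4 * M * accumulate ?prob 0 tr)"
  proof (rule expectation_mono_finite[OF fin])
    fix tr assume "tr \<in> set_pmf (trace_law law' \<pi>)"
    then have tr: "tr \<in> runs" by (rule policy_runs[OF assms(1)])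
    define vs where "vs = eligibles 0 tr"
    have paths: "vs \<in> paths"
      using tr eligibles_subseq paths_subseq by (auto simp: vs_def runs_def)
    then have less: "v < n" if "v \<in> set vs" for v using that by (auto simp: paths_def)
    have pos: "large_prob v > 0" if "v \<in> set vs" for v
    proof -
      have "v \<in> set (eligibles h tr) \<Longrightarrow> \<exists>h. eligible h v" for h tr
        by (induction tr arbitrary: h) (auto split: if_splits)
      with that have "\<exists>h. eligible h v" unfolding vs_def by blast
      then show ?thesis
        using large_prob_eq_0_iff[OF less[OF that]] large_prob_nonneg[OF less[OF that]]
        by (fastforce simp: eligible_def)
    qed
    have block: "(\<Sum>v\<leftarrow>us. large_reward v) \<le> M"
      if sub: "sublist us vs" and capped: "(\<Sum>v\<leftarrow>us. capped_prob v) \<le> 1 / 2" for us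
    proof (rule bound)
      have in_vs: "v \<in> set vs" if "v \<in> set us" for v
        using that sub by (auto dest: set_mono_sublist)
      have "on_time small_size (\<lambda>v. real W - large_size v) 0 us"
      \<comment> \<open>A job that is large with certainty may have two large sizes, so
        \<open>sizes_unique\<close> does not apply to it. But its capped probability fills the
        knapsack, and all eligible vertices have a positive one. Hence it is alone in its block and
        meets its deadline at weight 0.\<close>
      proof (cases "\<exists>v\<in>set us. large_prob v \<ge> 1")
        case True
        then obtain us1 v us2 where us: "us = us1 @ v # us2" "large_prob v \<ge> 1"
          by (auto dest: split_list)
        have us_vs: "set us1 \<union> set us2 \<subseteq> set vs" using in_vs us(1) by auto
        then have "0 < capped_prob u" if "u \<in> set us1 \<union> set us2" for u
          using pos[of u] that by (auto simp: capped_prob_def)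
        then have sum_pos: "0 < (\<Sum>v\<leftarrow>us0. capped_prob v)" if "us0 \<noteq> []" "us0 = us1 \<or> us0 = us2" for us0
          using that by (intro sum_list_pos) auto
        have "capped_prob v = 1 / 2" using us(2) by (simp add: capped_prob_def)
        with capped have "(\<Sum>v\<leftarrow>us1. capped_prob v) + (\<Sum>v\<leftarrow>us2. capped_prob v) \<le> 0"
          by (simp add: us(1))
        then have "us1 = [] \<and> us2 = []"
          using sum_pos[of us1] sum_pos[of us2] by (cases "us1 = []"; cases "us2 = []") auto
        with us large_size_le[of v] show ?thesis by simp
      next
        case False
        have "on_time small_size (\<lambda>v. real W - large_size v) (real 0) (filter (\<lambda>v. large_prob v < 1) vs)"
          unfolding vs_def using tr runs_vertex[OF tr]
          by (intro eligibles_on_time) (auto simp: runs_def)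
        moreover have "subseq us (filter (\<lambda>v. large_prob v < 1) vs)"
        proof -
          have "subseq (filter (\<lambda>v. large_prob v < 1) us) (filter (\<lambda>v. large_prob v < 1) vs)"
            by (intro subseq_filter sublist_imp_subseq sub)
          also have "filter (\<lambda>v. large_prob v < 1) us = us"
            using False by (intro filter_True) auto
          finally show ?thesis .
        qed
        ultimately show ?thesis by (auto elim: on_time_subseq simp: small_size_nonneg)
      qed
      then show "knap_orientkd_feasible (large_instance I) (\<rho> # us)"
        using paths_subseq[OF paths sublist_imp_subseq[OF sub]] capped by (simp add: large_instance_iff)
    qed
    have "accumulate (\<lambda>h v _. measure_pmf.expectation (law' v) (large_part h v)) 0 tr \<le>
        accumulate (\<lambda>h v _. if eligible h v then large_reward v else 0) 0 tr"
    proof (rule accumulate_mono)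
      fix h v and x :: outcome assume "(v, x) \<in> set tr"
      then have v: "v < n" using runs_vertex[OF tr] by fastforce
      show "measure_pmf.expectation (law' v) (large_part h v) \<le> (if eligible h v then large_reward v else 0)"
      proof (cases "eligible h v")
        case True
        with v show ?thesis
          using reward_nonneg[OF v]
          by (auto simp: large_reward_eq law'_def large_part_def finite_law intro!: expectation_mono_finite)
      next
        case False
        with v have "measure_pmf.expectation (law' v) (large_part h v) = measure_pmf.expectation (law' v) (\<lambda>_. 0)"
          by (intro expectation_cong_set_pmf) (auto simp: eligible_def law'_def large_part_def)
        with False show ?thesis by simp
      qed
    qed
    also have "\<dots> = (\<Sum>v\<leftarrow>vs. large_reward v)" by (simp add: accumulate_eligible vs_def)
    \<comment> \<open>A greedy block may overshoot the knapsack budget with its last vertex. It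
      splits into the vertices before that one and that vertex alone, both feasible, at the price of
      a factor 2.\<close>
    also have "\<dots> \<le> 2 * M * (1 + (\<Sum>v\<leftarrow>vs. capped_prob v) / (1 / 2))"
    proof (rule reward_le_of_blocks)
      show "0 \<le> capped_prob v" if "v \<in> set vs" for v
        using capped_prob_bounds[OF less[OF that]] by simp
      show "(\<Sum>v\<leftarrow>us. large_reward v) \<le> 2 * M"
        if sub: "sublist us vs" and "on_time capped_prob (\<lambda>_. 1 / 2) 0 us" for us
      proof (cases us rule: rev_cases)
        case (snoc us' u)
        obtain ps ss where vs_eq: "vs = ps @ us @ ss" using sub by (auto simp: sublist_def)
        then have "sublist us' vs" "sublist [u] vs" "u \<in> set vs"
          unfolding sublist_def snoc by (auto intro: exI[of _ ps] exI[of _ "u # ss"] exI[of _ "ps @ us'"])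
        have "(\<Sum>v\<leftarrow>us'. capped_prob v) \<le> 1 / 2"
          using that(2) by (auto simp: on_time_conv_take snoc dest!: spec[of _ "length us'"])
        then have "(\<Sum>v\<leftarrow>us'. large_reward v) \<le> M"
          using \<open>sublist us' vs\<close> by (intro block)
        moreover have "(\<Sum>v\<leftarrow>[u]. large_reward v) \<le> M"
          using \<open>sublist [u] vs\<close> capped_prob_bounds[OF less[OF \<open>u \<in> set vs\<close>]] by (intro block) auto
        ultimately show ?thesis using snoc by simp
      qed (use \<open>M \<ge> 0\<close> in auto)
    qed (use \<open>M \<ge> 0\<close> in auto)
    also have "\<dots> \<le> 2 * M * (1 + (\<Sum>v\<leftarrow>vs. large_prob v) / (1 / 2))"
      using \<open>M \<ge> 0\<close> capped_prob_bounds less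
      by (intro mult_left_mono add_left_mono divide_right_mono sum_list_mono) auto
    also have "\<dots> = 2 * M + 4 * M * accumulate ?prob 0 tr"
      by (simp add: accumulate_eligible vs_def algebra_simps)
    finally show "accumulate (\<lambda>h v _. measure_pmf.expectation (law' v) (large_part h v)) 0 tr \<le> \<dots>" .
  qed
  also have "\<dots> = 2 * M + 4 * M * ?E (accumulate ?prob 0)"
    by (subst expectation_add_finite[OF fin]) simp
  also have "\<dots> \<le> 2 * M + 4 * M * 1"
    using prob \<open>M \<ge> 0\<close> by (intro add_left_mono mult_left_mono) auto
  finally show ?thesis by simp
qed

lemma policy_value_le:
  assumes "corrko_feasible I \<pi>"
    and "\<And>vs. knap_orientkd_feasible (small_instance I) (\<rho> # vs) \<Longrightarrow> (\<Sum>v\<leftarrow>vs. small_reward v) \<le> M"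
    and "\<And>vs. knap_orientkd_feasible (large_instance I) (\<rho> # vs) \<Longrightarrow> (\<Sum>v\<leftarrow>vs. large_reward v) \<le> M'"
  shows "corrko_value I \<pi> \<le> 9 * M + 6 * M'"
proof -
  note fin = finite_trace_law[OF finite_law', where \<pi> = \<pi>]
  have "corrko_value I \<pi> \<le> measure_pmf.expectation (trace_law law' \<pi>)
      (\<lambda>tr. accumulate small_part 0 tr + accumulate large_part 0 tr)"
    unfolding policy_value[OF assms(1)]
    by (intro expectation_mono_finite[OF fin] collects_le policy_runs[OF assms(1)])
  then show ?thesis
    using expectation_small_part[OF assms(1,2)] expectation_large_part[OF assms(1,3)]
    unfolding expectation_add_finite[OF fin] by linarith
qed

end

section \<open>The non-adaptive policy\<close>

text \<open>Of the history only the processed size matters. The test \<open>W < h\<close> comes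
  before the next visit, so the job that overruns the budget is the last one, as the problem
  permits.\<close>

primrec walk :: "nat \<Rightarrow> nat \<Rightarrow> nat list \<Rightarrow> policy" where
  "walk W h [] = Stop"
| "walk W h (v # vs) = (if W < h then Stop else Visit v (\<lambda>x. walk W (h + fst x) vs))"

lemma visits_walk_prefix: "prefix (visits (walk W h vs) f) vs"
  by (induction vs arbitrary: h) auto

lemma visits_walk_size:
  "visits (walk W h vs) f = [] \<or> h + (\<Sum>v\<leftarrow>butlast (visits (walk W h vs) f). fst (f v)) \<le> W"
proof (induction vs arbitrary: h)
  case (Cons v vs)
  show ?case using Cons[of "h + fst (f v)"] by auto
qed simp

context two_corrko_inst
begin

text \<open>There is no stopping test here: after an overrun nothing is collected anyway
  (\<open>walk_value_overrun\<close>), so the value agrees with that of the stopped walk.\<close>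

primrec walk_value :: "nat \<Rightarrow> nat list \<Rightarrow> real" where
  "walk_value h [] = 0"
| "walk_value h (v # vs) =
    measure_pmf.expectation (law v) (\<lambda>x. collects W h v x + walk_value (h + fst x) vs)"

lemma walk_value_overrun: "W < h \<Longrightarrow> walk_value h vs = 0"
  by (induction vs arbitrary: h) (auto simp: collects_def)

lemma collects_nonneg: "v < n \<Longrightarrow> x \<in> set_pmf (law v) \<Longrightarrow> 0 \<le> collects W h v x"
  using reward_nonneg by (auto simp: collects_def)

lemma walk_value_nonneg: "set vs \<subseteq> {..<n} \<Longrightarrow> 0 \<le> walk_value h vs"
  by (induction vs arbitrary: h)
    (auto intro!: integral_nonneg_AE add_nonneg_nonneg collects_nonneg simp: AE_measure_pmf_iff)

lemma expectation_walk:
  "set vs \<subseteq> {..<n} \<Longrightarrow>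
    measure_pmf.expectation (trace_law law' (walk W h vs)) (accumulate (collects W) h) = walk_value h vs"
proof (induction vs arbitrary: h)
  case (Cons v vs)
  show ?case
  proof (cases "W < h")
    case True
    then show ?thesis using walk_value_overrun[OF True, of "v # vs"] by simp
  next
    case False
    have "measure_pmf.expectation (trace_law law' (walk W h (v # vs))) (accumulate (collects W) h) =
      measure_pmf.expectation (law' v) (\<lambda>x. collects W h v x +
        measure_pmf.expectation (trace_law law' (walk W (h + fst x) vs)) (accumulate (collects W) (h + fst x)))"
      using False by (simp add: expectation_bind_finite finite_law' finite_trace_law expectation_add_finite)
    moreover have "law' v = law v" using Cons.prems by (simp add: law'_def)
    ultimately show ?thesis using Cons by simp
  qed
qed simp

lemma walk_feasible:
  assumes "vs \<in> paths"
  shows "corrko_feasible I (walk W 0 vs)"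
  unfolding corrko_feasible_def
proof (intro ballI)
  fix f
  have "visits (walk W 0 vs) f \<in> paths"
    using visits_walk_prefix by (intro paths_subseq[OF assms]) auto
  then show "let us = visits (walk W 0 vs) f in distinct (\<rho> # us) \<and> set us \<subseteq> {..<n} \<and>
      path_length (ck_dist I) (\<rho> # us) \<le> ck_B I \<and> (\<Sum>v\<leftarrow>butlast us. fst (f v)) \<le> W"
    using visits_walk_size[of W 0 vs f] by (auto simp: Let_def paths_def)
qed

lemma walk_policy_value:
  assumes "vs \<in> paths"
  shows "corrko_value I (walk W 0 vs) = walk_value 0 vs"
  using assms by (simp add: policy_value[OF walk_feasible] expectation_walk paths_def)

section \<open>Lower bounds on the value of a walk\<close>

definition "markov_factor = 2 / (real W + 1)"

lemma markov_factor_pos: "0 < markov_factor"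
  by (simp add: markov_factor_def)

text \<open>An integral processed size above \<open>W / 2\<close> is at least
  \<open>(W + 1) / 2\<close>. Dividing by \<open>W + 1\<close> thus suffices for Markov's
  inequality, and also covers \<open>W = 0\<close>.\<close>

lemma markov_factor_ge: "real W + 1 \<le> 2 * g \<Longrightarrow> 1 \<le> markov_factor * g"
  by (simp add: markov_factor_def le_divide_eq)

lemma markov_factor_le: "g \<le> (real W + 1) / 4 \<Longrightarrow> markov_factor * g \<le> 1 / 2"
  using mult_left_mono[of g "(real W + 1) / 4" markov_factor] markov_factor_pos by (simp add: markov_factor_def)

text \<open>By Markov's inequality, the processed size exceeds \<open>W / 2\<close> with probability at most
  \<open>2 * g / (W + 1)\<close> if its truncation at \<open>W + 1\<close> has mean \<open>g\<close>.\<close>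

primrec markov_bound :: "real \<Rightarrow> nat list \<Rightarrow> real" where
  "markov_bound g [] = 0"
| "markov_bound g (v # vs) = (1 - markov_factor * g) * small_reward v + markov_bound (g + mean_size v) vs"

text \<open>Being affine in \<open>g\<close> is the point of this bound: the expectation over the
  truncated size of the next job can be moved inside, where it becomes the mean size.\<close>

lemma markov_bound_affine:
  "markov_bound g vs = markov_bound 0 vs - markov_factor * g * (\<Sum>v\<leftarrow>vs. small_reward v)"
proof (induction vs arbitrary: g)
  case (Cons v vs)
  show ?case
    using Cons[of "g + mean_size v"] Cons[of "mean_size v"] by (simp add: algebra_simps)
qed simp

text \<open>From \<open>(W + 1) / 2\<close> on, all coefficients are nonpositive, so the bound lies
  below any walk value. This absorbs the truncation of sizes at \<open>W + 1\<close>.\<close>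

lemma markov_bound_nonpos:
  assumes "set vs \<subseteq> {..<n}" "real W + 1 \<le> 2 * g"
  shows "markov_bound g vs \<le> 0"
  using assms
proof (induction vs arbitrary: g)
  case (Cons v vs)
  have "(1 - markov_factor * g) * small_reward v \<le> 0"
    using Cons.prems small_reward_nonneg[of v] markov_factor_ge[of g] by (intro mult_nonpos_nonneg) auto
  moreover have "markov_bound (g + mean_size v) vs \<le> 0"
    using Cons.prems mean_size_nonneg[of v] by (intro Cons.IH) auto
  ultimately show ?case by simp
qed simp

lemma walk_value_ge_markov_bound:
  assumes "set vs \<subseteq> {..<n}"
  shows "markov_bound (real h) vs \<le> walk_value h vs"
  using assms
proof (induction vs arbitrary: h)
  case (Cons v vs)
  then have v: "v < n" and vs: "set vs \<subseteq> {..<n}" by auto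
  note fin = finite_law[OF v]
  let ?S = "\<Sum>v\<leftarrow>vs. small_reward v"
  let ?t = "\<lambda>x :: outcome. min (real (fst x)) (real W + 1)"
  have step: "markov_bound (real h + ?t x) vs \<le> walk_value (h + fst x) vs" for x
  proof (cases "real (fst x) \<le> real W + 1")
    case True
    then show ?thesis using Cons.IH[OF vs, of "h + fst x"] by (simp add: min_def)
  next
    case False
    then have "markov_bound (real h + ?t x) vs \<le> 0" using vs by (intro markov_bound_nonpos) auto
    then show ?thesis using walk_value_nonneg[OF vs, of "h + fst x"] by linarith
  qed
  have "markov_bound (real h + mean_size v) vs =
      measure_pmf.expectation (law v) (\<lambda>x. markov_bound (real h + ?t x) vs)"
  proof -
    have affine: "markov_bound (real h + t) vs = (markov_bound 0 vs - markov_factor * real h * ?S) + - (markov_factor * ?S) * t" for t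
      by (subst markov_bound_affine) (simp add: algebra_simps)
    have "measure_pmf.expectation (law v) (\<lambda>x. markov_bound (real h + ?t x) vs) =
      markov_bound 0 vs - markov_factor * real h * ?S + - (markov_factor * ?S) * mean_size v"
      unfolding affine mean_size_eq[OF v] by (subst expectation_add_finite[OF fin]) simp
    also have "\<dots> = markov_bound (real h + mean_size v) vs"
      by (rule affine[symmetric])
    finally show ?thesis by simp
  qed
  moreover have "(1 - markov_factor * real h) * small_reward v \<le>
      measure_pmf.expectation (law v) (collects W h v)"
  \<comment> \<open>Up to \<open>W / 2\<close> every small outcome still fits. Beyond that the
    coefficient is nonpositive, because \<open>2 * h\<close> is at least \<open>W + 1\<close> by
    integrality.\<close>
  proof (cases "2 * h \<le> W")
    case True
    have "(1 - markov_factor * real h) * small_reward v \<le> 1 * small_reward v"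
      using small_reward_nonneg[OF v] markov_factor_pos by (intro mult_right_mono) auto
    also have "\<dots> \<le> measure_pmf.expectation (law v) (collects W h v)"
      unfolding small_reward_eq[OF v] mult_1 using True reward_nonneg[OF v]
      by (intro expectation_mono_finite[OF fin]) (auto simp: collects_def)
    finally show ?thesis .
  next
    case False
    then have "W + 1 \<le> 2 * h" by simp
    then have "real (W + 1) \<le> real (2 * h)" by (rule of_nat_mono)
    then have "(1 - markov_factor * real h) * small_reward v \<le> 0"
      using small_reward_nonneg[OF v] markov_factor_ge[of "real h"] by (intro mult_nonpos_nonneg) auto
    also have "0 \<le> measure_pmf.expectation (law v) (collects W h v)"
      using collects_nonneg[OF v] by (intro integral_nonneg_AE) (auto simp: AE_measure_pmf_iff)
    finally show ?thesis .
  qed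
  moreover have "measure_pmf.expectation (law v) (\<lambda>x. markov_bound (real h + ?t x) vs) \<le>
      measure_pmf.expectation (law v) (\<lambda>x. walk_value (h + fst x) vs)"
    using step by (intro expectation_mono_finite[OF fin])
  ultimately show ?case by (simp add: expectation_add_finite[OF fin])
qed simp

text \<open>The deadline \<open>(W + 1) / 4\<close> on the mean size before a vertex makes every
  coefficient of \<open>markov_bound\<close> at least 1/2.\<close>

lemma small_instance_walk_value:
  assumes "knap_orientkd_feasible (small_instance I) (\<rho> # vs)"
  shows "(\<Sum>v\<leftarrow>vs. small_reward v) \<le> 2 * walk_value 0 vs"
proof -
  from assms have vs: "set vs \<subseteq> {..<n}" and "on_time mean_size (\<lambda>_. (real W + 1) / 4) 0 vs"
    by (auto simp: small_instance_iff paths_def)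
  have "(\<Sum>v\<leftarrow>vs. small_reward v) \<le> 2 * markov_bound g vs"
    if "on_time mean_size (\<lambda>_. (real W + 1) / 4) g vs" for g
    using that vs
  proof (induction vs arbitrary: g)
    case (Cons v vs)
    have "1 / 2 * small_reward v \<le> (1 - markov_factor * g) * small_reward v"
      using Cons.prems small_reward_nonneg[of v] markov_factor_le[of g] by (intro mult_right_mono) auto
    with Cons show ?case by fastforce
  qed simp
  with walk_value_ge_markov_bound[OF vs, of 0] \<open>on_time _ _ 0 vs\<close> show ?thesis by fastforce
qed

text \<open>A Horner scheme: each large reward is weighted with the probability that all earlier
  jobs of the list turn out small.\<close>

primrec survival_bound :: "nat list \<Rightarrow> real" where
  "survival_bound [] = 0"
| "survival_bound (v # vs) = large_reward v + (1 - large_prob v) * survival_bound vs"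

lemma large_prob_le_1: "v < n \<Longrightarrow> large_prob v \<le> 1"
  using expectation_mono_finite[OF finite_law, of v "\<lambda>x. if W < 2 * fst x then 1 else 0" "\<lambda>_. 1"]
  by (simp add: large_prob_eq)

lemma survival_bound_nonneg: "set vs \<subseteq> {..<n} \<Longrightarrow> 0 \<le> survival_bound vs"
  by (induction vs) (auto intro!: add_nonneg_nonneg mult_nonneg_nonneg simp: large_reward_nonneg large_prob_le_1)

text \<open>While all outcomes are small, the processed size is at most the total
  \<open>small_size\<close> of the visited vertices, so the deadline leaves room for every large
  outcome of size at most \<open>W\<close>. After the first large outcome the rest of the walk is
  estimated by 0.\<close>

lemma walk_value_ge_survival_bound:
  assumes "set vs \<subseteq> {..<n}" "on_time small_size (\<lambda>v. real W - large_size v) (real h) vs"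
  shows "survival_bound vs \<le> walk_value h vs"
  using assms
proof (induction vs arbitrary: h)
  case (Cons v vs)
  then have v: "v < n" and vs: "set vs \<subseteq> {..<n}" by auto
  note fin = finite_law[OF v]
  have "1 - large_prob v = measure_pmf.expectation (law v) (\<lambda>x. if W < 2 * fst x then 0 else 1)"
  proof -
    have "measure_pmf.expectation (law v) (\<lambda>x. if W < 2 * fst x then 0 else 1 :: real) + large_prob v =
        measure_pmf.expectation (law v) (\<lambda>x. (if W < 2 * fst x then 0 else 1) + (if W < 2 * fst x then 1 else 0))"
      unfolding large_prob_eq[OF v] by (rule expectation_add_finite[OF fin, symmetric])
    also have "\<dots> = measure_pmf.expectation (law v) (\<lambda>_. 1)"
      by (intro expectation_cong_set_pmf) auto
    finally show ?thesis by simp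
  qed
  then have "survival_bound (v # vs) = measure_pmf.expectation (law v) (\<lambda>x.
      (if W < 2 * fst x \<and> fst x \<le> W then real_of_rat (snd x) else 0) +
      (if W < 2 * fst x then 0 else 1) * survival_bound vs)"
    by (subst expectation_add_finite[OF fin]) (simp add: large_reward_eq[OF v])
  also have "\<dots> \<le> walk_value h (v # vs)"
    unfolding walk_value.simps
  proof (rule expectation_mono_finite[OF fin])
    fix x assume x: "x \<in> set_pmf (law v)"
    show "(if W < 2 * fst x \<and> fst x \<le> W then real_of_rat (snd x) else 0) +
        (if W < 2 * fst x then 0 else 1) * survival_bound vs \<le> collects W h v x + walk_value (h + fst x) vs"
    proof (cases "W < 2 * fst x")
      case True
      have "fst x \<le> W \<Longrightarrow> real (h + fst x) \<le> real W"
        using Cons.prems large_size_upper[OF v x] by simp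
      then have "fst x \<le> W \<Longrightarrow> h + fst x \<le> W" by (simp only: of_nat_le_iff)
      then show ?thesis
        using True walk_value_nonneg[OF vs, of "h + fst x"] reward_nonneg[OF v x] by (auto simp: collects_def)
    next
      case False
      have "on_time small_size (\<lambda>v. real W - large_size v) (real (h + fst x)) vs"
        using Cons.prems small_size_upper[OF v x] False by (auto elim!: on_time_antimono)
      then have "survival_bound vs \<le> walk_value (h + fst x) vs" by (rule Cons.IH[OF vs])
      with False show ?thesis using collects_nonneg[OF v x, of h] by simp
    qed
  qed
  finally show ?case .
qed simp

lemma large_reward_eq_0:
  assumes "v < n" "capped_prob v = 0"
  shows "large_reward v = 0"
proof -
  have "large_prob v = 0" using assms by (auto simp: capped_prob_def min_def split: if_splits)
  then have "large_reward v = measure_pmf.expectation (law v) (\<lambda>_. 0)"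
    unfolding large_reward_eq[OF assms(1)] large_prob_eq_0_iff[OF assms(1)]
    by (intro expectation_cong_set_pmf) (auto simp: not_less[symmetric])
  then show ?thesis by simp
qed

text \<open>Think of \<open>q\<close> as the probability that all jobs before the list were small.
  The invariant says that it exceeds 1/2 by at least the knapsack weight still to come. A factor
  \<open>1 - large_prob v\<close> lowers \<open>q\<close> by at most \<open>large_prob v\<close>,
  since \<open>q\<close> is at most 1.\<close>

lemma survival_bound_ge:
  assumes "set vs \<subseteq> {..<n}" "1 / 2 + (\<Sum>v\<leftarrow>vs. capped_prob v) \<le> q" "q \<le> 1"
  shows "(\<Sum>v\<leftarrow>vs. large_reward v) \<le> 2 * (q * survival_bound vs)"
  using assms
proof (induction vs arbitrary: q)
  case (Cons v vs)
  then have v: "v < n" and vs: "set vs \<subseteq> {..<n}" by auto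
  have nn: "0 \<le> (\<Sum>v\<leftarrow>vs. capped_prob v)"
    using vs capped_prob_bounds by (intro sum_list_nonneg) auto
  have "large_reward v \<le> 2 * q * large_reward v"
    using Cons.prems nn capped_prob_bounds[OF v] large_reward_nonneg[OF v]
    by (intro mult_right_mono[of 1 _ "large_reward v", simplified]) auto
  moreover have "(\<Sum>v\<leftarrow>vs. large_reward v) \<le> 2 * (q * (1 - large_prob v) * survival_bound vs)"
  proof (cases "large_prob v \<le> 1 / 2")
    case True
    have "q * large_prob v \<le> 1 * large_prob v"
      using Cons.prems large_prob_nonneg[OF v] by (intro mult_right_mono) auto
    moreover have "0 \<le> q * large_prob v"
      using Cons.prems nn capped_prob_bounds[OF v] large_prob_nonneg[OF v] by (intro mult_nonneg_nonneg) auto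
    ultimately show ?thesis
      using Cons.prems vs True by (intro Cons.IH) (auto simp: capped_prob_def algebra_simps)
  next
    \<comment> \<open>Here the cap is active: this vertex uses up the knapsack budget, so all later
      vertices have capped probability 0 and therefore no large reward.\<close>
    case False
    with Cons.prems nn have "(\<Sum>v\<leftarrow>vs. capped_prob v) = 0" by (auto simp: capped_prob_def)
    then have "\<forall>v\<in>set vs. capped_prob v = 0"
      using vs capped_prob_bounds by (subst (asm) sum_list_nonneg_eq_0_iff) auto
    then have "(\<Sum>v\<leftarrow>vs. large_reward v) = (\<Sum>v\<leftarrow>vs. 0)"
      using vs large_reward_eq_0 by (intro arg_cong[where f = sum_list] map_cong) auto
    moreover have "0 \<le> q * (1 - large_prob v) * survival_bound vs"
      using Cons.prems nn capped_prob_bounds[OF v] large_prob_le_1[OF v] survival_bound_nonneg[OF vs]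
      by (intro mult_nonneg_nonneg) auto
    ultimately show ?thesis by simp
  qed
  ultimately show ?case by (simp add: algebra_simps)
qed simp

lemma large_instance_walk_value:
  assumes "knap_orientkd_feasible (large_instance I) (\<rho> # vs)"
  shows "(\<Sum>v\<leftarrow>vs. large_reward v) \<le> 2 * walk_value 0 vs"
  using assms survival_bound_ge[of vs 1] walk_value_ge_survival_bound[of vs 0]
  by (auto simp: large_instance_iff paths_def)

theorem walk_approximates:
  assumes "1 \<le> \<alpha>"
    and P: "knap_orientkd_feasible (small_instance I) P"
      "\<And>Q. knap_orientkd_feasible (small_instance I) Q \<Longrightarrow>
        of_rat (orientkd_value (small_instance I) Q) \<le> \<alpha> * of_rat (orientkd_value (small_instance I) P)"
    and P': "knap_orientkd_feasible (large_instance I) P'"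
      "\<And>Q. knap_orientkd_feasible (large_instance I) Q \<Longrightarrow>
        of_rat (orientkd_value (large_instance I) Q) \<le> \<alpha> * of_rat (orientkd_value (large_instance I) P')"
    and vs: "vs = tl (if orientkd_value (small_instance I) P < orientkd_value (large_instance I) P' then P' else P)"
  shows "corrko_feasible I (walk W 0 vs)"
    and "corrko_feasible I \<sigma> \<Longrightarrow> corrko_value I \<sigma> \<le> 30 * \<alpha> * corrko_value I (walk W 0 vs)"
proof -
  obtain us us' where us: "P = \<rho> # us" "P' = \<rho> # us'"
    using feasible_deadline_instance_root[OF P(1)[unfolded small_instance_def Let_def]]
      feasible_deadline_instance_root[OF P'(1)[unfolded large_instance_def Let_def]] by auto
  let ?R = "\<Sum>v\<leftarrow>us. small_reward v" and ?R' = "\<Sum>v\<leftarrow>us'. large_reward v"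
  have paths: "us \<in> paths" "us' \<in> paths"
    using P(1) P'(1) us by (auto simp: small_instance_iff large_instance_iff)
  have vs_eq: "vs = (if ?R < ?R' then us' else us)"
  proof -
    have "orientkd_value (small_instance I) P < orientkd_value (large_instance I) P' \<longleftrightarrow> ?R < ?R'"
      unfolding us small_instance_value[OF paths(1), symmetric] large_instance_value[OF paths(2), symmetric]
      by (simp only: of_rat_less)
    with us show ?thesis by (simp add: vs)
  qed
  with paths have vs_paths: "vs \<in> paths" by simp
  then show "corrko_feasible I (walk W 0 vs)" by (rule walk_feasible)
  have best: "?R \<le> 2 * walk_value 0 vs" "?R' \<le> 2 * walk_value 0 vs"
    using small_instance_walk_value[OF P(1)[unfolded us]] large_instance_walk_value[OF P'(1)[unfolded us]]
    by (simp_all add: vs_eq split: if_splits)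
  show "corrko_value I \<sigma> \<le> 30 * \<alpha> * corrko_value I (walk W 0 vs)" if "corrko_feasible I \<sigma>"
  proof -
    have "corrko_value I \<sigma> \<le> 9 * (\<alpha> * ?R) + 6 * (\<alpha> * ?R')"
    proof (rule policy_value_le[OF that])
      fix ws
      show "(\<Sum>v\<leftarrow>ws. small_reward v) \<le> \<alpha> * ?R" if "knap_orientkd_feasible (small_instance I) (\<rho> # ws)"
        using P(2)[OF that] that paths(1) small_instance_iff unfolding us by (simp add: small_instance_value)
      show "(\<Sum>v\<leftarrow>ws. large_reward v) \<le> \<alpha> * ?R'" if "knap_orientkd_feasible (large_instance I) (\<rho> # ws)"
        using P'(2)[OF that] that paths(2) large_instance_iff unfolding us by (simp add: large_instance_value)
    qed
    \<comment> \<open>The walk earns at least half of the better of the two values, hence at least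
      half of each: \<open>2 * (9 + 6) = 30\<close>.\<close>
    also have "\<dots> \<le> 9 * (\<alpha> * (2 * walk_value 0 vs)) + 6 * (\<alpha> * (2 * walk_value 0 vs))"
      using best assms(1) by (intro add_mono mult_left_mono) auto
    also have "\<dots> = 30 * \<alpha> * corrko_value I (walk W 0 vs)"
      by (simp add: walk_policy_value[OF vs_paths])
    finally show ?thesis .
  qed
qed

end

section \<open>Sizes of rational numbers\<close>

definition height :: "rat \<Rightarrow> nat" where
  "height x = (case quotient_of x of (a, b) \<Rightarrow> nat \<bar>a\<bar> + nat b)"

text \<open>Cancelling decreases numerator and denominator. Heights can therefore be estimated on
  any representation, and sums and products need no greatest common divisors.\<close>

lemma height_le:
  assumes "x = of_int a / of_int b" "0 < b"
  shows "int (height x) \<le> \<bar>a\<bar> + b"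
proof -
  obtain a' b' where q: "quotient_of x = (a', b')" by force
  have b': "b' > 0" "coprime a' b'" "x = of_int a' / of_int b'"
    using q quotient_of_denom_pos quotient_of_coprime quotient_of_div by auto
  have "rat_of_int (a' * b) = of_int (a * b')"
    using b' assms by (simp add: field_simps)
  then have eq: "a' * b = a * b'" by (simp only: of_int_eq_iff)
  then have "b' dvd a' * b" by simp
  then have "b' dvd b" using b'(2) by (simp add: coprime_commute coprime_dvd_mult_right_iff)
  then obtain k where k: "b = b' * k" by blast
  then have "k > 0" using assms(2) b'(1) by (simp add: zero_less_mult_iff)
  have "a = a' * k" using eq b'(1) unfolding k by (simp add: ac_simps)
  have "b' \<le> b' * k" using \<open>k > 0\<close> b'(1) mult_left_mono[of 1 k b'] by simp
  moreover have "\<bar>a'\<bar> \<le> \<bar>a\<bar>"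
    using \<open>k > 0\<close> mult_left_mono[of 1 k "\<bar>a'\<bar>"] unfolding \<open>a = a' * k\<close> by (simp add: abs_mult)
  moreover have "int (height x) = \<bar>a'\<bar> + b'" using b'(1) by (simp add: height_def q)
  ultimately show ?thesis unfolding k by linarith
qed

lemma height_witness:
  obtains a b where "x = of_int a / of_int b" "0 < b" "int (height x) = \<bar>a\<bar> + b"
proof -
  obtain a b where q: "quotient_of x = (a, b)" by force
  then show ?thesis
    using that[of a b] quotient_of_denom_pos[OF q] quotient_of_div[OF q] by (auto simp: height_def)
qed

lemma height_uminus: "height (- x) = height x"
  by (simp add: height_def rat_uminus_code Let_def split: prod.splits)

lemma height_add: "height (x + y) \<le> height x * height y"
proof -
  obtain a b c d where x: "x = of_int a / of_int b" "0 < b" "int (height x) = \<bar>a\<bar> + b"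
    and y: "y = of_int c / of_int d" "0 < d" "int (height y) = \<bar>c\<bar> + d"
    using height_witness by metis
  have "x + y = of_int (a * d + c * b) / of_int (b * d)"
    using x y by (simp add: field_simps)
  then have "int (height (x + y)) \<le> \<bar>a * d + c * b\<bar> + b * d"
    using x y by (intro height_le) auto
  also have "\<dots> \<le> \<bar>a\<bar> * d + \<bar>c\<bar> * b + b * d"
    using abs_triangle_ineq[of "a * d" "c * b"] x(2) y(2) by (simp add: abs_mult)
  also have "\<dots> \<le> (\<bar>a\<bar> + b) * (\<bar>c\<bar> + d)"
    by (simp add: algebra_simps)
  finally show ?thesis by (simp flip: x(3) y(3) of_nat_mult)
qed

lemma height_diff: "height (x - y) \<le> height x * height y"
  using height_add[of x "- y"] by (simp add: height_uminus)

lemma height_mult: "height (x * y) \<le> height x * height y"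
proof -
  obtain a b c d where x: "x = of_int a / of_int b" "0 < b" "int (height x) = \<bar>a\<bar> + b"
    and y: "y = of_int c / of_int d" "0 < d" "int (height y) = \<bar>c\<bar> + d"
    using height_witness by metis
  have "x * y = of_int (a * c) / of_int (b * d)"
    using x y by simp
  then have "int (height (x * y)) \<le> \<bar>a * c\<bar> + b * d"
    using x y by (intro height_le) auto
  also have "\<dots> \<le> (\<bar>a\<bar> + b) * (\<bar>c\<bar> + d)"
    using x(2) y(2) by (simp add: algebra_simps abs_mult)
  finally show ?thesis by (simp flip: x(3) y(3) of_nat_mult)
qed

lemma height_of_nat: "height (of_nat m) \<le> m + 1"
  using height_le[of "of_nat m" "int m" 1] by simp

lemma bitlen_le: "0 \<le> a \<Longrightarrow> a < 2 ^ k \<Longrightarrow> nat (bitlen a) \<le> k"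
  using bitlen_le_iff_power[of a k] by simp

lemma less_two_power_bitlen: "0 \<le> a \<Longrightarrow> a < 2 ^ nat (bitlen a)"
  using bitlen_le_iff_power[of a "nat (bitlen a)"] bitlen_nonneg[of a] by simp

lemma val_size_of_height:
  assumes "height x \<le> 2 ^ k"
  shows "val_size (Num x) \<le> 2 * k + 2"
proof -
  obtain a b where q: "quotient_of x = (a, b)" by force
  have b: "b > 0" using quotient_of_denom_pos[OF q] .
  have "int (height x) \<le> int (2 ^ k)" using assms by (rule of_nat_mono)
  then have "\<bar>a\<bar> + b \<le> 2 ^ k" using b by (simp add: height_def q)
  \<comment> \<open>The denominator is positive, so the numerator stays strictly below
    \<open>2 ^ k\<close>. The denominator itself may equal \<open>2 ^ k\<close> and take one more
    bit; the leaf adds another unit.\<close>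
  then have "nat (bitlen \<bar>a\<bar>) \<le> k" "nat (bitlen b) \<le> Suc k"
    using b by (intro bitlen_le; simp)+
  then show ?thesis by (simp add: rat_size_def q)
qed

lemma height_of_val_size: "height x \<le> 2 ^ val_size (Num x)"
proof -
  obtain a b where q: "quotient_of x = (a, b)" by force
  have b: "b > 0" using quotient_of_denom_pos[OF q] .
  let ?j = "nat (bitlen \<bar>a\<bar>)" and ?k = "nat (bitlen b)"
  have "\<bar>a\<bar> < 2 ^ ?j" "b < 2 ^ ?k" using b by (intro less_two_power_bitlen; simp)+
  moreover have "(2 :: int) ^ ?j \<le> 2 ^ (?j + ?k)" "(2 :: int) ^ ?k \<le> 2 ^ (?j + ?k)"
    by (intro power_increasing; simp)+
  ultimately have "\<bar>a\<bar> + b \<le> 2 ^ Suc (?j + ?k)" unfolding power_Suc by linarith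
  then have "int (height x) \<le> int (2 ^ Suc (?j + ?k))" using b by (simp add: height_def q)
  then show ?thesis by (simp only: of_nat_le_iff) (simp add: rat_size_def q)
qed

text \<open>The exponent bounds the logarithm of the height, so exponents just add up under sums,
  differences and products. Conversion from and to \<open>val_size\<close> loses only a factor 2 and
  a constant.\<close>

definition short :: "nat \<Rightarrow> rat \<Rightarrow> bool" where
  "short k x \<longleftrightarrow> height x \<le> 2 ^ k"

lemma short_mono: "short k x \<Longrightarrow> k \<le> k' \<Longrightarrow> short k' x"
  unfolding short_def by (meson le_trans one_le_numeral power_increasing)

lemma short_of_val_size: "val_size (Num x) \<le> k \<Longrightarrow> short k x"
  using height_of_val_size short_mono unfolding short_def by blast

lemma val_size_of_short: "short k x \<Longrightarrow> val_size (Num x) \<le> 2 * k + 2"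
  by (simp only: short_def val_size_of_height)

lemma short_add: "short j x \<Longrightarrow> short k y \<Longrightarrow> short (j + k) (x + y)"
  unfolding short_def power_add by (meson height_add le_trans mult_le_mono)

lemma short_diff: "short j x \<Longrightarrow> short k y \<Longrightarrow> short (j + k) (x - y)"
  unfolding short_def power_add by (meson height_diff le_trans mult_le_mono)

lemma short_mult: "short j x \<Longrightarrow> short k y \<Longrightarrow> short (j + k) (x * y)"
  unfolding short_def power_add by (meson height_mult le_trans mult_le_mono)

lemma short_of_nat: "m \<le> k \<Longrightarrow> short k (of_nat m)"
proof -
  have "Suc m \<le> 2 ^ m" using less_exp[of m] by (simp only: Suc_le_eq)
  then have "short m (of_nat m)" using height_of_nat[of m] unfolding short_def by linarith
  then show "m \<le> k \<Longrightarrow> short k (of_nat m)" using short_mono by blast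
qed

lemma short_0: "short k 0"
  using short_of_nat[of 0 k] by simp

lemma short_1: "short 1 1"
  using short_of_nat[of 1 1] by simp

lemma short_half: "short 2 (1 / 2)"
  using height_le[of "1 / 2" 1 2] by (simp add: short_def)

lemma short_quarter: "short 3 (1 / 4)"
  using height_le[of "1 / 4" 1 4] by (simp add: short_def)

lemma short_sum_list:
  "(\<And>z. z \<in> set zs \<Longrightarrow> short k (f z)) \<Longrightarrow> short (k * length zs) (\<Sum>z\<leftarrow>zs. f z)"
proof (induction zs)
  case (Cons z zs)
  then show ?case using short_add[of k "f z" "k * length zs"] by simp
qed (simp add: short_0)

lemma val_size_pos: "2 \<le> val_size v"
proof (induction v)
  case (Num x)
  obtain a b where q: "quotient_of x = (a, b)" by force
  have "b > 0" using quotient_of_denom_pos[OF q] .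
  then have "0 < bitlen b" using less_two_power_bitlen[of b] by (cases "nat (bitlen b)") auto
  with q show ?case by (simp add: rat_size_def)
qed simp

section \<open>Evaluation with bounded steps and sizes\<close>

locale machine =
  fixes p :: program and orc :: "val \<Rightarrow> val" and N :: nat
  assumes N_pos: "1 \<le> N"
begin

text \<open>The cube is the size of the largest objects: a statistic of a job adds up at most
  \<open>N\<close> terms of \<open>O(N)\<close> bits, a vector has at most \<open>N\<close> such
  entries, and an objective value is a sum of at most \<open>N\<close> of them. The absolute limit
  on \<open>c\<close> gives one cost bound for all steps; \<open>2 \<le> c\<close> makes room for
  \<open>Num 0\<close>.\<close>

definition sized :: "nat \<Rightarrow> val \<Rightarrow> bool" where
  "sized c v \<longleftrightarrow> val_size v \<le> c * N ^ 3 \<and> 2 \<le> c \<and> c \<le> 1000"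

text \<open>Evaluation in \<open>k\<close> steps of cost at most \<open>1000 * N ^ 3 + 1\<close>; the bound \<open>c\<close> on the size of the
  result only serves to show that no intermediate value is larger.\<close>

definition computes :: "val list \<Rightarrow> expr \<Rightarrow> val \<Rightarrow> nat \<Rightarrow> nat \<Rightarrow> bool" where
  "computes env e v k c \<longleftrightarrow> (\<exists>t. evaluates p orc env e v t \<and> t \<le> k * (1000 * N ^ 3 + 1)) \<and> sized c v"

lemma cube_pos: "1 \<le> N ^ 3"
  using N_pos by simp

lemma sized_mono: "sized c v \<Longrightarrow> c \<le> c' \<Longrightarrow> c' \<le> 1000 \<Longrightarrow> sized c' v"
  unfolding sized_def by (auto intro: order_trans mult_right_mono)

lemma sized_Pair: "sized c u \<Longrightarrow> sized c' v \<Longrightarrow> c + c' + 1 \<le> 1000 \<Longrightarrow> sized (c + c' + 1) (Pair u v)"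
  using cube_pos by (auto simp: sized_def algebra_simps)

lemma sized_short: "sized c (Num x) \<Longrightarrow> short (c * N ^ 3) x"
  unfolding sized_def by (blast intro: short_of_val_size)

lemma short_sized:
  assumes "short (c * N ^ 3) x" "2 * c + 2 \<le> 1000"
  shows "sized (2 * c + 2) (Num x)"
proof -
  have "val_size (Num x) \<le> 2 * (c * N ^ 3) + 2" by (rule val_size_of_short[OF assms(1)])
  also have "\<dots> \<le> (2 * c + 2) * N ^ 3" using cube_pos by (simp add: algebra_simps)
  finally show ?thesis using assms(2) by (auto simp: sized_def)
qed

lemma sized_val_num: "sized c v \<Longrightarrow> short (c * N ^ 3) (val_num v)"
  by (cases v) (auto simp: short_0 intro: sized_short)

lemma sized_0: "2 \<le> c \<Longrightarrow> c \<le> 1000 \<Longrightarrow> sized c (Num 0)"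
  using short_sized[of 0 0] by (auto simp: short_0 numeral_2_eq_2 intro: sized_mono)

lemma sized_fst: "sized c v \<Longrightarrow> sized c (val_fst v)"
  using sized_0[of c] by (cases v) (auto simp: sized_def)

lemma sized_snd: "sized c v \<Longrightarrow> sized c (val_snd v)"
  using sized_0[of c] by (cases v) (auto simp: sized_def)

lemma sized_step: "sized c v \<Longrightarrow> val_size v \<le> 1000 * N ^ 3"
  unfolding sized_def by (meson le_trans mult_le_mono1)

lemma sized_1: "sized 4 (Num 1)"
proof -
  have "short (1 * N ^ 3) 1" using short_mono[OF short_1] cube_pos by simp
  from short_sized[OF this] show ?thesis by simp
qed

lemma sized_half: "sized 6 (Num (1 / 2))"
proof -
  have "short (2 * N ^ 3) (1 / 2)" using short_mono[OF short_half] cube_pos by simp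
  from short_sized[OF this] show ?thesis by simp
qed

lemma sized_quarter: "sized 8 (Num (1 / 4))"
proof -
  have "short (3 * N ^ 3) (1 / 4)" using short_mono[OF short_quarter] cube_pos by simp
  from short_sized[OF this] show ?thesis by simp
qed

lemma computes_sized: "computes env e v k c \<Longrightarrow> sized c v"
  by (simp add: computes_def)

text \<open>The new bound \<open>c'\<close> may be smaller than \<open>c\<close>, as it is justified
  by the value itself. This resets the bound after a chain of operations, in particular in every
  step of a recursion.\<close>

lemma computes_cong:
  "computes env e v k c \<Longrightarrow> v = v' \<Longrightarrow> k \<le> k' \<Longrightarrow> sized c' v' \<Longrightarrow> computes env e v' k' c'"
  unfolding computes_def by (blast intro: order_trans mult_le_mono1)

lemma computes_I1:
  assumes "computes env1 e1 v1 k1 c1"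
    and "\<And>t. evaluates p orc env1 e1 v1 t \<Longrightarrow> evaluates p orc env e v (1 + t + val_size v)"
    and "sized c v"
  shows "computes env e v (k1 + 1) c"
proof -
  obtain t where t: "evaluates p orc env1 e1 v1 t" "t \<le> k1 * (1000 * N ^ 3 + 1)"
    using assms(1) by (auto simp: computes_def)
  have "1 + t + val_size v \<le> (k1 + 1) * (1000 * N ^ 3 + 1)"
    using t(2) sized_step[OF assms(3)] by (simp add: algebra_simps)
  with assms(2)[OF t(1)] assms(3) show ?thesis by (auto simp: computes_def)
qed

lemma computes_I2:
  assumes "computes env1 e1 v1 k1 c1" "computes env2 e2 v2 k2 c2"
    and "\<And>t1 t2. evaluates p orc env1 e1 v1 t1 \<Longrightarrow> evaluates p orc env2 e2 v2 t2 \<Longrightarrow>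
      evaluates p orc env e v (1 + t1 + t2 + val_size v)"
    and "sized c v"
  shows "computes env e v (k1 + k2 + 1) c"
proof -
  obtain t1 t2 where t: "evaluates p orc env1 e1 v1 t1" "t1 \<le> k1 * (1000 * N ^ 3 + 1)"
    "evaluates p orc env2 e2 v2 t2" "t2 \<le> k2 * (1000 * N ^ 3 + 1)"
    using assms(1,2) by (auto simp: computes_def)
  have "1 + t1 + t2 + val_size v \<le> (k1 + k2 + 1) * (1000 * N ^ 3 + 1)"
    using t(2,4) sized_step[OF assms(4)] by (simp add: algebra_simps)
  with assms(3)[OF t(1,3)] assms(4) show ?thesis by (auto simp: computes_def)
qed

lemma computes_leaf:
  assumes "evaluates p orc env e v (1 + val_size v)" "sized c v"
  shows "computes env e v 1 c"
  using assms sized_step[OF assms(2)] by (auto simp: computes_def)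

lemma computes_Var:
  "sized c v \<Longrightarrow> i < length env \<Longrightarrow> env ! i = v \<Longrightarrow> computes env (EVar i) v 1 c"
  using computes_leaf evaluates.Var by metis

lemma computes_Var_0: "sized c v \<Longrightarrow> computes (v # env) (EVar 0) v 1 c"
  by (rule computes_Var) auto

lemma computes_Var_Suc: "computes env (EVar i) v 1 c \<Longrightarrow> computes (u # env) (EVar (Suc i)) v 1 c"
proof (rule computes_Var)
  assume *: "computes env (EVar i) v 1 c"
  then show "sized c v" by (rule computes_sized)
  from * obtain t where "evaluates p orc env (EVar i) v t" by (auto simp: computes_def)
  then show "Suc i < length (u # env)" "(u # env) ! Suc i = v" by (auto elim: evaluates_elims)
qed

lemma computes_Num: "sized c (Num x) \<Longrightarrow> computes env (ENum x) (Num x) 1 c"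
  by (rule computes_leaf[OF evaluates.Lit])

lemma computes_Cons:
  assumes "computes env e1 v1 k1 c1" "computes env e2 v2 k2 c2" "c1 + c2 + 1 \<le> 1000"
  shows "computes env (ECons e1 e2) (Pair v1 v2) (k1 + k2 + 1) (c1 + c2 + 1)"
  using assms(1,2) by (rule computes_I2)
    (rule evaluates.Cons sized_Pair computes_sized[OF assms(1)] computes_sized[OF assms(2)] assms(3) | assumption)+

lemma computes_Fst: "computes env e v k c \<Longrightarrow> computes env (EFst e) (val_fst v) (k + 1) c"
  using computes_I1[OF _ evaluates.Fst sized_fst[OF computes_sized]] by blast

lemma computes_Snd: "computes env e v k c \<Longrightarrow> computes env (ESnd e) (val_snd v) (k + 1) c"
  using computes_I1[OF _ evaluates.Snd sized_snd[OF computes_sized]] by blast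

lemma computes_Fst_Pair: "computes env e (Pair u v) k c \<Longrightarrow> computes env (EFst e) u (k + 1) c"
  using computes_Fst by fastforce

lemma computes_Snd_Pair: "computes env e (Pair u v) k c \<Longrightarrow> computes env (ESnd e) v (k + 1) c"
  using computes_Snd by fastforce

lemma computes_IsNum: "computes env e v k c \<Longrightarrow> computes env (EIsNum e) (Num (val_is_num v)) (k + 1) 4"
  by (erule computes_I1, rule evaluates.IsNum, assumption) (cases v; simp add: sized_1 sized_0)

lemma computes_Arith:
  assumes "computes env e1 v1 k1 c1" "computes env e2 v2 k2 c2" "2 * (c1 + c2) + 2 \<le> 1000"
    "f \<in> {Add, Sub, Mul, Less}"
  shows "computes env (EArith f e1 e2) (Num (arith_sem f (val_num v1) (val_num v2))) (k1 + k2 + 1) (2 * (c1 + c2) + 2)"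
  using assms(1,2)
proof (rule computes_I2)
  have "short (c1 * N ^ 3) (val_num v1)" "short (c2 * N ^ 3) (val_num v2)"
    using computes_sized[OF assms(1)] computes_sized[OF assms(2)] by (auto intro: sized_val_num)
  moreover have one: "1 \<le> (c1 + c2) * N ^ 3"
    using computes_sized[OF assms(1)] cube_pos by (auto simp: sized_def)
  moreover from one have "short ((c1 + c2) * N ^ 3) 1" by (rule short_mono[OF short_1])
  ultimately have "short ((c1 + c2) * N ^ 3) (arith_sem f (val_num v1) (val_num v2))"
    using assms(4) unfolding add_mult_distrib
    by (auto simp: short_0 intro: short_add short_diff short_mult)
  then show "sized (2 * (c1 + c2) + 2) (Num (arith_sem f (val_num v1) (val_num v2)))"
    using assms(3) by (rule short_sized)
qed (erule (1) evaluates.Arith, rule refl)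

text \<open>Charging for both branches gives a step count that can be read off the expression,
  whatever the test yields.\<close>

lemma computes_If:
  assumes "computes env e0 u k0 c0" "val_num u \<noteq> 0 \<Longrightarrow> computes env e1 x k1 c1"
    "val_num u = 0 \<Longrightarrow> computes env e2 y k2 c2" "max c1 c2 \<le> 1000"
  shows "computes env (EIf e0 e1 e2) (if val_num u \<noteq> 0 then x else y) (k0 + k1 + k2 + 1) (max c1 c2)"
proof (cases "val_num u = 0")
  case True
  note e2 = assms(3)[OF True]
  have "computes env (EIf e0 e1 e2) y (k0 + k2 + 1) c2"
    using assms(1) e2 by (rule computes_I2) (erule (1) evaluates.IfFalse[OF _ True], rule computes_sized[OF e2])
  from computes_cong[OF this refl _ sized_mono[OF computes_sized[OF this] _ assms(4)]] True
  show ?thesis by simp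
next
  case False
  note e1 = assms(2)[OF False]
  have "computes env (EIf e0 e1 e2) x (k0 + k1 + 1) c1"
    using assms(1) e1 by (rule computes_I2) (erule (1) evaluates.IfTrue[OF _ False], rule computes_sized[OF e1])
  from computes_cong[OF this refl _ sized_mono[OF computes_sized[OF this] _ assms(4)]] False
  show ?thesis by simp
qed

lemma computes_Let:
  assumes "computes env e1 u k1 c1" "computes (u # env) e2 v k2 c2"
  shows "computes env (ELet e1 e2) v (k1 + k2 + 1) c2"
  using assms by (rule computes_I2) (erule (1) evaluates.Let, rule computes_sized[OF assms(2)])

lemma computes_Call:
  assumes "computes [u'] (p ! f) v k2 c2" "f < length p" "computes env e u k1 c1" "u = u'"
  shows "computes env (ECall f e) v (k1 + k2 + 1) c2"
  using assms(3,1) unfolding assms(4)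
  by (rule computes_I2) (erule (1) evaluates.Call[OF _ assms(2)], rule computes_sized[OF assms(1)])

lemma computes_Oracle:
  assumes "computes env e u k c" "u = u'" "orc u' = v" "sized c' v"
  shows "computes env (EOracle e) v (k + 1) c'"
  using assms(1) unfolding assms(2) assms(3)[symmetric]
  by (rule computes_I1) (erule evaluates.Oracle, simp add: assms)

end

text \<open>A recursion on a list in the second component of the argument, with the first component as a
  fixed parameter. The step is evaluated with the recursive result as variable 0 and the argument as
  variable 1.\<close>

abbreviation "V0 \<equiv> EVar 0"
abbreviation "V1 \<equiv> EVar (Suc 0)"
abbreviation "V2 \<equiv> EVar (Suc (Suc 0))"
abbreviation "V3 \<equiv> EVar (Suc (Suc (Suc 0)))"

definition fold_body :: "nat \<Rightarrow> expr \<Rightarrow> expr \<Rightarrow> expr" where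
  "fold_body f base step = EIf (EIsNum (ESnd V0)) base
     (ELet (ECall f (ECons (EFst V0) (ESnd (ESnd V0)))) step)"

context machine
begin

text \<open>\<open>F\<close> is the closed form of the recursion. A step may assume the size bound
  \<open>c\<close> for the recursive result and must reestablish the same \<open>c\<close> for its
  own, so bounds do not accumulate. The \<open>suffix\<close> premise gives access to facts about
  the entries of the original list.\<close>

lemma computes_fold:
  assumes f: "f < length p" "p ! f = fold_body f base step"
    and arg: "sized ca (Pair u (enc_list g xs))" "2 * ca + 1 \<le> 1000"
    and base: "computes [Pair u (Num 0)] base (F []) kb c"
    and step: "\<And>x xs'. suffix (x # xs') xs \<Longrightarrow> sized c (F xs') \<Longrightarrow>
      sized ca (Pair u (Pair (g x) (enc_list g xs'))) \<Longrightarrow>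
      computes [F xs', Pair u (Pair (g x) (enc_list g xs'))] step (F (x # xs')) ks c"
  shows "computes [Pair u (enc_list g xs)] (p ! f) (F xs) ((kb + ks + 20) * (length xs + 1)) c"
proof -
  have "sized ca (Pair u (enc_list g ys)) \<Longrightarrow>
      computes [Pair u (enc_list g ys)] (p ! f) (F ys) ((kb + ks + 20) * (length ys + 1)) c"
    if "suffix ys xs" for ys
    using that
  proof (induction ys)
    case Nil
    note c = computes_sized[OF base]
    have "computes [Pair u (Num 0)] (fold_body f base step) (F []) (3 + kb + 0 + 1) (max c c)"
      unfolding fold_body_def
      \<comment> \<open>The shape of the list decides the test. The premise for the other branch is
        vacuous, and its value and costs can be chosen at will.\<close>
      by (rule computes_cong[OF computes_If[where x = "F []" and y = "F []" and ?k2.0 = 0 and ?c2.0 = c]])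
        (rule computes_IsNum computes_Snd_Pair computes_Var_0 Nil(1)[unfolded enc_list.simps] base |
          (use c in \<open>simp add: sized_def\<close>; fail))+
    then show ?case
      unfolding f(2) using c by (auto elim!: computes_cong)
  next
    case (Cons x ys)
    have suf: "suffix ys xs" using Cons.prems(2) by (metis suffix_ConsD)
    have sz: "sized ca (Pair u (enc_list g ys))" using Cons.prems(1) by (auto simp: sized_def)
    note rec = Cons.IH[OF sz suf]
    note st = step[OF Cons.prems(2) computes_sized[OF rec] Cons.prems(1)[unfolded enc_list.simps]]
    have "computes [Pair u (Pair (g x) (enc_list g ys))] (fold_body f base step) (F (x # ys))
        (3 + 0 + (8 + (kb + ks + 20) * (length ys + 1) + 1 + ks + 1) + 1) (max c c)"
      unfolding fold_body_def
      by (rule computes_cong[OF computes_If[where x = "F (x # ys)" and y = "F (x # ys)" and ?k1.0 = 0 and ?c1.0 = c]])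
        (rule computes_IsNum computes_Snd_Pair computes_Fst_Pair computes_Var_0 Cons.prems(1)[unfolded enc_list.simps]
            computes_Let[OF _ st] computes_Call[OF rec f(1)] computes_Cons refl |
          (use computes_sized[OF st] arg(2) in \<open>simp add: sized_def\<close>; fail))+
    then show ?case
      unfolding f(2) enc_list.simps using computes_sized[OF st] by (auto elim!: computes_cong)
  qed
  with arg(1) show ?thesis by simp
qed

end

section \<open>The program\<close>

definition "param = EFst V1"
definition "item = EFst (ESnd V1)"

abbreviation "item_size \<equiv> EFst (EFst item)"
abbreviation "item_reward \<equiv> ESnd (EFst item)"
abbreviation "item_prob \<equiv> ESnd item"

definition "reward_step = EIf (EArith Less param item_size) V0 (EArith Add (EArith Mul item_prob item_reward) V0)"

definition "tail_step = EIf (EArith Less param item_size) (EArith Add item_prob V0) V0"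

definition "mean_step = EIf (EArith Less param item_size)
  (EArith Add (EArith Mul item_prob param) V0) (EArith Add (EArith Mul item_prob item_size) V0)"

definition "max_step = EIf (EArith Less (ENum 0) item_prob)
  (EIf (EArith Less param item_size) V0 (EIf (EArith Less V0 item_size) item_size V0)) V0"

text \<open>The result of a vector fold is paired with its length, and the parameter is paired with the
  number of vertices after the root, so as to recognize the position of the root.\<close>

definition "vector_step e = ECons (EArith Add (EFst V0) (ENum 1))
  (ECons (EIf (EArith Sub (EFst V0) (EFst param)) e (ENum 0)) (ESnd V0))"

abbreviation "budget \<equiv> ESnd param"
abbreviation "half_budget \<equiv> EArith Mul (ENum (1 / 2)) budget"

definition "small_reward_expr = ECall 1 (ECons half_budget item)"
definition "mean_expr = ECall 3 (ECons (EArith Add budget (ENum 1)) item)"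
definition "small_deadline_expr = EArith Add (EArith Mul (ENum (1 / 4)) (EArith Add budget (ENum 1))) mean_expr"
definition "large_reward_expr = EArith Sub (ECall 1 (ECons budget item)) small_reward_expr"
definition "small_size_expr = ECall 4 (ECons half_budget item)"
definition "large_deadline_expr = EArith Add (EArith Sub budget (ECall 4 (ECons budget item))) small_size_expr"
definition "capped_expr = ELet (ECall 2 (ECons half_budget item))
  (EIf (EArith Less (ENum (1 / 2)) V0) (ENum (1 / 2)) V0)"

text \<open>Positions are counted from the end, because the recursion returns from the tail: the
  entry is taken where the number of entries behind it equals the parameter.\<close>

definition "lookup_step = ECons (EArith Add (EFst V0) (ENum 1))
  (EIf (EArith Sub (EFst V0) param) (ESnd V0) item)"

text \<open>The first component of the parameter is one less than the number of vertices.
  Subtracting a vertex from it gives its position from the end of the reward vector.\<close>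

definition "objective_step = EArith Add (ESnd (ECall 13 (ECons (EArith Sub (EFst param) item) (ESnd param)))) V0"

definition "size_step = EArith Add (EFst (ESnd item)) V0"

definition "vector_body f e = fold_body f (ECons (ENum 0) (ENum 0)) (vector_step e)"

text \<open>The oracle returns only a path. Its value is recomputed from the reward vector, since
  the main function has to compare the two answers.\<close>

definition "solve_body fr fw fk fb =
  (let n = \<lambda>x. EFst x; dist = \<lambda>x. EFst (ESnd x); root = \<lambda>x. EFst (ESnd (ESnd x));
       B = \<lambda>x. EFst (ESnd (ESnd (ESnd x))); W = \<lambda>x. EFst (ESnd (ESnd (ESnd (ESnd x))));
       jobs = \<lambda>x. EFst (ESnd (ESnd (ESnd (ESnd (ESnd x)))))
   in ELet (ECons (EArith Sub (EArith Sub (n V0) (ENum 1)) (root V0)) (W V0))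
     (ELet (ESnd (ECall fr (ECons V0 (jobs V1))))
     (ELet (EOracle (ECons (n V2) (ECons (dist V2) (ECons (root V2) (ECons (B V2) (ECons V0
         (ECons (ESnd (ECall fw (ECons V1 (jobs V2)))) (ECons (ESnd (ECall fk (ECons V1 (jobs V2))))
         (ECons (ESnd (ECall fb (ECons V1 (jobs V2)))) (ECons (ENum (1 / 2)) (ENum 0)))))))))))
     (ECons V0 (ECall 14 (ECons (ECons (EArith Sub (n V3) (ENum 1)) V1) V0))))))"

text \<open>Nothing is remembered between decisions: both instances are solved again for every
  history. The oracle is a function, so the same path results each time, and the history tells how
  far it has been followed and how much has been processed.\<close>

definition "main_body = ELet (ECall 17 (EFst V0)) (ELet (ECall 18 (EFst V1))
  (ELet (ECall 16 (ECons (EIf (EArith Less (ESnd V1) (ESnd V0)) (ESnd (EFst V0)) (ESnd (EFst V1))) (ESnd V2)))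
  (EIf (EArith Less (EFst (ESnd (ESnd (ESnd (ESnd (EFst V3)))))) (ECall 15 (ECons (ENum 0) (ESnd V3))))
    (ENum 0) (EIf (EIsNum V0) (ENum 0) (ECons (EFst V0) (ENum 0))))))"

definition "deadline_program =
  [main_body,
   fold_body 1 (ENum 0) reward_step, fold_body 2 (ENum 0) tail_step,
   fold_body 3 (ENum 0) mean_step, fold_body 4 (ENum 0) max_step,
   vector_body 5 small_reward_expr, vector_body 6 mean_expr,
   vector_body 7 small_deadline_expr, vector_body 8 (ENum 0),
   vector_body 9 large_reward_expr, vector_body 10 small_size_expr,
   vector_body 11 large_deadline_expr, vector_body 12 capped_expr,
   fold_body 13 (ECons (ENum 0) (ENum 0)) lookup_step, fold_body 14 (ENum 0) objective_step,
   fold_body 15 (ENum 0) size_step, fold_body 16 (EFst V0) (ESnd V0),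
   solve_body 5 6 7 8, solve_body 9 10 11 12]"

lemma length_deadline_program: "length deadline_program = 19"
  by (simp add: deadline_program_def)

lemma nth_deadline_program:
  "deadline_program ! 0 = main_body"
  "deadline_program ! 1 = fold_body 1 (ENum 0) reward_step"
  "deadline_program ! 2 = fold_body 2 (ENum 0) tail_step"
  "deadline_program ! 3 = fold_body 3 (ENum 0) mean_step"
  "deadline_program ! 4 = fold_body 4 (ENum 0) max_step"
  "deadline_program ! 5 = vector_body 5 small_reward_expr"
  "deadline_program ! 6 = vector_body 6 mean_expr"
  "deadline_program ! 7 = vector_body 7 small_deadline_expr"
  "deadline_program ! 8 = vector_body 8 (ENum 0)"
  "deadline_program ! 9 = vector_body 9 large_reward_expr"
  "deadline_program ! 10 = vector_body 10 small_size_expr"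
  "deadline_program ! 11 = vector_body 11 large_deadline_expr"
  "deadline_program ! 12 = vector_body 12 capped_expr"
  "deadline_program ! 13 = fold_body 13 (ECons (ENum 0) (ENum 0)) lookup_step"
  "deadline_program ! 14 = fold_body 14 (ENum 0) objective_step"
  "deadline_program ! 15 = fold_body 15 (ENum 0) size_step"
  "deadline_program ! 16 = fold_body 16 (EFst V0) (ESnd V0)"
  "deadline_program ! 17 = solve_body 5 6 7 8"
  "deadline_program ! 18 = solve_body 9 10 11 12"
  by (simp_all add: deadline_program_def)

section \<open>Encodings and the functions on single jobs\<close>

lemma length_le_enc_list: "length xs \<le> val_size (enc_list g xs)"
  by (induction xs) auto

lemma enc_list_element: "x \<in> set xs \<Longrightarrow> val_size (g x) \<le> val_size (enc_list g xs)"
  by (induction xs) auto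

lemma val_size_enc_list_le:
  "(\<And>x. x \<in> set xs \<Longrightarrow> val_size (g x) \<le> m) \<Longrightarrow> val_size (enc_list g xs) \<le> length xs * (m + 1) + 2"
proof (induction xs)
  case Nil
  then show ?case using val_size_of_short[OF short_0[of 0]] by simp
next
  case (Cons x xs)
  then have "val_size (g x) \<le> m" "val_size (enc_list g xs) \<le> length xs * (m + 1) + 2" by auto
  then show ?case by simp
qed

lemma enc_list_map: "enc_list f (map g xs) = enc_list (f \<circ> g) xs"
  by (induction xs) auto

abbreviation "enc_job \<equiv> enc_list (enc_pair enc_outcome Num)"

lemma enc_job_item:
  "enc_pair enc_outcome Num z = Pair (Pair (Num (of_nat (fst (fst z)))) (Num (snd (fst z)))) (Num (snd z))"
  by (simp add: enc_pair_def enc_outcome_def enc_nat_def)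

locale program_machine = machine deadline_program orc N for orc N
begin

lemma computes_0: "computes env (ENum 0) (Num 0) 1 2"
  by (rule computes_Num[OF sized_0]) auto

lemmas computes_rules = computes_Fst_Pair computes_Snd_Pair computes_Cons computes_Let computes_If
  computes_Arith computes_0 computes_Num[OF sized_1] computes_Num[OF sized_half]
  computes_Num[OF sized_quarter]

lemma le_cube: "N \<le> N ^ 3" "N ^ 2 \<le> N ^ 3"
  using N_pos by (simp_all add: self_le_power power_increasing)

lemma sized_short_le: "short m x \<Longrightarrow> m \<le> k * N ^ 3 \<Longrightarrow> 2 * k + 2 \<le> 1000 \<Longrightarrow> c = 2 * k + 2 \<Longrightarrow> sized c (Num x)"
  using short_sized[of k x] short_mono by blast

lemma sized_input: "val_size v \<le> N \<Longrightarrow> sized 2 v"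
  unfolding sized_def using le_cube(1) by linarith

text \<open>The bound \<open>8 * N\<close> on the terms leaves room for the product of a probability
  with a threshold, which are short for \<open>N\<close> and \<open>4 * N\<close>.\<close>

lemma short_sum:
  assumes "\<And>z. z \<in> set zs \<Longrightarrow> short (8 * N) (f z)" "length zs \<le> N"
  shows "short (8 * N ^ 2) (\<Sum>z\<leftarrow>zs. f z)"
  using short_sum_list[of zs "8 * N" f, OF assms(1)]
  by (rule short_mono) (use assms(2) in \<open>auto simp: power2_eq_square\<close>)

lemma sized_sum:
  assumes "\<And>z. z \<in> set zs \<Longrightarrow> short (8 * N) (f z)" "length zs \<le> N"
  shows "sized 18 (Num (\<Sum>z\<leftarrow>zs. f z))"
  using short_sum[OF assms] by (rule sized_short_le[where k = 8]) (use le_cube in auto)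

lemma job_entries:
  assumes "val_size (enc_job zs) \<le> N" "z \<in> set zs"
  shows "short N (of_nat (fst (fst z)))" "short N (snd (fst z))" "short N (snd z)"
proof -
  have "val_size (enc_pair enc_outcome Num z) \<le> N"
    using enc_list_element[OF assms(2)] assms(1) by (rule le_trans)
  then show "short N (of_nat (fst (fst z)))" "short N (snd (fst z))" "short N (snd z)"
    by (auto simp: enc_job_item intro!: short_of_val_size)
qed

lemma short_job_reward:
  "val_size (enc_job zs) \<le> N \<Longrightarrow> set ys \<subseteq> set zs \<Longrightarrow> length ys \<le> N \<Longrightarrow> short (8 * N ^ 2) (job_reward t ys)"
  unfolding job_reward_def
  by (rule short_sum) (auto simp: short_0 subset_iff intro!: short_mono[OF short_mult[of N _ N]] job_entries)

lemma short_job_tail: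
  "val_size (enc_job zs) \<le> N \<Longrightarrow> set ys \<subseteq> set zs \<Longrightarrow> length ys \<le> N \<Longrightarrow> short (8 * N ^ 2) (job_tail t ys)"
  unfolding job_tail_def
  by (rule short_sum) (auto simp: short_0 subset_iff intro!: short_mono[of N _ "8 * N"] job_entries)

lemma short_job_mean:
  "val_size (enc_job zs) \<le> N \<Longrightarrow> set ys \<subseteq> set zs \<Longrightarrow> length ys \<le> N \<Longrightarrow> short (4 * N) t \<Longrightarrow>
    short (8 * N ^ 2) (job_mean t ys)"
  unfolding job_mean_def
  by (rule short_sum)
    (auto simp: subset_iff intro!: short_mono[OF short_mult[of N _ "4 * N"]] job_entries short_mono[of N _ "4 * N"])

lemma short_job_max:
  "val_size (enc_job zs) \<le> N \<Longrightarrow> set ys \<subseteq> set zs \<Longrightarrow> short N (job_max t ys)"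
  using job_max_attained[of t ys] job_entries(1)[of zs] by (fastforce simp: short_0)

lemma short_job_max_square: "val_size (enc_job zs) \<le> N \<Longrightarrow> set ys \<subseteq> set zs \<Longrightarrow> short (8 * N ^ 2) (job_max t ys)"
  by (rule short_mono[OF short_job_max]) (auto simp: power2_eq_square N_pos)

text \<open>The size of the partial results comes from the closed form \<open>F\<close>, so a step
  may be evaluated with any bound. Here 18 = 2 * 8 + 2 belongs to numbers that are short for
  \<open>8 * N ^ 2\<close>, and 13 = 10 + 2 + 1 to the pair of threshold and list.\<close>

lemma computes_job_fold:
  assumes f: "f < 19" "deadline_program ! f = fold_body f (ENum 0) step"
    and job: "val_size (enc_job zs) \<le> N" and t: "short (4 * N) t"
    and F: "F [] = 0" "\<And>ys. set ys \<subseteq> set zs \<Longrightarrow> length ys \<le> N \<Longrightarrow> short (8 * N ^ 2) (F ys)"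
    and step: "\<And>z ys. sized 18 (Num (F ys)) \<Longrightarrow> sized 13 (Pair (Num t) (Pair (enc_pair enc_outcome Num z) (enc_job ys))) \<Longrightarrow>
      \<exists>v k c. computes [Num (F ys), Pair (Num t) (Pair (enc_pair enc_outcome Num z) (enc_job ys))] step v k c \<and>
        v = Num (F (z # ys)) \<and> k \<le> 60"
  shows "computes [Pair (Num t) (enc_job zs)] (deadline_program ! f) (Num (F zs)) (100 * (N + 1)) 18"
proof -
  have len: "length zs \<le> N" using length_le_enc_list job by (rule le_trans)
  have sized_F: "sized 18 (Num (F ys))" if "suffix ys zs" for ys
    by (rule sized_short_le[OF F(2), where k = 8])
      (use that len set_mono_suffix[OF that] suffix_length_le[OF that] le_cube in auto)
  have arg: "sized (10 + 2 + 1) (Pair (Num t) (enc_job zs))"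
    by (rule sized_Pair[OF sized_short_le[OF t, where k = 4] sized_input[OF job]]) (use le_cube in auto)
  have "computes [Pair (Num t) (enc_job zs)] (deadline_program ! f) (Num (F zs)) ((1 + 60 + 20) * (length zs + 1)) 18"
  proof (rule computes_fold[where F = "\<lambda>ys. Num (F ys)" and ca = 13])
    show "computes [Pair (Num t) (Num 0)] (ENum 0) (Num (F [])) 1 18"
      unfolding F(1) by (rule computes_Num[OF sized_0]) auto
  next
    fix z ys assume suf: "suffix (z # ys) zs" and *: "sized 18 (Num (F ys))"
      "sized 13 (Pair (Num t) (Pair (enc_pair enc_outcome Num z) (enc_job ys)))"
    from step[OF *] obtain k c where
      "computes [Num (F ys), Pair (Num t) (Pair (enc_pair enc_outcome Num z) (enc_job ys))] step (Num (F (z # ys))) k c"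
      "k \<le> 60" by blast
    then show "computes [Num (F ys), Pair (Num t) (Pair (enc_pair enc_outcome Num z) (enc_job ys))] step (Num (F (z # ys))) 60 18"
      by (rule computes_cong[OF _ refl]) (rule sized_F[OF suf])
  qed (use f arg in \<open>auto simp: length_deadline_program\<close>)
  then show ?thesis
    by (rule computes_cong[OF _ refl]) (use sized_F[of zs] len in auto)
qed

lemma computes_job_reward:
  assumes "val_size (enc_job zs) \<le> N" "short (4 * N) t"
  shows "computes [Pair (Num t) (enc_job zs)] (deadline_program ! 1) (Num (job_reward t zs)) (100 * (N + 1)) 18"
proof (rule computes_job_fold[OF _ nth_deadline_program(2) assms])
  fix z ys
  assume "sized 18 (Num (job_reward t ys))"
    "sized 13 (Pair (Num t) (Pair (enc_pair enc_outcome Num z) (enc_job ys)))"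
  note sized = this[unfolded enc_job_item]
  show "\<exists>v k c. computes [Num (job_reward t ys), Pair (Num t) (Pair (enc_pair enc_outcome Num z) (enc_job ys))]
      reward_step v k c \<and> v = Num (job_reward t (z # ys)) \<and> k \<le> 60"
    unfolding reward_step_def param_def item_def enc_job_item
    \<comment> \<open>Value, step count and bound stay schematic while the rules follow the
      expression. Only the comparison with the claimed value and with 60 remains.\<close>
    by (intro exI conjI, (rule computes_rules computes_Var_Suc computes_Var_0 sized | (simp; fail))+)
      (simp_all add: job_reward_def)
qed (use assms in \<open>auto simp: job_reward_def[of t \<open>[]\<close>] intro: short_job_reward\<close>)

lemma computes_job_tail:
  assumes "val_size (enc_job zs) \<le> N" "short (4 * N) t"
  shows "computes [Pair (Num t) (enc_job zs)] (deadline_program ! 2) (Num (job_tail t zs)) (100 * (N + 1)) 18"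
proof (rule computes_job_fold[OF _ nth_deadline_program(3) assms])
  fix z ys
  assume "sized 18 (Num (job_tail t ys))"
    "sized 13 (Pair (Num t) (Pair (enc_pair enc_outcome Num z) (enc_job ys)))"
  note sized = this[unfolded enc_job_item]
  show "\<exists>v k c. computes [Num (job_tail t ys), Pair (Num t) (Pair (enc_pair enc_outcome Num z) (enc_job ys))]
      tail_step v k c \<and> v = Num (job_tail t (z # ys)) \<and> k \<le> 60"
    unfolding tail_step_def param_def item_def enc_job_item
    by (intro exI conjI, (rule computes_rules computes_Var_Suc computes_Var_0 sized | (simp; fail))+)
      (simp_all add: job_tail_def)
qed (use assms in \<open>auto simp: job_tail_def[of t \<open>[]\<close>] intro: short_job_tail\<close>)

lemma computes_job_mean:
  assumes "val_size (enc_job zs) \<le> N" "short (4 * N) t"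
  shows "computes [Pair (Num t) (enc_job zs)] (deadline_program ! 3) (Num (job_mean t zs)) (100 * (N + 1)) 18"
proof (rule computes_job_fold[OF _ nth_deadline_program(4) assms])
  fix z ys
  assume "sized 18 (Num (job_mean t ys))"
    "sized 13 (Pair (Num t) (Pair (enc_pair enc_outcome Num z) (enc_job ys)))"
  note sized = this[unfolded enc_job_item]
  show "\<exists>v k c. computes [Num (job_mean t ys), Pair (Num t) (Pair (enc_pair enc_outcome Num z) (enc_job ys))]
      mean_step v k c \<and> v = Num (job_mean t (z # ys)) \<and> k \<le> 60"
    unfolding mean_step_def param_def item_def enc_job_item
    by (intro exI conjI, (rule computes_rules computes_Var_Suc computes_Var_0 sized | (simp; fail))+)
      (simp_all add: job_mean_def)
qed (use assms in \<open>auto simp: job_mean_def[of t \<open>[]\<close>] intro: short_job_mean\<close>)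

lemma computes_job_max:
  assumes "val_size (enc_job zs) \<le> N" "short (4 * N) t"
  shows "computes [Pair (Num t) (enc_job zs)] (deadline_program ! 4) (Num (job_max t zs)) (100 * (N + 1)) 18"
proof (rule computes_job_fold[OF _ nth_deadline_program(5) assms])
  fix z ys
  assume "sized 18 (Num (job_max t ys))"
    "sized 13 (Pair (Num t) (Pair (enc_pair enc_outcome Num z) (enc_job ys)))"
  note sized = this[unfolded enc_job_item]
  show "\<exists>v k c. computes [Num (job_max t ys), Pair (Num t) (Pair (enc_pair enc_outcome Num z) (enc_job ys))]
      max_step v k c \<and> v = Num (job_max t (z # ys)) \<and> k \<le> 60"
    unfolding max_step_def param_def item_def enc_job_item
    by (intro exI conjI, (rule computes_rules computes_Var_Suc computes_Var_0 sized | (simp; fail))+)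
      (simp_all add: job_max_def)
qed (use assms in \<open>auto simp: job_max_def[of t \<open>[]\<close>] intro: short_job_max_square\<close>)

end

section \<open>Vectors over all vertices\<close>

primrec mark_root :: "nat \<Rightarrow> ('a \<Rightarrow> rat) \<Rightarrow> 'a list \<Rightarrow> rat list" where
  "mark_root m f [] = []"
| "mark_root m f (x # xs) = (if length xs = m then 0 else f x) # mark_root m f xs"

lemma length_mark_root: "length (mark_root m f xs) = length xs"
  by (induction xs) auto

lemma nth_mark_root:
  "i < length xs \<Longrightarrow> mark_root m f xs ! i = (if length xs - 1 - i = m then 0 else f (xs ! i))"
  by (induction xs arbitrary: i) (auto simp: nth_Cons')

lemma set_mark_root: "y \<in> set (mark_root m f xs) \<Longrightarrow> y = 0 \<or> (\<exists>x\<in>set xs. y = f x)"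
  by (induction xs) (auto split: if_splits)

context program_machine
begin

lemma computes_weaken:
  "computes env e v k c \<Longrightarrow> v = v' \<Longrightarrow> k \<le> k' \<Longrightarrow> c \<le> c' \<Longrightarrow> c' \<le> 1000 \<Longrightarrow> computes env e v' k' c'"
  by (blast intro: computes_cong sized_mono computes_sized)

lemma sized_enc_nat: "k \<le> N \<Longrightarrow> sized 4 (enc_nat k)"
  unfolding enc_nat_def by (rule sized_short_le[OF short_of_nat[of k N], where k = 1]) (use le_cube in auto)

lemma sized_enc_list_Num:
  assumes "\<And>y. y \<in> set ys \<Longrightarrow> short (20 * N ^ 2) y" "length ys \<le> N"
  shows "sized 46 (enc_list Num ys)"
proof -
  have "val_size (enc_list Num ys) \<le> length ys * (40 * N ^ 2 + 2 + 1) + 2"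
    using assms(1) val_size_of_short by (intro val_size_enc_list_le) fastforce
  also have "\<dots> \<le> N * (40 * N ^ 2 + 2 + 1) + 2"
    by (intro add_le_mono1 mult_le_mono1 assms(2))
  also have "\<dots> = 40 * N ^ 3 + 3 * N + 2"
    by (simp add: power3_eq_cube power2_eq_square)
  also have "\<dots> \<le> 46 * N ^ 3"
    using le_cube cube_pos by linarith
  finally show ?thesis by (simp add: sized_def)
qed

text \<open>The steps granted to \<open>e\<close> cover two calls of a function on jobs. Over at
  most \<open>N\<close> entries this gives a quadratic number of steps. The bound 51 = 4 + 46 + 1 is
  for counter, list and pair.\<close>

lemma computes_vector:
  assumes f: "f < 19" "deadline_program ! f = vector_body f e"
    and jobs: "val_size (enc_list enc_job jobs) \<le> N" "m \<le> N" "val_size (enc_nat W) \<le> N"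
    and short: "\<And>x. x \<in> set jobs \<Longrightarrow> short (20 * N ^ 2) (h x)"
    and e: "\<And>y x xs. sized 51 y \<Longrightarrow> sized 10 (Pair (Pair (enc_nat m) (enc_nat W)) (Pair (enc_job x) xs)) \<Longrightarrow> x \<in> set jobs \<Longrightarrow>
      \<exists>v k c. computes [y, Pair (Pair (enc_nat m) (enc_nat W)) (Pair (enc_job x) xs)] e v k c \<and>
        v = Num (h x) \<and> k \<le> 200 * (N + 1) + 60 \<and> c \<le> 300"
  shows "computes [Pair (Pair (enc_nat m) (enc_nat W)) (enc_list enc_job jobs)] (deadline_program ! f)
    (Pair (enc_nat (length jobs)) (enc_list Num (mark_root m h jobs))) (400 * (N + 1) ^ 2) 51"
proof -
  let ?F = "\<lambda>xs. Pair (enc_nat (length xs)) (enc_list Num (mark_root m h xs))"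
  let ?u = "Pair (enc_nat m) (enc_nat W)"
  have len: "length jobs \<le> N" using length_le_enc_list jobs(1) by (rule le_trans)
  have sized_F: "sized 51 (?F xs)" if "suffix xs jobs" for xs
  proof -
    have *: "length xs \<le> N" "set xs \<subseteq> set jobs"
      using suffix_length_le[OF that] len set_mono_suffix[OF that] by auto
    have "sized (4 + 46 + 1) (?F xs)"
      using * by (intro sized_Pair sized_enc_nat sized_enc_list_Num)
        (auto simp: length_mark_root short_0 dest!: set_mark_root intro: short)
    then show ?thesis by simp
  qed
  have arg: "sized 10 (Pair ?u (enc_list enc_job jobs))"
    using sized_Pair[OF sized_Pair[OF sized_enc_nat[OF jobs(2)] sized_input[OF jobs(3)]] sized_input[OF jobs(1)]]
    by simp
  have "computes [Pair ?u (enc_list enc_job jobs)] (deadline_program ! f) (?F jobs)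
      ((10 + (200 * (N + 1) + 100) + 20) * (length jobs + 1)) 51"
  proof (rule computes_fold[where F = ?F and ca = 10])
    show "f < length deadline_program" using f(1) by (simp add: length_deadline_program)
    show "deadline_program ! f = fold_body f (ECons (ENum 0) (ENum 0)) (vector_step e)"
      using f(2) by (simp add: vector_body_def)
    show "computes [Pair ?u (Num 0)] (ECons (ENum 0) (ENum 0)) (?F []) 10 51"
      by (rule computes_cong) (rule computes_rules | (simp add: enc_nat_def sized_F[of "[]", simplified enc_nat_def, simplified]; fail))+
  next
    fix x xs assume suf: "suffix (x # xs) jobs" and *: "sized 51 (?F xs)"
      "sized 10 (Pair ?u (Pair (enc_job x) (enc_list enc_job xs)))"
    have "x \<in> set jobs" using set_mono_suffix[OF suf] by auto
    from e[OF * this] obtain k c where **: "computes [?F xs, Pair ?u (Pair (enc_job x) (enc_list enc_job xs))] e (Num (h x)) k c"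
      "k \<le> 200 * (N + 1) + 60" "c \<le> 300" by blast
    have e': "computes [?F xs, Pair ?u (Pair (enc_job x) (enc_list enc_job xs))] e (Num (h x)) (200 * (N + 1) + 60) 300"
      by (rule computes_weaken[OF **(1)]) (use **(2,3) in auto)
    show "computes [?F xs, Pair ?u (Pair (enc_job x) (enc_list enc_job xs))] (vector_step e) (?F (x # xs)) (200 * (N + 1) + 100) 51"
      unfolding vector_step_def param_def
    proof (rule computes_cong)
      show "sized 51 (?F (x # xs))" by (rule sized_F[OF suf])
    qed (rule computes_rules computes_Var_Suc computes_Var_0 * e' |
         (simp add: enc_nat_def; fail))+
  qed (rule arg, simp)
  then show ?thesis
  proof (rule computes_cong[OF _ refl _ sized_F[OF suffix_order.refl]])
    have "(10 + (200 * (N + 1) + 100) + 20) * (length jobs + 1) \<le> (400 * (N + 1)) * (N + 1)"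
      using len by (intro mult_le_mono) auto
    then show "(10 + (200 * (N + 1) + 100) + 20) * (length jobs + 1) \<le> 400 * (N + 1) ^ 2"
      by (simp add: power2_eq_square algebra_simps)
  qed
qed

context
  fixes x :: "(outcome \<times> rat) list" and W :: nat
  assumes job: "val_size (enc_job x) \<le> N" and W: "val_size (enc_nat W) \<le> N"
begin

lemma short_budget: "short N (of_nat W)"
  using W by (auto simp: enc_nat_def intro: short_of_val_size)

lemma short_budgets:
  "short (4 * N) (of_nat W)" "short (4 * N) (of_nat W / 2)" "short (4 * N) (of_nat W + 1)"
proof -
  show "short (4 * N) (of_nat W)" by (rule short_mono[OF short_budget]) simp
  have "short (2 + N) (1 / 2 * of_nat W)" by (rule short_mult[OF short_half short_budget])
  then show "short (4 * N) (of_nat W / 2)" using short_mono[of _ _ "4 * N"] N_pos by fastforce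
  have "short (N + 1) (of_nat W + 1)" by (rule short_add[OF short_budget short_1])
  then show "short (4 * N) (of_nat W + 1)" by (rule short_mono) (use N_pos in auto)
qed

lemma length_job: "length x \<le> N"
  using length_le_enc_list job by (rule le_trans)

lemma short_stats:
  "short (8 * N ^ 2) (job_reward t x)" "short (8 * N ^ 2) (job_tail t x)"
  "short (8 * N ^ 2) (job_mean (of_nat W + 1) x)" "short (8 * N ^ 2) (job_max t x)"
  using short_job_reward[OF job] short_job_tail[OF job] short_job_mean[OF job] short_job_max_square[OF job]
    length_job short_budgets by auto

lemma short_vector_entries:
  "short (20 * N ^ 2) (job_reward (of_nat W / 2) x)"
  "short (20 * N ^ 2) (job_mean (of_nat W + 1) x)"
  "short (20 * N ^ 2) ((of_nat W + 1) / 4 + job_mean (of_nat W + 1) x)"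
  "short (20 * N ^ 2) (job_reward (of_nat W) x - job_reward (of_nat W / 2) x)"
  "short (20 * N ^ 2) (job_max (of_nat W / 2) x)"
  "short (20 * N ^ 2) (of_nat W - job_max (of_nat W) x + job_max (of_nat W / 2) x)"
  "short (20 * N ^ 2) (if 1 / 2 < job_tail (of_nat W / 2) x then 1 / 2 else job_tail (of_nat W / 2) x)"
proof -
  have N: "N \<le> N ^ 2" "1 \<le> N ^ 2" using N_pos by (simp_all add: power2_eq_square)
  show "short (20 * N ^ 2) (job_reward (of_nat W / 2) x)" "short (20 * N ^ 2) (job_mean (of_nat W + 1) x)"
    "short (20 * N ^ 2) (job_max (of_nat W / 2) x)"
    by (rule short_mono[OF short_stats(1)] short_mono[OF short_stats(3)] short_mono[OF short_stats(4)], simp)+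
  have "short (3 + 4 * N + 8 * N ^ 2) (1 / 4 * (of_nat W + 1) + job_mean (of_nat W + 1) x)"
    by (intro short_add short_mult short_quarter short_budgets short_stats)
  then show "short (20 * N ^ 2) ((of_nat W + 1) / 4 + job_mean (of_nat W + 1) x)"
    using short_mono[of _ _ "20 * N ^ 2"] N by fastforce
  show "short (20 * N ^ 2) (job_reward (of_nat W) x - job_reward (of_nat W / 2) x)"
    by (rule short_mono[OF short_diff[OF short_stats(1) short_stats(1)]]) simp
  show "short (20 * N ^ 2) (of_nat W - job_max (of_nat W) x + job_max (of_nat W / 2) x)"
    by (rule short_mono[OF short_add[OF short_diff[OF short_budgets(1) short_stats(4)] short_stats(4)]])
      (use N in auto)
  show "short (20 * N ^ 2) (if 1 / 2 < job_tail (of_nat W / 2) x then 1 / 2 else job_tail (of_nat W / 2) x)"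
    using short_mono[OF short_stats(2), of "20 * N ^ 2"] short_mono[OF short_half, of "20 * N ^ 2"] N by simp
qed

context
  fixes y :: val and xs a :: val
  assumes arg: "sized 10 (Pair (Pair a (enc_nat W)) (Pair (enc_job x) xs))"
begin

abbreviation "env \<equiv> [y, Pair (Pair a (enc_nat W)) (Pair (enc_job x) xs)]"

lemmas entry_rules = computes_rules computes_Var_Suc computes_Var_0 arg

lemma computes_small_reward:
  "computes env small_reward_expr (Num (job_reward (of_nat W / 2) x)) (100 * (N + 1) + 20) 18"
  unfolding small_reward_expr_def param_def item_def
  by (rule computes_weaken, (rule entry_rules computes_Call[OF computes_job_reward[OF job short_budgets(2)]] |
      (simp add: length_deadline_program enc_nat_def; fail))+)

lemma computes_mean:
  "computes env mean_expr (Num (job_mean (of_nat W + 1) x)) (100 * (N + 1) + 20) 18"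
  unfolding mean_expr_def param_def item_def
  by (rule computes_weaken, (rule entry_rules computes_Call[OF computes_job_mean[OF job short_budgets(3)]] |
      (simp add: length_deadline_program enc_nat_def; fail))+)

lemma computes_small_size:
  "computes env small_size_expr (Num (job_max (of_nat W / 2) x)) (100 * (N + 1) + 20) 18"
  unfolding small_size_expr_def param_def item_def
  by (rule computes_weaken, (rule entry_rules computes_Call[OF computes_job_max[OF job short_budgets(2)]] |
      (simp add: length_deadline_program enc_nat_def; fail))+)

lemma computes_small_deadline:
  "computes env small_deadline_expr (Num ((of_nat W + 1) / 4 + job_mean (of_nat W + 1) x)) (200 * (N + 1) + 60) 300"
  unfolding small_deadline_expr_def param_def item_def
  by (rule computes_weaken, (rule entry_rules computes_mean |
      (simp add: length_deadline_program enc_nat_def; fail))+)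

lemma computes_large_reward:
  "computes env large_reward_expr (Num (job_reward (of_nat W) x - job_reward (of_nat W / 2) x)) (200 * (N + 1) + 60) 300"
  unfolding large_reward_expr_def param_def item_def
  by (rule computes_weaken, (rule entry_rules computes_small_reward computes_Call[OF computes_job_reward[OF job short_budgets(1)]] |
      (simp add: length_deadline_program enc_nat_def; fail))+)

lemma computes_large_deadline:
  "computes env large_deadline_expr (Num (of_nat W - job_max (of_nat W) x + job_max (of_nat W / 2) x)) (200 * (N + 1) + 60) 300"
  unfolding large_deadline_expr_def param_def item_def
  by (rule computes_weaken, (rule entry_rules computes_small_size computes_Call[OF computes_job_max[OF job short_budgets(1)]] |
      (simp add: length_deadline_program enc_nat_def; fail))+)

lemma computes_capped:
  "computes env capped_expr (Num (if 1 / 2 < job_tail (of_nat W / 2) x then 1 / 2 else job_tail (of_nat W / 2) x)) (200 * (N + 1) + 60) 300"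
proof -
  have tail: "sized 18 (Num (job_tail (of_nat W / 2) x))"
    by (rule computes_sized[OF computes_job_tail[OF job short_budgets(2)]])
  show ?thesis
    unfolding capped_expr_def param_def item_def
    by (rule computes_weaken, (rule entry_rules tail computes_Call[OF computes_job_tail[OF job short_budgets(2)]] |
      (simp add: length_deadline_program enc_nat_def; fail))+)
qed

end
end

lemma computes_vectors:
  assumes "val_size (enc_list enc_job jobs) \<le> N" "m \<le> N" "val_size (enc_nat W) \<le> N"
  defines "arg \<equiv> Pair (Pair (enc_nat m) (enc_nat W)) (enc_list enc_job jobs)"
    and "result \<equiv> \<lambda>h. Pair (enc_nat (length jobs)) (enc_list Num (mark_root m h jobs))"
  shows "computes [arg] (deadline_program ! 5) (result (job_reward (of_nat W / 2))) (400 * (N + 1) ^ 2) 51"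
    and "computes [arg] (deadline_program ! 6) (result (job_mean (of_nat W + 1))) (400 * (N + 1) ^ 2) 51"
    and "computes [arg] (deadline_program ! 7) (result (\<lambda>xs. (of_nat W + 1) / 4 + job_mean (of_nat W + 1) xs)) (400 * (N + 1) ^ 2) 51"
    and "computes [arg] (deadline_program ! 8) (result (\<lambda>_. 0)) (400 * (N + 1) ^ 2) 51"
    and "computes [arg] (deadline_program ! 9) (result (\<lambda>xs. job_reward (of_nat W) xs - job_reward (of_nat W / 2) xs)) (400 * (N + 1) ^ 2) 51"
    and "computes [arg] (deadline_program ! 10) (result (job_max (of_nat W / 2))) (400 * (N + 1) ^ 2) 51"
    and "computes [arg] (deadline_program ! 11) (result (\<lambda>xs. of_nat W - job_max (of_nat W) xs + job_max (of_nat W / 2) xs)) (400 * (N + 1) ^ 2) 51"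
    and "computes [arg] (deadline_program ! 12) (result (\<lambda>xs. if 1 / 2 < job_tail (of_nat W / 2) xs then 1 / 2 else job_tail (of_nat W / 2) xs)) (400 * (N + 1) ^ 2) 51"
proof -
  have job: "val_size (enc_job x) \<le> N" if "x \<in> set jobs" for x
    using enc_list_element[OF that] assms(1) by (rule le_trans)
  note vector = computes_vector[OF _ _ assms(1-3)]
  note short = short_vector_entries[OF job assms(3)]
  show "computes [arg] (deadline_program ! 5) (result (job_reward (of_nat W / 2))) (400 * (N + 1) ^ 2) 51"
    unfolding arg_def result_def
    by (rule vector[OF _ nth_deadline_program(6) short(1)]) (use computes_small_reward[OF job assms(3)] in force)+
  show "computes [arg] (deadline_program ! 6) (result (job_mean (of_nat W + 1))) (400 * (N + 1) ^ 2) 51"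
    unfolding arg_def result_def
    by (rule vector[OF _ nth_deadline_program(7) short(2)]) (use computes_mean[OF job assms(3)] in force)+
  show "computes [arg] (deadline_program ! 7) (result (\<lambda>xs. (of_nat W + 1) / 4 + job_mean (of_nat W + 1) xs)) (400 * (N + 1) ^ 2) 51"
    unfolding arg_def result_def
    by (rule vector[OF _ nth_deadline_program(8) short(3)]) (use computes_small_deadline[OF job assms(3)] in force)+
  show "computes [arg] (deadline_program ! 8) (result (\<lambda>_. 0)) (400 * (N + 1) ^ 2) 51"
    unfolding arg_def result_def
    by (rule vector[OF _ nth_deadline_program(9) short_0]) (use computes_0 in force)+
  show "computes [arg] (deadline_program ! 9) (result (\<lambda>xs. job_reward (of_nat W) xs - job_reward (of_nat W / 2) xs)) (400 * (N + 1) ^ 2) 51"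
    unfolding arg_def result_def
    by (rule vector[OF _ nth_deadline_program(10) short(4)]) (use computes_large_reward[OF job assms(3)] in force)+
  show "computes [arg] (deadline_program ! 10) (result (job_max (of_nat W / 2))) (400 * (N + 1) ^ 2) 51"
    unfolding arg_def result_def
    by (rule vector[OF _ nth_deadline_program(11) short(5)]) (use computes_small_size[OF job assms(3)] in force)+
  show "computes [arg] (deadline_program ! 11) (result (\<lambda>xs. of_nat W - job_max (of_nat W) xs + job_max (of_nat W / 2) xs)) (400 * (N + 1) ^ 2) 51"
    unfolding arg_def result_def
    by (rule vector[OF _ nth_deadline_program(12) short(6)]) (use computes_large_deadline[OF job assms(3)] in force)+
  show "computes [arg] (deadline_program ! 12) (result (\<lambda>xs. if 1 / 2 < job_tail (of_nat W / 2) xs then 1 / 2 else job_tail (of_nat W / 2) xs)) (400 * (N + 1) ^ 2) 51"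
    unfolding arg_def result_def
    by (rule vector[OF _ nth_deadline_program(13) short(7)]) (use computes_capped[OF job assms(3)] in force)+
qed

end

text \<open>A recursion on the list knows how many entries follow but not the index of the current
  one. Exactly \<open>ck_n I - 1 - ck_root I\<close> entries follow that of the root.\<close>

lemma mark_root_jobs:
  assumes "ck_root I < ck_n I"
  shows "enc_list Num (mark_root (ck_n I - 1 - ck_root I) f (map (ck_job I) [0..<ck_n I])) =
    enc_vector Num (ck_n I) (at_vertices I f)"
  unfolding enc_vector_def
  using assms by (intro arg_cong[where f = "enc_list Num"] nth_equalityI)
    (auto simp: length_mark_root nth_mark_root at_vertices_def)

lemma enc_matrix_of_nat: "enc_matrix Num n (\<lambda>u v. of_nat (d u v)) = enc_matrix enc_nat n d"
  by (simp add: enc_matrix_def enc_vector_def enc_list_map o_def enc_nat_def[abs_def])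

section \<open>Evaluating a path and reading the history\<close>

context program_machine
begin

lemma computes_lookup:
  assumes ys: "sized 46 (enc_list Num ys)" "length ys \<le> N" and m: "m \<le> N"
  shows "computes [Pair (enc_nat m) (enc_list Num ys)] (deadline_program ! 13)
    (Pair (enc_nat (length ys)) (Num (if m < length ys then ys ! (length ys - 1 - m) else 0))) (100 * (N + 1)) 51"
proof -
  let ?F = "\<lambda>ys. Pair (enc_nat (length ys)) (Num (if m < length ys then ys ! (length ys - 1 - m) else 0))"
  have sized_F: "sized 51 (?F zs)" if "suffix zs ys" for zs
  proof -
    have len: "length zs \<le> N" using suffix_length_le[OF that] ys(2) by simp
    have entry: "sized 46 (Num y)" if "y \<in> set ys" for y
      using enc_list_element[OF that, of Num] ys(1) by (simp add: sized_def)
    have "sized 46 (Num (if m < length zs then zs ! (length zs - 1 - m) else 0))"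
    proof (cases "m < length zs")
      case True
      then have "zs ! (length zs - 1 - m) \<in> set zs" by (intro nth_mem) simp
      with set_mono_suffix[OF that] have "sized 46 (Num (zs ! (length zs - 1 - m)))"
        by (intro entry) blast
      with True show ?thesis by simp
    qed (simp add: sized_0)
    from sized_Pair[OF sized_enc_nat[OF len] this] show ?thesis by simp
  qed
  have "computes [Pair (enc_nat m) (enc_list Num ys)] (deadline_program ! 13) (?F ys) ((10 + 50 + 20) * (length ys + 1)) 51"
  proof (rule computes_fold[where F = ?F and ca = 51])
    show "deadline_program ! 13 = fold_body 13 (ECons (ENum 0) (ENum 0)) lookup_step"
      by (rule nth_deadline_program)
    show "sized 51 (Pair (enc_nat m) (enc_list Num ys))"
      using sized_Pair[OF sized_enc_nat[OF m] ys(1)] by simp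
    show "computes [Pair (enc_nat m) (Num 0)] (ECons (ENum 0) (ENum 0)) (?F []) 10 51"
      by (rule computes_weaken) (rule computes_rules | (simp add: enc_nat_def; fail))+
  next
    fix x xs assume suf: "suffix (x # xs) ys" and *: "sized 51 (?F xs)"
      "sized 51 (Pair (enc_nat m) (Pair (Num x) (enc_list Num xs)))"
    show "computes [?F xs, Pair (enc_nat m) (Pair (Num x) (enc_list Num xs))] lookup_step (?F (x # xs)) 50 51"
      unfolding lookup_step_def param_def item_def
    proof (rule computes_cong)
      show "sized 51 (?F (x # xs))" by (rule sized_F[OF suf])
    qed (rule computes_rules computes_Var_Suc computes_Var_0 * |
         (simp add: enc_nat_def; fail) | (simp add: enc_nat_def nth_Cons' Suc_diff_Suc less_Suc_eq; fail))+
  qed (simp_all add: length_deadline_program)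
  then show ?thesis
    by (rule computes_weaken) (use ys(2) in auto)
qed

text \<open>Oracle answers are charged by their size. A feasible path repeats no vertex, which
  bounds its length and thus its encoding.\<close>

lemma sized_path:
  assumes "distinct P" "set P \<subseteq> {..<n}" "n \<le> N"
  shows "sized 7 (enc_list enc_nat P)"
proof -
  have "card (set P) \<le> card {..<n}" by (rule card_mono) (use assms in auto)
  then have len: "length P \<le> N" using assms(1,3) by (simp add: distinct_card)
  have "val_size (enc_list enc_nat P) \<le> length P * (2 * N + 2 + 1) + 2"
  proof (rule val_size_enc_list_le)
    fix v assume "v \<in> set P"
    then have "v \<le> N" using assms(2,3) by auto
    from val_size_of_short[OF short_of_nat[OF this]] show "val_size (enc_nat v) \<le> 2 * N + 2"
      by (simp add: enc_nat_def)
  qed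
  also have "\<dots> \<le> N * (2 * N + 2 + 1) + 2"
    by (intro add_le_mono1 mult_le_mono1 len)
  also have "\<dots> = 2 * N ^ 2 + 3 * N + 2"
    by (simp add: power2_eq_square)
  also have "\<dots> \<le> 7 * N ^ 3"
    using le_cube cube_pos by linarith
  finally show ?thesis by (simp add: sized_def)
qed

lemma computes_objective:
  assumes P: "distinct P" "set P \<subseteq> {..<n}" and n: "1 \<le> n" "n \<le> N"
    and r: "\<And>v. v < n \<Longrightarrow> short (20 * N ^ 2) (r v)"
  shows "computes [Pair (Pair (enc_nat (n - 1)) (enc_vector Num n r)) (enc_list enc_nat P)]
    (deadline_program ! 14) (Num (\<Sum>v\<leftarrow>P. r v)) (300 * (N + 1) ^ 2) 42"
proof -
  let ?u = "Pair (enc_nat (n - 1)) (enc_vector Num n r)"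
  have vec: "sized 46 (enc_vector Num n r)"
    unfolding enc_vector_def using r n(2) by (intro sized_enc_list_Num) auto
  have sP: "sized 7 (enc_list enc_nat P)" using P n(2) by (rule sized_path)
  have "card (set P) \<le> card {..<n}" by (rule card_mono) (use P in auto)
  then have len: "length P \<le> N" using P(1) n(2) by (simp add: distinct_card)
  have sized_F: "sized 42 (Num (\<Sum>v\<leftarrow>vs. r v))" if "suffix vs P" for vs
  proof -
    have vs: "length vs \<le> N" "set vs \<subseteq> {..<n}"
      using suffix_length_le[OF that] len set_mono_suffix[OF that] P(2) by auto
    have "short (20 * N ^ 2 * length vs) (\<Sum>v\<leftarrow>vs. r v)"
      using vs(2) by (intro short_sum_list r) auto
    moreover have "20 * N ^ 2 * length vs \<le> 20 * N ^ 3"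
      using vs(1) by (simp add: power3_eq_cube power2_eq_square)
    ultimately show ?thesis by (rule sized_short_le) auto
  qed
  have "computes [Pair ?u (enc_list enc_nat P)] (deadline_program ! 14) (Num (\<Sum>v\<leftarrow>P. r v))
      ((1 + (100 * (N + 1) + 50) + 20) * (length P + 1)) 42"
  proof (rule computes_fold[where F = "\<lambda>vs. Num (\<Sum>v\<leftarrow>vs. r v)" and ca = 59])
    show "deadline_program ! 14 = fold_body 14 (ENum 0) objective_step"
      by (rule nth_deadline_program)
    show "sized 59 (Pair ?u (enc_list enc_nat P))"
      using sized_Pair[OF sized_Pair[OF sized_enc_nat[of "n - 1"] vec] sP] n by (auto intro: sized_mono)
    show "computes [Pair ?u (Num 0)] (ENum 0) (Num (\<Sum>v\<leftarrow>[]. r v)) 1 42"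
      using computes_Num[OF sized_0] by simp
  next
    fix x xs assume suf: "suffix (x # xs) P" and *: "sized 42 (Num (\<Sum>v\<leftarrow>xs. r v))"
      "sized 59 (Pair ?u (Pair (enc_nat x) (enc_list enc_nat xs)))"
    have x: "x < n" using set_mono_suffix[OF suf] P(2) by auto
    have lookup: "computes [Pair (enc_nat (n - 1 - x)) (enc_vector Num n r)] (deadline_program ! 13)
        (Pair (enc_nat n) (Num (r x))) (100 * (N + 1)) 51"
      using computes_lookup[of "map r [0..<n]" "n - 1 - x"] vec x n by (simp add: enc_vector_def)
    show "computes [Num (\<Sum>v\<leftarrow>xs. r v), Pair ?u (Pair (enc_nat x) (enc_list enc_nat xs))] objective_step
        (Num (\<Sum>v\<leftarrow>x # xs. r v)) (100 * (N + 1) + 50) 42"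
      unfolding objective_step_def param_def item_def
    proof (rule computes_cong)
      show "sized 42 (Num (\<Sum>v\<leftarrow>x # xs. r v))" by (rule sized_F[OF suf])
    qed (rule computes_rules computes_Var_Suc computes_Var_0 * computes_Call[OF lookup] |
         (use x n in \<open>simp add: enc_nat_def length_deadline_program of_nat_diff\<close>; fail))+
  qed (simp_all add: length_deadline_program)
  then show ?thesis
  proof (rule computes_weaken)
    have "(1 + (100 * (N + 1) + 50) + 20) * (length P + 1) \<le> (300 * (N + 1)) * (N + 1)"
      using len by (intro mult_le_mono) auto
    then show "(1 + (100 * (N + 1) + 50) + 20) * (length P + 1) \<le> 300 * (N + 1) ^ 2"
      by (simp add: power2_eq_square algebra_simps)
  qed auto
qed

abbreviation "enc_history \<equiv> enc_list (enc_pair enc_nat enc_outcome)"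

lemma enc_history_item:
  "enc_pair enc_nat enc_outcome z = Pair (enc_nat (fst z)) (Pair (Num (of_nat (fst (snd z)))) (Num (snd (snd z))))"
  by (simp add: enc_pair_def enc_outcome_def enc_nat_def)

lemma computes_history_size:
  assumes "val_size (enc_history h) \<le> N"
  shows "computes [Pair (Num 0) (enc_history h)] (deadline_program ! 15)
    (Num (\<Sum>z\<leftarrow>h. of_nat (fst (snd z)))) (100 * (N + 1)) 18"
proof -
  have len: "length h \<le> N" using length_le_enc_list assms by (rule le_trans)
  have sized_F: "sized 18 (Num (\<Sum>z\<leftarrow>h'. of_nat (fst (snd z))))" if "suffix h' h" for h'
  proof (rule sized_sum)
    fix z assume "z \<in> set h'"
    then have "z \<in> set h" using set_mono_suffix[OF that] by auto
    from enc_list_element[OF this, of "enc_pair enc_nat enc_outcome"] assms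
    have "val_size (Num (of_nat (fst (snd z)))) \<le> 8 * N" by (simp add: enc_history_item)
    then show "short (8 * N) (of_nat (fst (snd z)))" by (rule short_of_val_size)
  qed (use suffix_length_le[OF that] len in simp)
  have "computes [Pair (Num 0) (enc_history h)] (deadline_program ! 15)
    (Num (\<Sum>z\<leftarrow>h. of_nat (fst (snd z)))) ((1 + 20 + 20) * (length h + 1)) 18"
  proof (rule computes_fold[where F = "\<lambda>h. Num (\<Sum>z\<leftarrow>h. of_nat (fst (snd z)))" and ca = 5])
    show "deadline_program ! 15 = fold_body 15 (ENum 0) size_step"
      by (rule nth_deadline_program)
    show "sized 5 (Pair (Num 0) (enc_history h))"
      using sized_Pair[OF sized_0[of 2] sized_input[OF assms]] by simp
    show "computes [Pair (Num 0) (Num 0)] (ENum 0) (Num (\<Sum>z\<leftarrow>[]. of_nat (fst (snd z)))) 1 18"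
      using computes_Num[OF sized_0] by simp
  next
    fix z h' assume suf: "suffix (z # h') h" and "sized 18 (Num (\<Sum>z\<leftarrow>h'. of_nat (fst (snd z))))"
      "sized 5 (Pair (Num 0) (Pair (enc_pair enc_nat enc_outcome z) (enc_history h')))"
    note * = this(2,3)[unfolded enc_history_item]
    show "computes [Num (\<Sum>z\<leftarrow>h'. of_nat (fst (snd z))), Pair (Num 0) (Pair (enc_pair enc_nat enc_outcome z) (enc_history h'))]
        size_step (Num (\<Sum>z\<leftarrow>z # h'. of_nat (fst (snd z)))) 20 18"
      unfolding size_step_def item_def enc_history_item
    proof (rule computes_cong)
      show "sized 18 (Num (\<Sum>z\<leftarrow>z # h'. of_nat (fst (snd z))))" by (rule sized_F[OF suf])
    qed (rule computes_rules computes_Var_Suc computes_Var_0 * | (simp; fail))+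
  qed (simp_all add: length_deadline_program)
  then show ?thesis
    by (rule computes_weaken) (use len in auto)
qed

lemma computes_drop:
  assumes "val_size (enc_history h) \<le> N" "sized 7 (enc_list enc_nat vs)"
  shows "computes [Pair (enc_list enc_nat vs) (enc_history h)] (deadline_program ! 16)
    (enc_list enc_nat (drop (length h) vs)) (100 * (N + 1)) 7"
proof -
  have len: "length h \<le> N" using length_le_enc_list assms(1) by (rule le_trans)
  have arg: "sized 10 (Pair (enc_list enc_nat vs) (enc_history h))"
    using sized_Pair[OF assms(2) sized_input[OF assms(1)]] by simp
  \<comment> \<open>The empty list is encoded as \<open>Num 0\<close>, on which
    \<open>val_snd\<close> returns \<open>Num 0\<close> again, so dropping beyond the end is
    harmless.\<close>
  have snd_drop: "val_snd (enc_list enc_nat (drop k vs)) = enc_list enc_nat (drop (Suc k) vs)" for k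
    by (cases "drop k vs") (auto simp: drop_Suc drop_tl)
  have "computes [Pair (enc_list enc_nat vs) (enc_history h)] (deadline_program ! 16)
    (enc_list enc_nat (drop (length h) vs)) ((5 + 5 + 20) * (length h + 1)) 7"
  proof (rule computes_fold[where F = "\<lambda>h :: history. enc_list enc_nat (drop (length h) vs)" and ca = 10])
    show "deadline_program ! 16 = fold_body 16 (EFst V0) (ESnd V0)"
      by (rule nth_deadline_program)
    have "sized 10 (Pair (enc_list enc_nat vs) (Num 0))"
      using sized_Pair[OF assms(2) sized_0[of 2]] by simp
    then have "computes [Pair (enc_list enc_nat vs) (Num 0)] (EFst V0) (enc_list enc_nat vs) (1 + 1) 10"
      by (rule computes_Fst_Pair[OF computes_Var_0])
    then show "computes [Pair (enc_list enc_nat vs) (Num 0)] (EFst V0) (enc_list enc_nat (drop (length []) vs)) 5 7"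
      by (rule computes_cong) (use assms(2) in auto)
  next
    fix z and h' :: history assume "sized 7 (enc_list enc_nat (drop (length h') vs))"
    then have "computes [enc_list enc_nat (drop (length h') vs), Pair (enc_list enc_nat vs) (Pair (enc_pair enc_nat enc_outcome z) (enc_history h'))]
        (ESnd V0) (val_snd (enc_list enc_nat (drop (length h') vs))) (1 + 1) 7"
      by (intro computes_Snd computes_Var_0)
    then show "computes [enc_list enc_nat (drop (length h') vs), Pair (enc_list enc_nat vs) (Pair (enc_pair enc_nat enc_outcome z) (enc_history h'))]
        (ESnd V0) (enc_list enc_nat (drop (length (z # h')) vs)) 5 7"
      by (rule computes_weaken) (simp_all add: snd_drop)
  qed (use arg in \<open>simp_all add: length_deadline_program\<close>)
  then show ?thesis
    by (rule computes_weaken) (use len in auto)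
qed

end

section \<open>Solving the two instances and taking one decision\<close>

lemma enc_corrko_eq:
  "enc_corrko I = Pair (enc_nat (ck_n I)) (Pair (enc_matrix enc_nat (ck_n I) (ck_dist I))
    (Pair (enc_nat (ck_root I)) (Pair (enc_nat (ck_B I)) (Pair (enc_nat (ck_W I))
    (Pair (enc_list enc_job (map (ck_job I) [0..<ck_n I])) (Num 0))))))"
  by (simp add: enc_corrko_def enc_vector_def)

lemma enc_deadline_instance:
  "enc_knap_orientkd (deadline_instance I r w k b) =
    Pair (enc_nat (ck_n I)) (Pair (enc_matrix enc_nat (ck_n I) (ck_dist I))
    (Pair (enc_nat (ck_root I)) (Pair (enc_nat (ck_B I))
    (Pair (enc_vector Num (ck_n I) (at_vertices I r)) (Pair (enc_vector Num (ck_n I) (at_vertices I w))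
    (Pair (enc_vector Num (ck_n I) (at_vertices I (\<lambda>xs. k xs + w xs)))
    (Pair (enc_vector Num (ck_n I) (at_vertices I b)) (Pair (Num (1 / 2)) (Num 0)))))))))"
  by (simp add: enc_knap_orientkd_def deadline_instance_def enc_matrix_of_nat enc_nat_def)

text \<open>The decision of \<open>walk\<close> as a function of the history alone: the length of
  the history is the position on the path, and its sizes add up to the processed size.\<close>

definition next_visit :: "nat \<Rightarrow> nat list \<Rightarrow> history \<Rightarrow> nat option" where
  "next_visit W vs h = (if W < (\<Sum>z\<leftarrow>h. fst (snd z)) then None
     else case drop (length h) vs of [] \<Rightarrow> None | v # _ \<Rightarrow> Some v)"

context program_machine
begin

text \<open>Each of the four vectors takes at most \<open>400 * (N + 1) ^ 2\<close> steps and the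
  objective \<open>300 * (N + 1) ^ 2\<close>. The rest of the 2200 absorbs the additive
  constants.\<close>

lemma computes_solve:
  fixes I
  defines "m \<equiv> ck_n I - 1 - ck_root I" and "jobs \<equiv> map (ck_job I) [0..<ck_n I]"
  assumes I: "val_size (enc_corrko I) \<le> N" "ck_root I < ck_n I"
    and p: "deadline_program ! f = solve_body fr fw fk fb" "fr < 19" "fw < 19" "fk < 19" "fb < 19"
    and vectors: "\<And>g h. (g, h) \<in> {(fr, r), (fw, w), (fk, \<lambda>xs. k xs + w xs), (fb, b)} \<Longrightarrow>
      computes [Pair (Pair (enc_nat m) (enc_nat (ck_W I))) (enc_list enc_job jobs)] (deadline_program ! g)
        (Pair (enc_nat (length jobs)) (enc_list Num (mark_root m h jobs))) (400 * (N + 1) ^ 2) 51"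
    and r: "\<And>v. v < ck_n I \<Longrightarrow> short (20 * N ^ 2) (r (ck_job I v))"
    and P: "orc (enc_knap_orientkd (deadline_instance I r w k b)) = enc_list enc_nat P"
      "distinct P" "set P \<subseteq> {..<ck_n I}"
  shows "computes [enc_corrko I] (deadline_program ! f)
    (Pair (enc_list enc_nat P) (Num (orientkd_value (deadline_instance I r w k b) P))) (2200 * (N + 1) ^ 2) 50"
proof -
  let ?n = "ck_n I" and ?J = "deadline_instance I r w k b"
  let ?ctx = "Pair (enc_nat m) (enc_nat (ck_W I))"
  note inst = sized_input[OF I(1)]
  note inst' = inst[unfolded enc_corrko_eq]
  have n: "?n \<le> N" "1 \<le> ?n"
  proof -
    have "?n \<le> val_size (enc_list enc_job jobs)"
      using length_le_enc_list[of jobs enc_job] by (simp add: jobs_def)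
    then show "?n \<le> N" using I(1) by (simp add: enc_corrko_eq jobs_def)
  qed (use I(2) in simp)
  have vector: "computes [Pair ?ctx (enc_list enc_job jobs)] (deadline_program ! g)
      (Pair (enc_nat ?n) (enc_vector Num ?n (at_vertices I h))) (400 * (N + 1) ^ 2) 51"
    if "(g, h) \<in> {(fr, r), (fw, w), (fk, \<lambda>xs. k xs + w xs), (fb, b)}" for g h
    using vectors[OF that] mark_root_jobs[OF I(2), of h] by (simp add: m_def jobs_def)
  have N2: "1 \<le> (N + 1) ^ 2" by simp
  have ctx: "computes [enc_corrko I] (ECons (EArith Sub (EArith Sub (EFst V0) (ENum 1)) (EFst (ESnd (ESnd V0))))
      (EFst (ESnd (ESnd (ESnd (ESnd V0)))))) ?ctx 30 37"
    unfolding enc_corrko_eq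
    by (rule computes_weaken, (rule computes_rules computes_Var_0 inst' |
      (use I(2) in \<open>simp add: enc_nat_def m_def of_nat_diff\<close>; fail))+)
  note sized_ctx = computes_sized[OF ctx]
  have rv: "computes [?ctx, enc_corrko I] (ESnd (ECall fr (ECons V0 (EFst (ESnd (ESnd (ESnd (ESnd (ESnd V1)))))))))
      (enc_vector Num ?n (at_vertices I r)) (400 * (N + 1) ^ 2 + 20) 51"
    unfolding enc_corrko_eq
    by (rule computes_weaken, (rule computes_rules computes_Var_Suc computes_Var_0 inst' sized_ctx
       computes_Call[OF vector[of fr r]] |
      (simp add: length_deadline_program p jobs_def; fail))+)
  note sized_rv = computes_sized[OF rv]
  have P': "computes [enc_vector Num ?n (at_vertices I r), ?ctx, enc_corrko I]
     (EOracle (ECons (EFst V2) (ECons (EFst (ESnd V2)) (ECons (EFst (ESnd (ESnd V2))) (ECons (EFst (ESnd (ESnd (ESnd V2)))) (ECons V0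
         (ECons (ESnd (ECall fw (ECons V1 (EFst (ESnd (ESnd (ESnd (ESnd (ESnd V2)))))))))
         (ECons (ESnd (ECall fk (ECons V1 (EFst (ESnd (ESnd (ESnd (ESnd (ESnd V2)))))))))
         (ECons (ESnd (ECall fb (ECons V1 (EFst (ESnd (ESnd (ESnd (ESnd (ESnd V2))))))))) (ECons (ENum (1 / 2)) (ENum 0)))))))))))
     (enc_list enc_nat P) (1200 * (N + 1) ^ 2 + 150) 7"
    unfolding enc_corrko_eq
    by (rule computes_weaken, (rule P(1) computes_rules computes_Var_Suc computes_Var_0 inst' sized_ctx sized_rv
       computes_Oracle[OF _ _ P(1) sized_path[OF P(2,3) n(1)]]
       computes_Call[OF vector[of fw w]] computes_Call[OF vector[of fk "\<lambda>xs. k xs + w xs"]] computes_Call[OF vector[of fb b]] |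
      (simp add: length_deadline_program p jobs_def enc_deadline_instance; fail))+)
  note sized_P = computes_sized[OF P']
  have "computes [Pair (Pair (enc_nat (?n - 1)) (enc_vector Num ?n (at_vertices I r))) (enc_list enc_nat P)]
    (deadline_program ! 14) (Num (\<Sum>v\<leftarrow>P. at_vertices I r v)) (300 * (N + 1) ^ 2) 42"
    by (rule computes_objective[OF P(2,3) n(2,1)]) (auto simp: at_vertices_def r short_0)
  note objective = this[unfolded enc_corrko_eq]
  have obj: "computes [enc_list enc_nat P, enc_vector Num ?n (at_vertices I r), ?ctx, enc_corrko I]
    (ECons V0 (ECall 14 (ECons (ECons (EArith Sub (EFst V3) (ENum 1)) V1) V0)))
    (Pair (enc_list enc_nat P) (Num (orientkd_value ?J P))) (300 * (N + 1) ^ 2 + 50) 50"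
    unfolding enc_corrko_eq
    by (rule computes_weaken, (rule computes_rules computes_Var_Suc computes_Var_0 inst' sized_ctx sized_rv sized_P
       computes_Call[OF objective] |
      (use I(2) in \<open>simp add: length_deadline_program enc_nat_def of_nat_diff orientkd_value_def deadline_instance_def\<close>; fail))+)
  show ?thesis
    unfolding p(1) solve_body_def Let_def
    by (rule computes_weaken, rule computes_Let[OF ctx], rule computes_Let[OF rv], rule computes_Let[OF P'], rule obj)
      (rule refl, use N2 in linarith, simp_all)
qed

lemma computes_main:
  fixes I
  defines "n \<equiv> ck_n I" and "\<rho> \<equiv> ck_root I"
  assumes N: "N = val_size (enc_query I h)" and root: "\<rho> < n"
    and P: "orc (enc_knap_orientkd (small_instance I)) = enc_list enc_nat (\<rho> # us)"
      "distinct (\<rho> # us)" "set (\<rho> # us) \<subseteq> {..<n}"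
    and P': "orc (enc_knap_orientkd (large_instance I)) = enc_list enc_nat (\<rho> # us')"
      "distinct (\<rho> # us')" "set (\<rho> # us') \<subseteq> {..<n}"
    and vs: "vs = (if orientkd_value (small_instance I) (\<rho> # us) < orientkd_value (large_instance I) (\<rho> # us')
      then us' else us)"
  shows "computes [enc_query I h] (deadline_program ! 0) (enc_option enc_nat (next_visit (ck_W I) vs h))
    (5000 * (N + 1) ^ 2) 10"
proof -
  let ?jobs = "map (ck_job I) [0..<n]" and ?m = "n - 1 - \<rho>"
  have I: "val_size (enc_corrko I) \<le> N" and h: "val_size (enc_history h) \<le> N"
    by (auto simp: N enc_query_def)
  have jobs: "val_size (enc_list enc_job ?jobs) \<le> N" and W: "val_size (enc_nat (ck_W I)) \<le> N"
    using I by (auto simp: enc_corrko_eq n_def)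
  have "length ?jobs \<le> N" using length_le_enc_list jobs by (rule le_trans)
  then have n: "n \<le> N" by simp
  have job: "val_size (enc_job (ck_job I v)) \<le> N" if "v < n" for v
    using enc_list_element[of "ck_job I v" ?jobs enc_job] jobs that by auto
  note vectors = computes_vectors[OF jobs _ W, of ?m]
  have o: "computes [enc_corrko I] (deadline_program ! 17)
    (Pair (enc_list enc_nat (\<rho> # us)) (Num (orientkd_value (small_instance I) (\<rho> # us)))) (2200 * (N + 1) ^ 2) 50"
    unfolding small_instance_def Let_def
    by (rule computes_solve[OF I _ nth_deadline_program(18)])
      (use root n vectors short_vector_entries[OF job W] P in \<open>auto simp: n_def \<rho>_def small_instance_def Let_def\<close>)
  have o': "computes [enc_corrko I] (deadline_program ! 18)
    (Pair (enc_list enc_nat (\<rho> # us')) (Num (orientkd_value (large_instance I) (\<rho> # us')))) (2200 * (N + 1) ^ 2) 50"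
    unfolding large_instance_def Let_def
    by (rule computes_solve[OF I _ nth_deadline_program(19)])
      (use root n vectors short_vector_entries[OF job W] P' in \<open>auto simp: n_def \<rho>_def large_instance_def Let_def\<close>)
  let ?o = "orientkd_value (small_instance I) (\<rho> # us)" and ?o' = "orientkd_value (large_instance I) (\<rho> # us')"
  let ?a = "Pair (Pair (enc_nat \<rho>) (enc_list enc_nat us)) (Num ?o)"
    and ?b = "Pair (Pair (enc_nat \<rho>) (enc_list enc_nat us')) (Num ?o')"
    and ?q = "Pair (enc_corrko I) (enc_history h)"
  have q: "sized 2 ?q" using sized_input[of "enc_query I h"] by (simp add: N enc_query_def)
  have a: "sized 50 ?a" and b: "sized 50 ?b"
    using computes_sized[OF o] computes_sized[OF o'] by simp_all
  have "distinct vs" "set vs \<subseteq> {..<n}" using P(2,3) P'(2,3) vs by auto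
  then have "sized 7 (enc_list enc_nat vs)" using n by (rule sized_path)
  note drop = computes_drop[OF h this]
  note o1 = o[unfolded enc_list.simps] and o1' = o'[unfolded enc_list.simps]
  let ?rest = "enc_list enc_nat (drop (length h) vs)"
  have rest: "computes [?b, ?a, ?q] (ECall 16 (ECons (EIf (EArith Less (ESnd V1) (ESnd V0)) (ESnd (EFst V0)) (ESnd (EFst V1))) (ESnd V2)))
      ?rest (100 * (N + 1) + 50) 7"
    by (rule computes_weaken, (rule computes_rules computes_Var_Suc computes_Var_0 a b q computes_Call[OF drop] |
      (simp add: length_deadline_program vs; fail))+)
  note sized_rest = computes_sized[OF rest]
  \<comment> \<open>It is not known here whether any vertices remain, so the head is evaluated by
    the total function \<open>val_fst\<close>. Its default on the empty list lies in a branch that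
    is not taken.\<close>
  have fst: "computes (?rest # env) (EFst V0) (val_fst ?rest) (1 + 1) 7" for env
    by (intro computes_Fst computes_Var_0 sized_rest)
  have size: "W < (\<Sum>z\<leftarrow>h. fst (snd z)) \<longleftrightarrow> rat_of_nat W < (\<Sum>z\<leftarrow>h. of_nat (fst (snd z)))" for W
  proof -
    have "rat_of_nat (\<Sum>z\<leftarrow>h. fst (snd z)) = (\<Sum>z\<leftarrow>h. of_nat (fst (snd z)))" by (induction h) auto
    then show ?thesis by (metis of_nat_less_iff)
  qed
  have last: "computes [?rest, ?b, ?a, ?q]
    (EIf (EArith Less (EFst (ESnd (ESnd (ESnd (ESnd (EFst V3)))))) (ECall 15 (ECons (ENum 0) (ESnd V3))))
      (ENum 0) (EIf (EIsNum V0) (ENum 0) (ECons (EFst V0) (ENum 0))))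
    (enc_option enc_nat (next_visit (ck_W I) vs h)) (100 * (N + 1) + 60) 10"
    unfolding enc_corrko_eq
    apply (rule computes_weaken)
        apply (rule fst computes_IsNum computes_rules computes_Var_Suc computes_Var_0 a b q[unfolded enc_corrko_eq] sized_rest computes_Call[OF computes_history_size[OF h]] |
      (simp add: length_deadline_program; fail))+
       apply (auto simp: next_visit_def size enc_nat_def split: list.splits)
    done
  show ?thesis
    unfolding nth_deadline_program(1) main_body_def enc_query_def
    apply (rule computes_weaken)
        apply (rule computes_Let[OF computes_Call[OF o1]] computes_Let[OF computes_Call[OF o1']] computes_Let[OF rest] last
           computes_rules computes_Var_Suc computes_Var_0 a b q | (simp add: length_deadline_program; fail))+
    by (auto simp: power2_eq_square)
qed

end

section \<open>From single decisions to the policy\<close>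

lemma follows_walk:
  assumes "\<And>h. dec h (next_visit W vs h)"
  shows "(\<Sum>z\<leftarrow>h. fst (snd z)) = s \<Longrightarrow> drop (length h) vs = ws \<Longrightarrow> follows I dec (walk W s ws) h"
proof (induction ws arbitrary: h s)
  case Nil
  then have "next_visit W vs h = None" by (simp add: next_visit_def)
  then show ?case using assms[of h] by simp
next
  case (Cons v ws)
  then have "drop (Suc (length h)) vs = ws" by (metis drop_Suc list.sel(3) tl_drop)
  then have "follows I dec (walk W (s + fst x) ws) (h @ [(v, x)])" for x
    using Cons.prems(1) by (intro Cons.IH) auto
  moreover have "next_visit W vs h = (if W < s then None else Some v)"
    using Cons.prems by (simp add: next_visit_def)
  ultimately show ?case using assms[of h] by auto
qed

text \<open>The number of steps from \<open>computes_main\<close> times the largest cost of a step,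
  in terms of the size of the query.\<close>

definition "cost_poly = [:5000:] * [:1, 1:] ^ 2 * ([:1000:] * [:0, 1:] ^ 3 + 1 :: nat poly)"

lemma poly_cost_poly: "poly cost_poly m = 5000 * (m + 1) ^ 2 * (1000 * m ^ 3 + 1)"
  by (simp add: cost_poly_def)

theorem theorem5p4:
  shows "\<exists>(C::real) (p::program) (q::nat poly). C > 0 \<and>
    (\<forall>\<alpha> orc. \<alpha> \<ge> 1 \<and> knap_orientkd_approx \<alpha> orc \<longrightarrow> two_corrko_approx (C * \<alpha>) p q orc)"
proof (intro exI conjI allI impI)
  show "(30 :: real) > 0" by simp
  fix \<alpha> :: real and orc
  assume "\<alpha> \<ge> 1 \<and> knap_orientkd_approx \<alpha> orc"
  then have \<alpha>: "\<alpha> \<ge> 1" and approx: "knap_orientkd_approx \<alpha> orc" by auto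
  show "two_corrko_approx (30 * \<alpha>) deadline_program cost_poly orc"
    unfolding two_corrko_approx_def
  proof (intro allI impI)
    fix I assume "two_corrko I"
    then interpret two_corrko_inst I by unfold_locales
    have "\<exists>Q. knap_orientkd_feasible (small_instance I) Q"
      using small_instance_iff[of "[]"] empty_path by auto
    then obtain P where P: "orc (enc_knap_orientkd (small_instance I)) = enc_list enc_nat P"
      "knap_orientkd_feasible (small_instance I) P"
      "\<And>Q. knap_orientkd_feasible (small_instance I) Q \<Longrightarrow>
        of_rat (orientkd_value (small_instance I) Q) \<le> \<alpha> * of_rat (orientkd_value (small_instance I) P)"
      using approx small_instance_wf unfolding knap_orientkd_approx_def by blast
    have "\<exists>Q. knap_orientkd_feasible (large_instance I) Q"
      using large_instance_iff[of "[]"] empty_path by auto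
    then obtain P' where P': "orc (enc_knap_orientkd (large_instance I)) = enc_list enc_nat P'"
      "knap_orientkd_feasible (large_instance I) P'"
      "\<And>Q. knap_orientkd_feasible (large_instance I) Q \<Longrightarrow>
        of_rat (orientkd_value (large_instance I) Q) \<le> \<alpha> * of_rat (orientkd_value (large_instance I) P')"
      using approx large_instance_wf unfolding knap_orientkd_approx_def by blast
    obtain us us' where us: "P = \<rho> # us" "P' = \<rho> # us'"
      using feasible_deadline_instance_root[OF P(2)[unfolded small_instance_def Let_def]]
        feasible_deadline_instance_root[OF P'(2)[unfolded large_instance_def Let_def]] by auto
    have paths: "us \<in> paths" "us' \<in> paths"
      using P(2) P'(2) us by (auto simp: small_instance_iff large_instance_iff)
    define vs where "vs = tl (if orientkd_value (small_instance I) P < orientkd_value (large_instance I) P' then P' else P)"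
    note walk = walk_approximates[OF \<alpha> P(2,3) P'(2,3) vs_def]
    \<comment> \<open>The claim is needed for every history. The size of the query, history
      included, is the parameter \<open>N\<close>, so the machine is interpreted anew for each
      \<open>h\<close>.\<close>
    have "decides deadline_program orc cost_poly I h (next_visit W vs h)" for h
    proof -
      interpret program_machine orc "val_size (enc_query I h)"
        by unfold_locales (use val_size_pos[of "enc_query I h"] in simp)
      have "computes [enc_query I h] (deadline_program ! 0) (enc_option enc_nat (next_visit W vs h))
          (5000 * (val_size (enc_query I h) + 1) ^ 2) 10"
      proof (rule computes_main[OF refl root_less])
        show "orc (enc_knap_orientkd (small_instance I)) = enc_list enc_nat (\<rho> # us)"
          "orc (enc_knap_orientkd (large_instance I)) = enc_list enc_nat (\<rho> # us')"
          using P(1) P'(1) us by simp_all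
      qed (use paths root_less in \<open>auto simp: paths_def vs_def us\<close>)
      moreover have "deadline_program \<noteq> []" using length_deadline_program by force
      ultimately show ?thesis
        unfolding decides_def run_def computes_def poly_cost_poly by blast
    qed
    then have "follows I (decides deadline_program orc cost_poly I) (walk W 0 vs) []"
      by (rule follows_walk) auto
    with walk show "\<exists>\<pi>. follows I (decides deadline_program orc cost_poly I) \<pi> [] \<and> corrko_feasible I \<pi> \<and>
        (\<forall>\<sigma>. corrko_feasible I \<sigma> \<longrightarrow> corrko_value I \<sigma> \<le> 30 * \<alpha> * corrko_value I \<pi>)"
      by blast
  qed
qed

end
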